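(* Let admissible data be given (either the discrete-coupling or the continuous-coupling case, as defined in the context), and let $K>0$ be such that $P_\infty(K)>Q_\infty(K)$. Then $$P_L(K)\to P_\infty(K)\qquad\text{as }L\to\infty .$$ Moreover, let $(W_L)_{L\ge1}$ be any family such that for each finite $L\geq 1$ the function $W_L\in\mathcal{C}_{L,K}$ is a maximizer of $\mathcal{P}_L$ on $\mathcal{C}_{L,K}$, i.e. $\mathcal{P}_L(W_L)=P_L(K)$. Then $W_L$ converges, as $L\to\infty$ along subsequences and in a strong $L^2$-sense, to a maximizer $W_\infty$ of $\mathcal{P}_\infty$ on $\mathcal{C}_{\infty,K}$; that is, with $\widetilde W_L:=W_L$ on $(-L,L)$ and $\widetilde W_L:=0$ on $\mathbb{R}\setminus(-L,L)$, every sequence $L_n\to\infty$ has a subsequence along which $\widetilde W_{L_n}$ converges strongly in $L^2(\mathbb{R})$ to some $W_\infty\in\mathcal{C}_{\infty,K}$ with $\mathcal{P}_\infty(W_\infty)=P_\infty(K)$.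
   Context: For $0<L<\infty$ let $I_L=(-L,L)$ and let $L^2(I_L)$ be the space of $2L$-periodic functions $W:\mathbb{R}\to\mathbb{R}$ with $\|W\|_2^2=\int_{I_L}W^2dx<\infty$. For $L=\infty$ let $I_\infty=\mathbb{R}$ and $L^2(I_\infty)=L^2(\mathbb{R})$. For $\xi>0$ let $(\mathcal{A}_\xi W)(x):=\int_{x-\xi/2}^{x+\xi/2}W(\tilde x)\,d\tilde x$ (periodic functions being integrated as functions on $\mathbb{R}$). A smooth function $\Phi:[0,\infty)\to[0,\infty)$ is called weakly super-quadratic if it is not identically zero and $\Phi(0)=\Phi'(0)=0$, $\Phi''(r)r\ge\Phi'(r)\ge0$ for all $r\ge0$; here smooth means three times continuously differentiable on $[0,\infty)$. Admissible data are one of the following. (Discrete coupling) $M\in\mathbb{N}$, $M\ge1$, numbers $0<\xi_1<\dots<\xi_M<\infty$, and weakly super-quadratic functions $\Phi_1,\dots,\Phi_M$. One sets $$\mathcal{P}_L(W)=\sum_{m=1}^M\int_{I_L}\Phi_m(\mathcal{A}_{\xi_m}W)\,dx,\quad \mathcal{Q}_L(W)=\sum_{m=1}^M\tfrac12\Phi_m''(0)\int_{I_L}(\mathcal{A}_{\xi_m}W)^2dx.$$ (Continuous coupling) A weakly super-quadratic $\Phi$ and nonnegative measurable functions $\alpha,\beta$ on $(0,\infty)$ such that for all $K>0$ $$\int_0^\infty(\xi+\xi^2)\,\alpha(\xi)\beta(\xi)^2\,\phi\big(\xi^{1/2}\beta(\xi)\sqrt{2K}\big)\,d\xi<\infty,\qquad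 \phi(r):=r^{-1}|\Phi'(r)|.$$ One sets $$\mathcal{P}_L(W)=\int_0^\infty\int_{I_L}\alpha(\xi)\Phi(\beta(\xi)\mathcal{A}_\xi W)\,dx\,d\xi,\quad \mathcal{Q}_L(W)=\tfrac12\Phi''(0)\int_0^\infty\alpha(\xi)\beta(\xi)^2\int_{I_L}(\mathcal{A}_\xi W)^2dx\,d\xi.$$ For $0<L\le\infty$, $\mathcal{C}_L$ is the closure in $L^2(I_L)$ of the set of all $W\in C_c^\infty(I_L)$ (extended $2L$-periodically if $L<\infty$) with $W(x)=W(-x)\ge0$ and $-W'(x)=W'(-x)\ge0$ for all $x\in I_L$, $x\ge0$ (even, nonnegative, unimodal functions). Put $\mathcal{K}_L(W)=\tfrac12\|W\|_2^2$ and $\mathcal{C}_{L,K}=\{W\in\mathcal{C}_L:\mathcal{P}_L(W)>0,\ \mathcal{K}_L(W)=K\}$, $P_L(K)=\sup\{\mathcal{P}_L(W):W\in\mathcal{C}_{L,K}\}$, $Q_\infty(K)=\sup\{\mathcal{Q}_\infty(W):W\in\mathcal{C}_{\infty,K}\}$.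
   Formalization: For continuous coupling it is additionally assumed that P_L(K) is finite for all sufficiently large finite L; the integrability condition does not guarantee this, and the claim fails without it (e.g. Φ(r)=e^r-1-r, β=ξ^(-1/2), α=ξ^(-3) on ξ>1, K large). *)

theory Defs
  imports "HOL-Analysis.Analysis"
begin

text \<open>The half-length \<open>L\<close> is an extended real, so that the periodic case \<open>0 < L < \<infinity>\<close> and the
  case \<open>L = \<infinity>\<close> share all definitions. Elements of \<open>L2 L\<close> are functions, not equivalence
  classes modulo null sets.\<close>

definition Ivl :: "ereal \<Rightarrow> real set" where
  "Ivl L = {x. - L < ereal x \<and> ereal x < L}"

definition periodic :: "ereal \<Rightarrow> (real \<Rightarrow> real) \<Rightarrow> bool" where
  "periodic L W \<longleftrightarrow> (L < \<infinity> \<longrightarrow> (\<forall>x. W (x + 2 * real_of_ereal L) = W x))"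

definition L2 :: "ereal \<Rightarrow> (real \<Rightarrow> real) set" where
  "L2 L = {W \<in> borel_measurable lebesgue.
     periodic L W \<and> set_integrable lebesgue (Ivl L) (\<lambda>x. (W x)\<^sup>2)}"

definition L2norm :: "ereal \<Rightarrow> (real \<Rightarrow> real) \<Rightarrow> real" where
  "L2norm L W = sqrt (LINT x:Ivl L|lebesgue. (W x)\<^sup>2)"

definition avg :: "real \<Rightarrow> (real \<Rightarrow> real) \<Rightarrow> real \<Rightarrow> real" where
  "avg \<xi> W x = (LINT t:{x - \<xi> / 2 .. x + \<xi> / 2}|lebesgue. W t)"


text \<open>Derivatives on \<open>[0, \<infinity>)\<close>, one-sided at \<open>0\<close>; the values of \<open>f\<close> at negative arguments
  play no role.\<close>

definition hderiv :: "(real \<Rightarrow> real) \<Rightarrow> real \<Rightarrow> real" where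
  "hderiv f r = vector_derivative f (at r within {0..})"

primrec C_halfline :: "nat \<Rightarrow> (real \<Rightarrow> real) \<Rightarrow> bool" where
  "C_halfline 0 f \<longleftrightarrow> continuous_on {0..} f"
| "C_halfline (Suc k) f \<longleftrightarrow> f differentiable_on {0..} \<and> C_halfline k (hderiv f)"

definition weakly_super_quadratic :: "(real \<Rightarrow> real) \<Rightarrow> bool" where
  "weakly_super_quadratic \<Phi> \<longleftrightarrow>
     C_halfline 3 \<Phi> \<and> (\<forall>r\<ge>0. \<Phi> r \<ge> 0) \<and> (\<exists>r\<ge>0. \<Phi> r \<noteq> 0) \<and>
     \<Phi> 0 = 0 \<and> hderiv \<Phi> 0 = 0 \<and>
     (\<forall>r\<ge>0. hderiv (hderiv \<Phi>) r * r \<ge> hderiv \<Phi> r \<and> hderiv \<Phi> r \<ge> 0)"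


text \<open>\<open>Discrete M \<xi> \<Phi>\<close> uses only the indices \<open>1, \<dots>, M\<close>.\<close>

datatype coupling =
    is_Discrete: Discrete nat "nat \<Rightarrow> real" "nat \<Rightarrow> real \<Rightarrow> real"
  | is_Continuous: Continuous "real \<Rightarrow> real" "real \<Rightarrow> real" "real \<Rightarrow> real"

text \<open>In the integrability condition the quotient \<open>\<bar>\<Phi>'(r)\<bar> / r\<close> has \<open>r = 0\<close> only where
  \<open>\<beta> \<xi> = 0\<close>, and there the prefactor vanishes.\<close>

fun admissible :: "coupling \<Rightarrow> bool" where
  "admissible (Discrete M \<xi> \<Phi>) \<longleftrightarrow>
     M \<ge> 1 \<and> (\<forall>m\<in>{1..M}. 0 < \<xi> m) \<and> strict_mono_on {1..M} \<xi> \<and>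
     (\<forall>m\<in>{1..M}. weakly_super_quadratic (\<Phi> m))"
| "admissible (Continuous \<alpha> \<beta> \<Phi>) \<longleftrightarrow>
     weakly_super_quadratic \<Phi> \<and>
     \<alpha> \<in> borel_measurable (lebesgue_on {0<..}) \<and>
     \<beta> \<in> borel_measurable (lebesgue_on {0<..}) \<and>
     (\<forall>\<xi>>0. 0 \<le> \<alpha> \<xi> \<and> 0 \<le> \<beta> \<xi>) \<and>
     (\<forall>K>0. let \<phi> = (\<lambda>r. \<bar>hderiv \<Phi> r\<bar> / r) in
       (\<integral>\<^sup>+\<xi>\<in>{0<..}. ennreal ((\<xi> + \<xi>\<^sup>2) * \<alpha> \<xi> * (\<beta> \<xi>)\<^sup>2
           * \<phi> (sqrt \<xi> * \<beta> \<xi> * sqrt (2 * K))) \<partial>lebesgue) < \<infinity>)"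

text \<open>All integrands of the two functionals are nonnegative when \<open>W\<close> is nonnegative, so the
  functionals take values in \<open>[0, \<infinity>]\<close>; no value is silently replaced by \<open>0\<close> in case of
  divergence.\<close>

fun P_func :: "coupling \<Rightarrow> ereal \<Rightarrow> (real \<Rightarrow> real) \<Rightarrow> ennreal" where
  "P_func (Discrete M \<xi> \<Phi>) L W =
     (\<Sum>m=1..M. \<integral>\<^sup>+x\<in>Ivl L. ennreal (\<Phi> m (avg (\<xi> m) W x)) \<partial>lebesgue)"
| "P_func (Continuous \<alpha> \<beta> \<Phi>) L W =
     (\<integral>\<^sup>+\<xi>\<in>{0<..}. (\<integral>\<^sup>+x\<in>Ivl L. ennreal (\<alpha> \<xi> * \<Phi> (\<beta> \<xi> * avg \<xi> W x)) \<partial>lebesgue) \<partial>lebesgue)"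

fun Q_func :: "coupling \<Rightarrow> ereal \<Rightarrow> (real \<Rightarrow> real) \<Rightarrow> ennreal" where
  "Q_func (Discrete M \<xi> \<Phi>) L W =
     (\<Sum>m=1..M. ennreal (hderiv (hderiv (\<Phi> m)) 0 / 2)
        * (\<integral>\<^sup>+x\<in>Ivl L. ennreal ((avg (\<xi> m) W x)\<^sup>2) \<partial>lebesgue))"
| "Q_func (Continuous \<alpha> \<beta> \<Phi>) L W =
     ennreal (hderiv (hderiv \<Phi>) 0 / 2)
        * (\<integral>\<^sup>+\<xi>\<in>{0<..}. ennreal (\<alpha> \<xi> * (\<beta> \<xi>)\<^sup>2)
             * (\<integral>\<^sup>+x\<in>Ivl L. ennreal ((avg \<xi> W x)\<^sup>2) \<partial>lebesgue) \<partial>lebesgue)"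


definition Cc_infty :: "real set \<Rightarrow> (real \<Rightarrow> real) set" where
  "Cc_infty S = {f. (\<forall>n x. (deriv ^^ n) f differentiable at x) \<and>
     (\<exists>C. compact C \<and> C \<subseteq> S \<and> (\<forall>x. x \<notin> C \<longrightarrow> f x = 0))}"

text \<open>For finite \<open>L\<close> a member of \<open>unimodal_smooth L\<close> is the periodic extension of some
  \<open>f \<in> Cc_infty (Ivl L)\<close>; note that \<open>f\<close> vanishes at \<open>\<plusminus>L\<close>.\<close>

definition unimodal_smooth :: "ereal \<Rightarrow> (real \<Rightarrow> real) set" where
  "unimodal_smooth L = {W. periodic L W \<and>
     (\<exists>f\<in>Cc_infty (Ivl L).
        (\<forall>x\<in>Ivl L. 0 \<le> x \<longrightarrow> f x = f (- x) \<and> f (- x) \<ge> 0 \<and>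
                  - deriv f x = deriv f (- x) \<and> deriv f (- x) \<ge> 0) \<and>
        (\<forall>x. - L \<le> ereal x \<and> ereal x \<le> L \<longrightarrow> W x = f x))}"

definition cone :: "ereal \<Rightarrow> (real \<Rightarrow> real) set" where
  "cone L = {W \<in> L2 L. \<forall>\<epsilon>>0. \<exists>V\<in>unimodal_smooth L. L2norm L (\<lambda>x. W x - V x) < \<epsilon>}"

definition cone_K :: "coupling \<Rightarrow> ereal \<Rightarrow> real \<Rightarrow> (real \<Rightarrow> real) set" where
  "cone_K D L K = {W \<in> cone L. P_func D L W > 0 \<and> (L2norm L W)\<^sup>2 / 2 = K}"

definition P_sup :: "coupling \<Rightarrow> ereal \<Rightarrow> real \<Rightarrow> ennreal" where
  "P_sup D L K = (SUP W\<in>cone_K D L K. P_func D L W)"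

text \<open>For continuous coupling and finite \<open>L\<close>, a window of length \<open>\<xi> > 2 * L\<close> covers several
  periods, and the integrability condition in \<open>admissible\<close> does not bound such contributions:
  for \<open>\<Phi> r = exp r - 1 - r\<close>, \<open>\<beta> \<xi> = 1 / sqrt \<xi>\<close> and \<open>\<alpha> \<xi> = (if \<xi> > 1 then 1 / \<xi>^3 else 0)\<close>
  one has \<open>P_sup D L K = \<infinity>\<close> for all \<open>K > 0\<close> and \<open>0 < L < \<infinity>\<close>, whereas \<open>P_sup D \<infinity> K < \<infinity>\<close>.
  For discrete coupling \<open>P_sup\<close> is always finite.\<close>

definition Q_sup :: "coupling \<Rightarrow> real \<Rightarrow> ennreal" where
  "Q_sup D K = (SUP W\<in>cone_K D \<infinity> K. Q_func D \<infinity> W)"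

definition maximizer :: "coupling \<Rightarrow> ereal \<Rightarrow> real \<Rightarrow> (real \<Rightarrow> real) \<Rightarrow> bool" where
  "maximizer D L K W \<longleftrightarrow> W \<in> cone_K D L K \<and> P_func D L W = P_sup D L K"

definition trunc :: "ereal \<Rightarrow> (real \<Rightarrow> real) \<Rightarrow> real \<Rightarrow> real" where
  "trunc L W x = (if x \<in> Ivl L then W x else 0)"

end

theory Submission
  imports Defs "HOL-Probability.Helly_Selection" "HOL-Library.Periodic_Fun"
begin

text \<open>
  Both couplings have the form \<open>P L W = \<integral> (\<integral> F\<^sub>i (avg (\<xi> i) W x) dx) d\<nu>(i)\<close> with \<open>F\<^sub>i r = r^2 * h\<^sub>i r\<close>, where
  super-quadraticity makes \<open>h\<^sub>i\<close> nondecreasing and \<open>h\<^sub>i 0\<close> is the coefficient of the quadratic part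
  \<open>Q\<close>. The proof is a concentration-compactness argument for functions \<open>W\<^sub>n\<close> of squared norm
  \<open>B = 2 * K\<close> in the cones of half-length \<open>l\<^sub>n \<rightarrow> \<infinity>\<close>.

  Monotonicity gives the decay \<open>2 * \<bar>x\<bar> * W\<^sub>n(x)^2 \<le> B\<close>, so Helly's theorem yields an a.e. limit \<open>w\<close>
  of a subsequence, with squared norm \<open>N \<le> B\<close> (\<open>cone_compactness\<close>). The missing mass \<open>B - N\<close> has
  either concentrated at \<open>0\<close>, where averaging over a window of positive width makes it invisible,
  or spread out, where \<open>W\<^sub>n\<close> is uniformly small and only the quadratic part of \<open>F\<^sub>i\<close> counts. Young's
  inequality for the average then gives
  \<open>limsup P (l\<^sub>n) W\<^sub>n \<le> P \<infinity> w + q * (B - N)\<close> with \<open>q = \<integral> h\<^sub>i 0 * (\<xi> i)^2 d\<nu>(i)\<close> (\<open>limsup_P\<close>).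

  Let \<open>S\<close> be the supremum of \<open>P \<infinity>\<close> at mass \<open>B\<close>. Rescaling \<open>w\<close> to mass \<open>B\<close> gives
  \<open>P \<infinity> w \<le> (N / B) * S\<close> (\<open>P_le_fraction\<close>), and flattening a fixed profile shows that \<open>q * B\<close> is at
  most the supremum of \<open>Q\<close> (\<open>q_le\<close>), which is less than \<open>S\<close>. Thus the limsup is bounded by a convex
  combination of \<open>S\<close> and something smaller: it never exceeds \<open>S\<close>, and it reaches \<open>S\<close> only if
  \<open>N = B\<close> and \<open>w\<close> is a maximizer (\<open>concentration\<close>). In that case no norm is lost, and a.e. convergence
  is strong convergence (\<open>N2_scheffe\<close>). Conversely, smooth compactly supported near-maximizers on the
  line can be extended periodically, which gives the lower bound for \<open>P_sup\<close> at large half-length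
  (\<open>S_tendsto\<close>).

  Windows longer than a period see several copies of \<open>W\<close> and are not covered by the decay estimate.
  For discrete coupling they do not occur once \<open>l\<close> is large. For continuous coupling, testing the
  finiteness of \<open>P_sup\<close> at one half-length with one periodic bump yields an integrable bound that
  dominates them at all sufficiently large half-lengths (\<open>tail_of_finite\<close>, \<open>energy_large\<close>).
\<close>

section \<open>Weakly super-quadratic functions\<close>

lemma hderiv_has_real_derivative:
  assumes "f differentiable_on {0..}" "0 \<le> r"
  shows "(f has_real_derivative hderiv f r) (at r within {0..})"
  using assms unfolding hderiv_def differentiable_on_def
  by (auto simp: has_real_derivative_iff_has_vector_derivative vector_derivative_works[symmetric])

text \<open>The value at \<open>0\<close> is the limit of \<open>\<Phi> r / r^2\<close>, which makes the quotient continuous on the closed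
  half-line.\<close>

definition quad_quotient :: "(real \<Rightarrow> real) \<Rightarrow> real \<Rightarrow> real" where
  "quad_quotient \<Phi> r = (if r = 0 then hderiv (hderiv \<Phi>) 0 / 2 else \<Phi> r / r^2)"

context
  fixes \<Phi> :: "real \<Rightarrow> real"
  assumes wsq: "weakly_super_quadratic \<Phi>"
begin

lemma wsq_deriv:
  shows "0 \<le> r \<Longrightarrow> (\<Phi> has_real_derivative hderiv \<Phi> r) (at r within {0..})"
    and "0 \<le> r \<Longrightarrow> (hderiv \<Phi> has_real_derivative hderiv (hderiv \<Phi>) r) (at r within {0..})"
  using wsq hderiv_has_real_derivative[of \<Phi>] hderiv_has_real_derivative[of "hderiv \<Phi>"]
  by (auto simp: weakly_super_quadratic_def numeral_3_eq_3)

lemma wsq_deriv_at: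
  assumes "0 < r"
  shows "(\<Phi> has_real_derivative hderiv \<Phi> r) (at r)"
    and "(hderiv \<Phi> has_real_derivative hderiv (hderiv \<Phi>) r) (at r)"
proof -
  have "at r within {0..} = at r"
    using assms at_within_interior[of r "{0..}"] by (simp add: interior_Ici[of _ "-1"])
  then show "(\<Phi> has_real_derivative hderiv \<Phi> r) (at r)"
    "(hderiv \<Phi> has_real_derivative hderiv (hderiv \<Phi>) r) (at r)"
    using wsq_deriv[of r] assms by simp_all
qed

lemma wsq_facts:
  shows "\<Phi> 0 = 0" "hderiv \<Phi> 0 = 0"
    and "0 \<le> r \<Longrightarrow> 0 \<le> \<Phi> r" "0 \<le> r \<Longrightarrow> 0 \<le> hderiv \<Phi> r"
    and "0 \<le> r \<Longrightarrow> hderiv \<Phi> r \<le> hderiv (hderiv \<Phi>) r * r"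
  using wsq by (auto simp: weakly_super_quadratic_def)

lemma wsq_continuous:
  "continuous_on {0..} \<Phi>" "continuous_on {0..} (hderiv \<Phi>)"
  by (auto simp: continuous_on_eq_continuous_within intro!: DERIV_continuous wsq_deriv)

text \<open>The hypothesis \<open>\<Phi>'' r * r \<ge> \<Phi>' r\<close> is the sign of the derivative of \<open>\<Phi>' r / r\<close>.\<close>

lemma wsq_slope_mono:
  assumes "0 < s" "s \<le> r"
  shows "hderiv \<Phi> s / s \<le> hderiv \<Phi> r / r"
proof (rule DERIV_nonneg_imp_increasing_open[OF assms(2), of "\<lambda>x. hderiv \<Phi> x / x"])
  fix x assume x: "s < x" "x < r"
  then have "((\<lambda>x. hderiv \<Phi> x / x) has_real_derivative
      (hderiv (hderiv \<Phi>) x * x - hderiv \<Phi> x * 1) / (x * x)) (at x)"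
    using assms by (intro DERIV_divide wsq_deriv_at DERIV_ident) auto
  moreover have "(hderiv (hderiv \<Phi>) x * x - hderiv \<Phi> x * 1) / (x * x) \<ge> 0"
    using wsq_facts(5)[of x] x assms by (intro divide_nonneg_nonneg) auto
  ultimately show "\<exists>y. ((\<lambda>x. hderiv \<Phi> x / x) has_real_derivative y) (at x) \<and> y \<ge> 0" by blast
next
  show "continuous_on {s..r} (\<lambda>x. hderiv \<Phi> x / x)"
    using assms by (intro continuous_intros continuous_on_subset[OF wsq_continuous(2)]) auto
qed

lemma wsq_slope_tendsto:
  "((\<lambda>r. hderiv \<Phi> r / r) \<longlongrightarrow> hderiv (hderiv \<Phi>) 0) (at_right 0)"
proof -
  have "((\<lambda>y. (hderiv \<Phi> y - hderiv \<Phi> 0) / (y - 0)) \<longlongrightarrow> hderiv (hderiv \<Phi>) 0) (at 0 within {0..})"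
    using wsq_deriv(2)[of 0] by (simp add: has_field_derivative_iff)
  then have "((\<lambda>y. hderiv \<Phi> y / y) \<longlongrightarrow> hderiv (hderiv \<Phi>) 0) (at 0 within {0..})"
    by (simp add: wsq_facts)
  then show ?thesis
    by (rule tendsto_within_subset) auto
qed

lemma wsq_slope_ge:
  assumes "0 \<le> s"
  shows "hderiv (hderiv \<Phi>) 0 * s \<le> hderiv \<Phi> s"
proof (cases "s = 0")
  case False
  then have "0 < s" using assms by simp
  have "hderiv (hderiv \<Phi>) 0 \<le> hderiv \<Phi> s / s"
  proof (rule tendsto_upperbound[OF wsq_slope_tendsto])
    show "\<forall>\<^sub>F r in at_right 0. hderiv \<Phi> r / r \<le> hderiv \<Phi> s / s"
      using \<open>0 < s\<close> by (auto simp: eventually_at_right_field intro!: exI[of _ s] wsq_slope_mono)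
  qed simp
  then show ?thesis using \<open>0 < s\<close> by (simp add: field_simps)
qed (simp add: wsq_facts)

text \<open>On \<open>[0, r]\<close> the slope of \<open>\<Phi>\<close> stays below that of the parabola with the same slope at \<open>r\<close>.\<close>

lemma wsq_upper:
  assumes "0 < r" shows "\<Phi> r \<le> hderiv \<Phi> r / r * r^2 / 2"
proof -
  define p where "p = hderiv \<Phi> r / r"
  have "p * 0^2 / 2 - \<Phi> 0 \<le> p * r^2 / 2 - \<Phi> r"
  proof (rule DERIV_nonneg_imp_increasing_open[of 0 r "\<lambda>x. p * x^2 / 2 - \<Phi> x"])
    fix x assume x: "0 < x" "x < r"
    have "((\<lambda>x. p * x^2 / 2 - \<Phi> x) has_real_derivative (p * x - hderiv \<Phi> x)) (at x)"
      using x by (auto intro!: derivative_eq_intros wsq_deriv_at)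
    moreover have "0 \<le> p * x - hderiv \<Phi> x"
      using wsq_slope_mono[of x r] x by (simp add: p_def field_simps)
    ultimately show "\<exists>y. ((\<lambda>x. p * x^2 / 2 - \<Phi> x) has_real_derivative y) (at x) \<and> 0 \<le> y" by blast
  next
    show "continuous_on {0..r} (\<lambda>x. p * x^2 / 2 - \<Phi> x)"
      by (intro continuous_intros continuous_on_subset[OF wsq_continuous(1)]) auto
  qed (use assms in auto)
  then show ?thesis by (simp add: p_def wsq_facts)
qed

lemma wsq_lower:
  assumes "0 \<le> r" shows "hderiv (hderiv \<Phi>) 0 * r^2 / 2 \<le> \<Phi> r"
proof -
  define p where "p = hderiv (hderiv \<Phi>) 0"
  have "\<Phi> 0 - p * 0^2 / 2 \<le> \<Phi> r - p * r^2 / 2"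
  proof (rule DERIV_nonneg_imp_increasing_open[of 0 r "\<lambda>x. \<Phi> x - p * x^2 / 2"])
    fix x assume x: "0 < x" "x < r"
    have "((\<lambda>x. \<Phi> x - p * x^2 / 2) has_real_derivative (hderiv \<Phi> x - p * x)) (at x)"
      using x by (auto intro!: derivative_eq_intros wsq_deriv_at)
    moreover have "0 \<le> hderiv \<Phi> x - p * x"
      using wsq_slope_ge[of x] x by (simp add: p_def)
    ultimately show "\<exists>y. ((\<lambda>x. \<Phi> x - p * x^2 / 2) has_real_derivative y) (at x) \<and> 0 \<le> y" by blast
  next
    show "continuous_on {0..r} (\<lambda>x. \<Phi> x - p * x^2 / 2)"
      by (intro continuous_intros continuous_on_subset[OF wsq_continuous(1)]) auto
  qed (use assms in auto)
  then show ?thesis by (simp add: p_def wsq_facts)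
qed

lemma wsq_eq_quotient: "0 \<le> r \<Longrightarrow> \<Phi> r = r^2 * quad_quotient \<Phi> r"
  by (simp add: quad_quotient_def wsq_facts)

lemma quad_quotient_bounds:
  assumes "0 < r"
  shows "hderiv (hderiv \<Phi>) 0 / 2 \<le> quad_quotient \<Phi> r"
    and "quad_quotient \<Phi> r \<le> hderiv \<Phi> r / r / 2"
  using wsq_lower[of r] wsq_upper[of r] assms by (simp_all add: quad_quotient_def field_simps)

lemma quad_quotient_at_0_nonneg: "0 \<le> quad_quotient \<Phi> 0"
proof -
  have "0 \<le> hderiv (hderiv \<Phi>) 0"
  proof (rule tendsto_lowerbound[OF wsq_slope_tendsto])
    show "\<forall>\<^sub>F r in at_right 0. 0 \<le> hderiv \<Phi> r / r"
      by (auto simp: eventually_at_right_field intro!: exI[of _ 1] divide_nonneg_pos wsq_facts)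
  qed simp
  then show ?thesis by (simp add: quad_quotient_def)
qed

text \<open>The derivative of \<open>\<Phi> r / r^2\<close> has the sign of \<open>r * \<Phi>' r - 2 * \<Phi> r\<close>, which is nonnegative by
  \<open>wsq_upper\<close>. This monotonicity is what the rest of the proof retains of super-quadraticity.\<close>

lemma quad_quotient_mono:
  assumes "0 \<le> s" "s \<le> r"
  shows "quad_quotient \<Phi> s \<le> quad_quotient \<Phi> r"
proof (cases "s = 0")
  case True
  then show ?thesis using assms quad_quotient_bounds(1)[of r]
    by (cases "r = 0") (auto simp: quad_quotient_def)
next
  case False
  then have s: "0 < s" using assms by simp
  have "\<Phi> s / s^2 \<le> \<Phi> r / r^2"
  proof (rule DERIV_nonneg_imp_increasing_open[OF assms(2), of "\<lambda>x. \<Phi> x / x^2"])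
    fix x assume x: "s < x" "x < r"
    then have "((\<lambda>x. \<Phi> x / x^2) has_real_derivative
        (hderiv \<Phi> x * x^2 - \<Phi> x * (2 * x)) / (x^2 * x^2)) (at x)"
      using s by (auto intro!: derivative_eq_intros wsq_deriv_at)
    moreover have "(hderiv \<Phi> x * x^2 - \<Phi> x * (2 * x)) / (x^2 * x^2) \<ge> 0"
    proof (intro divide_nonneg_nonneg)
      have "2 * \<Phi> x \<le> hderiv \<Phi> x * x"
        using wsq_upper[of x] x s by (simp add: power2_eq_square field_simps)
      then have "2 * \<Phi> x * x \<le> hderiv \<Phi> x * x * x"
        using x s by (intro mult_right_mono) auto
      then show "0 \<le> hderiv \<Phi> x * x^2 - \<Phi> x * (2 * x)"
        by (simp add: power2_eq_square algebra_simps)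
    qed auto
    ultimately show "\<exists>y. ((\<lambda>x. \<Phi> x / x^2) has_real_derivative y) (at x) \<and> y \<ge> 0" by blast
  next
    show "continuous_on {s..r} (\<lambda>x. \<Phi> x / x^2)"
      using s by (intro continuous_intros continuous_on_subset[OF wsq_continuous(1)]) auto
  qed
  then show ?thesis using s assms by (simp add: quad_quotient_def)
qed

lemma quad_quotient_continuous: "continuous_on {0..} (quad_quotient \<Phi>)"
proof -
  have "continuous (at r within {0..}) (quad_quotient \<Phi>)" if r: "0 \<le> r" for r
  proof (cases "r = 0")
    case True
    have "(quad_quotient \<Phi> \<longlongrightarrow> hderiv (hderiv \<Phi>) 0 / 2) (at_right 0)"
    proof (rule tendsto_sandwich)
      show "\<forall>\<^sub>F r in at_right 0. hderiv (hderiv \<Phi>) 0 / 2 \<le> quad_quotient \<Phi> r"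
        "\<forall>\<^sub>F r in at_right 0. quad_quotient \<Phi> r \<le> hderiv \<Phi> r / r / 2"
        by (rule eventually_mono[OF eventually_at_right_less[of 0] quad_quotient_bounds(1)];simp)
          (rule eventually_mono[OF eventually_at_right_less[of 0] quad_quotient_bounds(2)];simp)
      show "((\<lambda>r. hderiv \<Phi> r / r / 2) \<longlongrightarrow> hderiv (hderiv \<Phi>) 0 / 2) (at_right 0)"
        by (intro tendsto_intros wsq_slope_tendsto) auto
    qed auto
    moreover have "at (0::real) within {0..} = at_right 0"
      by (rule at_within_nhd[of _ UNIV]) auto
    ultimately show ?thesis
      using True by (simp add: continuous_within quad_quotient_def)
  next
    case False
    then have "0 < r" using r by simp
    have "continuous_on {0<..} (quad_quotient \<Phi>)"
    proof (subst continuous_on_cong[OF refl])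
      show "quad_quotient \<Phi> x = \<Phi> x / x^2" if "x \<in> {0<..}" for x
        using that by (simp add: quad_quotient_def)
      show "continuous_on {0<..} (\<lambda>x. \<Phi> x / x^2)"
        by (intro continuous_intros continuous_on_subset[OF wsq_continuous(1)]) auto
    qed
    then have "isCont (quad_quotient \<Phi>) r"
      using \<open>0 < r\<close> by (simp add: continuous_on_eq_continuous_at)
    then show ?thesis by (rule continuous_at_imp_continuous_within)
  qed
  then show ?thesis by (simp add: continuous_on_eq_continuous_within)
qed

end

section \<open>Smoothness of products, reciprocals and dilations\<close>

text \<open>Recursion through \<open>deriv f\<close> instead of iterated derivatives of \<open>f\<close> is what makes the product and
  reciprocal rules inductive: their derivatives are again sums and products of admissible
  functions.\<close>

primrec diff_times :: "nat \<Rightarrow> (real \<Rightarrow> real) \<Rightarrow> bool" where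
  "diff_times 0 f \<longleftrightarrow> (\<forall>x. f differentiable at x)"
| "diff_times (Suc n) f \<longleftrightarrow> (\<forall>x. f differentiable at x) \<and> diff_times n (deriv f)"

lemma diff_times_iff: "diff_times n f \<longleftrightarrow> (\<forall>k\<le>n. \<forall>x. (deriv ^^ k) f differentiable at x)"
proof (induction n arbitrary: f)
  case (Suc n)
  have "(\<forall>k\<le>Suc n. P k) \<longleftrightarrow> P 0 \<and> (\<forall>k\<le>n. P (Suc k))" for P
    by (metis Suc_le_mono le0 not0_implies_Suc)
  then show ?case by (simp add: Suc funpow_swap1)
qed simp

lemma smooth_iff_diff_times:
  "(\<forall>n x. (deriv ^^ n) f differentiable at x) \<longleftrightarrow> (\<forall>n. diff_times n f)"
  by (auto simp: diff_times_iff)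

lemma diff_times_differentiable: "diff_times n f \<Longrightarrow> f differentiable at x"
  by (cases n) auto

lemma diff_times_DERIV: "diff_times n f \<Longrightarrow> DERIV f x :> deriv f x"
  using diff_times_differentiable DERIV_deriv_iff_real_differentiable by blast

lemma diff_times_Suc_D: "diff_times (Suc n) f \<Longrightarrow> diff_times n f"
  by (auto simp: diff_times_iff)

lemma diff_times_const: "diff_times n (\<lambda>x. c)"
proof (induction n arbitrary: c)
  case (Suc n)
  have "deriv (\<lambda>x. c) = (\<lambda>x. 0)" by (rule ext) (simp add: deriv_const)
  then show ?case using Suc by simp
qed simp

lemma diff_times_add:
  "diff_times n f \<Longrightarrow> diff_times n g \<Longrightarrow> diff_times n (\<lambda>x. f x + g x)"
proof (induction n arbitrary: f g)
  case (Suc n)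
  have "deriv (\<lambda>x. f x + g x) = (\<lambda>x. deriv f x + deriv g x)"
    using Suc.prems by (intro ext DERIV_imp_deriv DERIV_add diff_times_DERIV)
  then show ?case using Suc by simp
qed simp

lemma diff_times_mult:
  "diff_times n f \<Longrightarrow> diff_times n g \<Longrightarrow> diff_times n (\<lambda>x. f x * g x)"
proof (induction n arbitrary: f g)
  case (Suc n)
  have "deriv (\<lambda>x. f x * g x) = (\<lambda>x. deriv f x * g x + deriv g x * f x)"
    using Suc.prems by (intro ext DERIV_imp_deriv DERIV_mult diff_times_DERIV)
  moreover have "diff_times n (\<lambda>x. deriv f x * g x + deriv g x * f x)"
    using Suc by (intro diff_times_add Suc.IH) (auto intro: diff_times_Suc_D)
  ultimately show ?case using Suc by simp
qed simp

lemma diff_times_inverse: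
  assumes "\<And>x. f x \<noteq> 0"
  shows "diff_times n f \<Longrightarrow> diff_times n (\<lambda>x. inverse (f x))"
proof (induction n)
  case (Suc n)
  have "deriv (\<lambda>x. inverse (f x)) = (\<lambda>x. (-1) * (deriv f x * (inverse (f x) * inverse (f x))))"
  proof (rule ext)
    fix x
    have "DERIV (\<lambda>x. inverse (f x)) x :> - (inverse (f x) * deriv f x * inverse (f x))"
      using DERIV_inverse'[OF diff_times_DERIV[OF Suc.prems] assms] by simp
    then show "deriv (\<lambda>x. inverse (f x)) x = (-1) * (deriv f x * (inverse (f x) * inverse (f x)))"
      using DERIV_imp_deriv by (fastforce simp: mult_ac)
  qed
  moreover have "diff_times n (\<lambda>x. (-1) * (deriv f x * (inverse (f x) * inverse (f x))))"
    using Suc diff_times_Suc_D[OF Suc.prems]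
    by (intro diff_times_mult diff_times_const) auto
  ultimately show ?case using Suc assms by simp
qed (use assms in auto)

lemma diff_times_dilate:
  "diff_times n f \<Longrightarrow> diff_times n (\<lambda>x. f (c * x))"
proof (induction n arbitrary: f)
  case 0
  then show ?case
    by (auto intro!: differentiable_compose[of f "\<lambda>x. c * x" _ UNIV, simplified])
next
  case (Suc n)
  have "DERIV (\<lambda>x. f (c * x)) x :> deriv f (c * x) * c" for x
    by (rule DERIV_chain2[OF diff_times_DERIV[OF Suc.prems]]) (auto intro!: derivative_eq_intros)
  then have "deriv (\<lambda>x. f (c * x)) = (\<lambda>x. deriv f (c * x) * c)"
    by (intro ext DERIV_imp_deriv)
  moreover have "diff_times n (\<lambda>x. deriv f (c * x) * c)"
    using Suc by (intro diff_times_mult diff_times_const) auto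
  ultimately show ?case using Suc 
    by (auto intro!: differentiable_compose[of f "\<lambda>x. c * x" _ UNIV, simplified])
qed

section \<open>Smooth even unimodal functions and their periodic extensions\<close>

lemma Ivl_simps: "Ivl (ereal l) = {-l<..<l}" "Ivl \<infinity> = UNIV"
  by (auto simp: Ivl_def)

text \<open>These are the members of \<open>unimodal_smooth \<infinity>\<close>. Stating unimodality as monotonicity instead of as
  a sign of the derivative makes products, dilations and truncations immediate.\<close>

definition bumps :: "(real \<Rightarrow> real) set" where
  "bumps = {f. (\<forall>n. diff_times n f) \<and> (\<exists>b. \<forall>x. b \<le> \<bar>x\<bar> \<longrightarrow> f x = 0) \<and>
     (\<forall>x. f (- x) = f x) \<and> (\<forall>x. 0 \<le> f x) \<and> (\<forall>x y. 0 \<le> x \<longrightarrow> x \<le> y \<longrightarrow> f y \<le> f x)}"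

lemma bumpsD:
  assumes "f \<in> bumps"
  shows "diff_times n f" "f (- x) = f x" "0 \<le> f x" "0 \<le> x \<Longrightarrow> x \<le> y \<Longrightarrow> f y \<le> f x"
  using assms by (auto simp: bumps_def)

lemma bumps_support:
  assumes "f \<in> bumps" obtains b where "0 < b" "\<And>x. b \<le> \<bar>x\<bar> \<Longrightarrow> f x = 0"
proof -
  obtain b where "\<forall>x. b \<le> \<bar>x\<bar> \<longrightarrow> f x = 0" using assms by (auto simp: bumps_def)
  then show thesis by (intro that[of "max b 1"]) auto
qed

lemma bumps_abs: "f \<in> bumps \<Longrightarrow> f \<bar>x\<bar> = f x"
  by (cases "0 \<le> x") (auto simp: bumpsD)

lemma bumps_antimono: "f \<in> bumps \<Longrightarrow> \<bar>x\<bar> \<le> \<bar>y\<bar> \<Longrightarrow> f y \<le> f x"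
  using bumpsD(4)[of f "\<bar>x\<bar>" "\<bar>y\<bar>"] bumps_abs by fastforce

lemma bumps_continuous: "f \<in> bumps \<Longrightarrow> continuous_on S f"
  by (intro continuous_at_imp_continuous_on ballI differentiable_imp_continuous_within)
     (rule diff_times_differentiable[OF bumpsD(1)[where n=0]])

lemma bumps_borel [measurable_dest]: "f \<in> bumps \<Longrightarrow> f \<in> borel_measurable borel"
  by (intro borel_measurable_continuous_onI bumps_continuous)

lemma bumps_lebesgue: "f \<in> bumps \<Longrightarrow> f \<in> borel_measurable lebesgue"
  using bumps_borel by (intro measurable_completion) auto

lemma bumps_mult: "f \<in> bumps \<Longrightarrow> g \<in> bumps \<Longrightarrow> (\<lambda>x. f x * g x) \<in> bumps"
  unfolding bumps_def by (auto intro!: diff_times_mult mult_mono)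

lemma bumps_cmult: "f \<in> bumps \<Longrightarrow> 0 \<le> a \<Longrightarrow> (\<lambda>x. a * f x) \<in> bumps"
  unfolding bumps_def by (auto intro!: diff_times_mult diff_times_const mult_mono)

lemma bumps_dilate:
  assumes "f \<in> bumps" "0 < c" shows "(\<lambda>x. f (c * x)) \<in> bumps"
proof -
  obtain b where b: "0 < b" "\<And>x. b \<le> \<bar>x\<bar> \<Longrightarrow> f x = 0" using bumps_support[OF assms(1)] by blast
  have "\<forall>x. b / c \<le> \<bar>x\<bar> \<longrightarrow> f (c * x) = 0"
    using assms b by (auto simp: abs_mult field_simps)
  then show ?thesis
    using assms unfolding bumps_def by (auto intro!: diff_times_dilate)
qed

text \<open>The function \<open>y / (1 + y / k)\<close> is a smooth nondecreasing substitute for \<open>min y k\<close>.\<close>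

lemma bumps_truncate:
  assumes "f \<in> bumps" "0 < k" shows "(\<lambda>x. f x / (1 + f x / k)) \<in> bumps"
proof -
  have nz: "1 + f x * (1 / k) \<noteq> 0" for x
    using bumpsD(3)[OF assms(1), of x] assms by (metis add_nonneg_pos add.commute divide_nonneg_pos less_irrefl mult.right_neutral times_divide_eq_right zero_less_one)
  have "f y / (1 + f y / k) \<le> f x / (1 + f x / k)" if "0 \<le> x" "x \<le> y" for x y
    using bumpsD(3)[OF assms(1), of x] bumpsD(3)[OF assms(1), of y] bumpsD(4)[OF assms(1) that] assms
    by (simp add: divide_simps add_nonneg_pos add_pos_nonneg) (simp add: algebra_simps)
  moreover have "diff_times n (\<lambda>x. f x / (1 + f x / k))" for n
  proof -
    have "diff_times n (\<lambda>x. f x * inverse (1 + f x * (1 / k)))"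
      using assms nz
      by (intro diff_times_mult diff_times_inverse diff_times_add diff_times_const bumpsD(1)) auto
    then show ?thesis by (simp add: divide_inverse)
  qed
  ultimately show ?thesis
    using assms unfolding bumps_def by (auto intro!: divide_nonneg_nonneg add_nonneg_nonneg)
qed

lemma DERIV_even:
  fixes f :: "real \<Rightarrow> real"
  assumes "\<And>x. f (- x) = f x" "\<And>x. f differentiable at x"
  shows "deriv f (- x) = - deriv f x"
proof -
  have "DERIV f (-x) :> deriv f (-x)" using assms(2) DERIV_deriv_iff_real_differentiable by blast
  then have "DERIV (\<lambda>x. f (- x)) x :> deriv f (- x) * (-1)"
    by (rule DERIV_chain2) (auto intro!: derivative_eq_intros)
  then have "DERIV f x :> deriv f (- x) * (-1)" by (simp add: assms(1))
  then show ?thesis using DERIV_imp_deriv by force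
qed

lemma bumps_deriv:
  assumes "f \<in> bumps" "0 \<le> x"
  shows "deriv f (- x) = - deriv f x" "deriv f x \<le> 0"
proof -
  have d: "f differentiable at x" for x by (rule diff_times_differentiable[OF bumpsD(1)[OF assms(1), of 0]])
  show "deriv f (- x) = - deriv f x"
    by (rule DERIV_even) (auto simp: bumpsD[OF assms(1)] d)
  show "deriv f x \<le> 0"
  proof (rule ccontr)
    assume "\<not> deriv f x \<le> 0"
    then obtain e where "0 < e" "\<And>h. 0 < h \<Longrightarrow> h < e \<Longrightarrow> f x < f (x + h)"
      using DERIV_pos_inc_right[of f "deriv f x" x] d DERIV_deriv_iff_real_differentiable
      by (metis not_le_imp_less)
    from this(2)[of "e/2"] this(1) bumpsD(4)[OF assms(1), of x "x + e/2"] assms(2)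
    show False by simp
  qed
qed

text \<open>The floor selects the representative of \<open>x\<close> modulo \<open>2 * l\<close> in \<open>[-l, l)\<close>.\<close>

definition periodize :: "real \<Rightarrow> (real \<Rightarrow> real) \<Rightarrow> real \<Rightarrow> real" where
  "periodize l f x = f (x - 2 * l * of_int \<lfloor>(x + l) / (2 * l)\<rfloor>)"

lemma periodize_eq:
  assumes "0 < l" "-l \<le> x" "x < l" shows "periodize l f x = f x"
proof -
  have "\<lfloor>(x + l) / (2 * l)\<rfloor> = 0" using assms by (simp add: floor_eq_iff)
  then show ?thesis by (simp add: periodize_def)
qed

lemma periodize_periodic:
  assumes "0 < l" shows "periodic (ereal l) (periodize l f)"
proof -
  have "(x + 2 * l + l) / (2 * l) = (x + l) / (2 * l) + of_int 1" for x
    using assms by (simp add: field_simps)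
  then have "\<lfloor>(x + 2 * l + l) / (2 * l)\<rfloor> = \<lfloor>(x + l) / (2 * l)\<rfloor> + 1" for x
    by (metis floor_add_int)
  then show ?thesis by (simp add: periodic_def periodize_def algebra_simps)
qed

lemma periodize_borel:
  assumes "f \<in> bumps" shows "periodize l f \<in> borel_measurable borel"
proof -
  have [measurable]: "f \<in> borel_measurable borel" using assms by (rule bumps_borel)
  have "(\<lambda>x. f (x - 2 * l * real_of_int \<lfloor>(x + l) / (2 * l)\<rfloor>)) \<in> borel_measurable borel"
    by measurable
  then show ?thesis unfolding periodize_def[abs_def] .
qed

lemma periodize_unimodal:
  assumes "f \<in> bumps" "0 < l" "b < l" "\<And>x. b \<le> \<bar>x\<bar> \<Longrightarrow> f x = 0"
  shows "periodize l f \<in> unimodal_smooth (ereal l)"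
proof -
  have "\<forall>n x. (deriv ^^ n) f differentiable at x"
    using assms(1) by (simp add: smooth_iff_diff_times bumpsD)
  moreover have "x \<notin> {-b..b} \<Longrightarrow> f x = 0" for x using assms(4)[of x] by auto
  moreover have "{-b..b} \<subseteq> Ivl (ereal l)" using assms by (auto simp: Ivl_simps)
  ultimately have "f \<in> Cc_infty (Ivl (ereal l))"
    unfolding Cc_infty_def by (blast intro: compact_Icc)
  moreover have "periodize l f x = f x" if "-l \<le> x" "x \<le> l" for x
  proof (cases "x = l")
    case True
    \<comment> \<open>at the right end point the floor jumps and the value is \<open>f (- l)\<close>, which is \<open>0\<close> like \<open>f l\<close>\<close>
    have "(l + l) / (2 * l) = 1" using assms by simp
    then have "periodize l f x = f (- l)" using True by (simp add: periodize_def)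
    then show ?thesis using assms True by simp
  qed (use that assms periodize_eq in auto)
  ultimately show ?thesis
    unfolding unimodal_smooth_def using assms(1,2)
    by (auto intro!: bexI[of _ f] periodize_periodic simp: bumpsD bumps_deriv)
qed

lemma bumps_imp_unimodal: "f \<in> bumps \<Longrightarrow> f \<in> unimodal_smooth \<infinity>"
proof -
  assume f: "f \<in> bumps"
  obtain b where b: "0 < b" "\<And>x. b \<le> \<bar>x\<bar> \<Longrightarrow> f x = 0" using bumps_support[OF f] by blast
  have "\<forall>n x. (deriv ^^ n) f differentiable at x"
    using f by (simp add: smooth_iff_diff_times bumpsD)
  moreover have "x \<notin> {-b..b} \<Longrightarrow> f x = 0" for x using b(2)[of x] by auto
  ultimately have "f \<in> Cc_infty (Ivl \<infinity>)"
    unfolding Cc_infty_def Ivl_simps by (blast intro: compact_Icc)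
  then show ?thesis
    unfolding unimodal_smooth_def using f
    by (auto intro!: bexI[of _ f] simp: bumpsD bumps_deriv periodic_def)
qed

text \<open>The profile of a periodic unimodal function, extended by \<open>0\<close> outside one period, is a bump on the
  line. This is how the cones for different half-lengths are compared.\<close>

lemma unimodal_imp_bumps:
  assumes W: "W \<in> unimodal_smooth L" and L: "0 < L"
  obtains f where "f \<in> bumps" "\<And>x. x \<notin> Ivl L \<Longrightarrow> f x = 0" "\<And>x. x \<in> Ivl L \<Longrightarrow> W x = f x"
proof -
  obtain f where f: "f \<in> Cc_infty (Ivl L)"
    and ev: "\<And>x. x \<in> Ivl L \<Longrightarrow> 0 \<le> x \<Longrightarrow> f x = f (- x) \<and> f (- x) \<ge> 0 \<and>
                  - deriv f x = deriv f (- x) \<and> deriv f (- x) \<ge> 0"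
    and eq: "\<And>x. - L \<le> ereal x \<Longrightarrow> ereal x \<le> L \<Longrightarrow> W x = f x"
    using W by (auto simp: unimodal_smooth_def)
  obtain C where C: "compact C" "C \<subseteq> Ivl L" "\<And>x. x \<notin> C \<Longrightarrow> f x = 0"
    using f by (auto simp: Cc_infty_def)
  have out: "f x = 0" if "x \<notin> Ivl L" for x using C that by blast
  have neg: "- x \<in> Ivl L \<longleftrightarrow> x \<in> Ivl L" for x
    by (cases L) (auto simp: Ivl_def)
  have dt: "diff_times n f" for n using f by (auto simp: Cc_infty_def smooth_iff_diff_times)
  have even: "f (- x) = f x" for x
    using ev[of x] ev[of "-x"] neg[of x] out[of x] out[of "-x"]
    by (metis minus_minus neg_0_le_iff_le linear)
  have nn: "0 \<le> f x" for x
    using ev[of "\<bar>x\<bar>"] out[of x] even[of x] neg[of x] by (cases "x \<in> Ivl L"; cases "0 \<le> x") auto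
  have dec: "f y \<le> f x" if "0 \<le> x" "x \<le> y" for x y
  proof (cases "y \<in> Ivl L")
    case True
    show ?thesis
    proof (rule DERIV_nonpos_imp_nonincreasing[OF that(2)])
      fix t assume t: "x \<le> t" "t \<le> y"
      have "0 < L" by fact
      then have "t \<in> Ivl L" using True t that
        by (cases L) (auto simp: Ivl_def)
      then have "deriv f t \<le> 0" using ev[of t] t that by auto
      then show "\<exists>y. DERIV f t :> y \<and> y \<le> 0" using diff_times_DERIV[OF dt] by blast
    qed
  qed (use out nn in auto)
  obtain b where "\<And>x. x \<in> C \<Longrightarrow> \<bar>x\<bar> \<le> b"
    using compact_imp_bounded[OF C(1)] by (auto simp: bounded_real)
  then have "\<forall>x. b + 1 \<le> \<bar>x\<bar> \<longrightarrow> f x = 0" using C(3) by force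
  then have "f \<in> bumps" unfolding bumps_def using dt even nn dec by auto
  moreover have "W x = f x" if "x \<in> Ivl L" for x
    using that by (intro eq) (auto simp: Ivl_def)
  ultimately show thesis using that out by blast
qed

section \<open>Squared norms and the cones\<close>

text \<open>The squared norm as an extended real, which spares all integrability side conditions.\<close>

definition N2 :: "real set \<Rightarrow> (real \<Rightarrow> real) \<Rightarrow> ennreal" where
  "N2 S w = (\<integral>\<^sup>+x\<in>S. ennreal ((w x)^2) \<partial>lebesgue)"

lemma Ivl_sets [measurable, simp]: "Ivl L \<in> sets borel"
  unfolding Ivl_def by measurable

lemma Ivl_lebesgue [simp]: "Ivl L \<in> sets lebesgue"
  using Ivl_sets by auto

lemma N2_trunc: "N2 UNIV (trunc L W) = N2 (Ivl L) W"
  unfolding N2_def trunc_def by (intro nn_integral_cong) (auto simp: indicator_def)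

lemma N2_mono_set: "S \<subseteq> T \<Longrightarrow> N2 S w \<le> N2 T w"
  unfolding N2_def by (rule nn_set_integral_set_mono)

lemma N2_cong: "(\<And>x. x \<in> S \<Longrightarrow> u x = v x) \<Longrightarrow> N2 S u = N2 S v"
  unfolding N2_def by (intro nn_integral_cong) (auto simp: indicator_def)

lemma N2_cmult:
  assumes [measurable]: "w \<in> borel_measurable lebesgue" "S \<in> sets lebesgue"
  shows "N2 S (\<lambda>x. a * w x) = ennreal (a^2) * N2 S w"
proof -
  have "N2 S (\<lambda>x. a * w x) = (\<integral>\<^sup>+x. ennreal (a^2) * (ennreal ((w x)^2) * indicator S x) \<partial>lebesgue)"
    unfolding N2_def by (intro nn_integral_cong) (auto simp: power_mult_distrib ennreal_mult mult_ac)
  also have "\<dots> = ennreal (a^2) * N2 S w"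
    unfolding N2_def using assms by (intro nn_integral_cmult) measurable
  finally show ?thesis .
qed

lemma N2_add_le:
  assumes [measurable]: "u \<in> borel_measurable lebesgue" "v \<in> borel_measurable lebesgue" "S \<in> sets lebesgue"
  shows "N2 S (\<lambda>x. u x + v x) \<le> 2 * N2 S u + 2 * N2 S v"
proof -
  have "(u x + v x)^2 \<le> 2 * (u x)^2 + 2 * (v x)^2" for x
    using sum_squares_bound[of "u x" "v x"] by (simp add: power2_sum)
  then have "ennreal ((u x + v x)^2) \<le> ennreal (2 * (u x)^2 + 2 * (v x)^2)" for x
    by (rule ennreal_leI)
  then have "ennreal ((u x + v x)^2) \<le> 2 * ennreal ((u x)^2) + 2 * ennreal ((v x)^2)" for x
    by (simp add: ennreal_mult)
  then have "N2 S (\<lambda>x. u x + v x) \<le> (\<integral>\<^sup>+x. 2 * (ennreal ((u x)^2) * indicator S x)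
      + 2 * (ennreal ((v x)^2) * indicator S x) \<partial>lebesgue)"
    unfolding N2_def by (intro nn_integral_mono) (auto simp: indicator_def)
  also have "\<dots> = 2 * N2 S u + 2 * N2 S v"
    unfolding N2_def by (simp add: nn_integral_add nn_integral_cmult)
  finally show ?thesis .
qed

lemma set_integrable_square_iff:
  assumes [measurable]: "w \<in> borel_measurable lebesgue" "S \<in> sets lebesgue"
  shows "set_integrable lebesgue S (\<lambda>x. (w x)^2) \<longleftrightarrow> N2 S w < \<infinity>"
proof -
  have "(\<integral>\<^sup>+x. ennreal (norm (indicator S x *\<^sub>R (w x)^2)) \<partial>lebesgue) = N2 S w"
    unfolding N2_def by (intro nn_integral_cong) (auto simp: indicator_def)
  then show ?thesis
    unfolding set_integrable_def integrable_iff_bounded by simp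
qed

lemma L2norm_N2:
  assumes [measurable]: "w \<in> borel_measurable lebesgue" and "N2 (Ivl L) w < \<infinity>"
  shows "ennreal ((L2norm L w)^2) = N2 (Ivl L) w"
proof -
  have i: "set_integrable lebesgue (Ivl L) (\<lambda>x. (w x)^2)"
    using assms by (simp add: set_integrable_square_iff)
  have nn: "0 \<le> (LINT x:Ivl L|lebesgue. (w x)^2)"
    unfolding set_lebesgue_integral_def by (intro integral_nonneg_AE) auto
  have "N2 (Ivl L) w = (\<integral>\<^sup>+x. ennreal (indicator (Ivl L) x *\<^sub>R (w x)^2) \<partial>lebesgue)"
    unfolding N2_def by (intro nn_integral_cong) (auto simp: indicator_def)
  also have "\<dots> = ennreal (LINT x:Ivl L|lebesgue. (w x)^2)"
    using i unfolding set_lebesgue_integral_def set_integrable_def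
    by (intro nn_integral_eq_integral) auto
  finally show ?thesis using nn by (simp add: L2norm_def)
qed

lemma L2_iff: "W \<in> L2 L \<longleftrightarrow> W \<in> borel_measurable lebesgue \<and> periodic L W \<and> N2 (Ivl L) W < \<infinity>"
  unfolding L2_def by (auto simp: set_integrable_square_iff)

lemma trunc_measurable:
  assumes [measurable]: "W \<in> borel_measurable lebesgue"
  shows "trunc L W \<in> borel_measurable lebesgue"
proof -
  have "trunc L W = (\<lambda>x. indicator (Ivl L) x * W x)"
    by (rule ext) (simp add: trunc_def)
  moreover have "(\<lambda>x. indicator (Ivl L) x * W x) \<in> borel_measurable lebesgue"
    using borel_measurable_times[OF borel_measurable_indicator[OF Ivl_lebesgue] assms] by simp
  ultimately show ?thesis by simp
qed

lemma bumps_N2_finite: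
  assumes f: "f \<in> bumps" shows "N2 S f < \<infinity>"
proof -
  obtain b where b: "0 < b" "\<And>x. b \<le> \<bar>x\<bar> \<Longrightarrow> f x = 0" using bumps_support[OF f] by blast
  have "N2 S f \<le> (\<integral>\<^sup>+x. ennreal ((f 0)^2) * indicator {-b..b} x \<partial>lebesgue)"
    unfolding N2_def
  proof (intro nn_integral_mono)
    fix x
    have "(f x)^2 \<le> (f 0)^2" using bumps_antimono[OF f, of 0 x] bumpsD(3)[OF f, of x]
      by (intro power_mono) auto
    then show "ennreal ((f x)^2) * indicator S x \<le> ennreal ((f 0)^2) * indicator {- b..b} x"
      using b(2)[of x] by (cases "x \<in> {-b..b}") (auto simp: indicator_def abs_le_iff ennreal_leI)
  qed
  also have "\<dots> < \<infinity>"
    using b(1) by (subst nn_integral_cmult_indicator) (simp_all add: ennreal_mult_less_top)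
  finally show ?thesis .
qed

lemma N2_diff_less_iff:
  assumes "w \<in> borel_measurable lebesgue" "v \<in> borel_measurable lebesgue"
    "N2 (Ivl L) w < \<infinity>" "N2 (Ivl L) v < \<infinity>" "0 < e"
  shows "L2norm L (\<lambda>x. w x - v x) < e \<longleftrightarrow> N2 (Ivl L) (\<lambda>x. w x - v x) < ennreal (e^2)"
proof -
  have "N2 (Ivl L) (\<lambda>x. w x + (-1) * v x) \<le> 2 * N2 (Ivl L) w + 2 * N2 (Ivl L) (\<lambda>x. (-1) * v x)"
    using assms by (intro N2_add_le) auto
  also have "\<dots> < \<infinity>" using assms by (subst N2_cmult) (auto simp: ennreal_mult_less_top)
  finally have fin: "N2 (Ivl L) (\<lambda>x. w x - v x) < \<infinity>" by simp
  have "ennreal ((L2norm L (\<lambda>x. w x - v x))^2) = N2 (Ivl L) (\<lambda>x. w x - v x)"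
    using assms fin by (intro L2norm_N2) auto
  then have "N2 (Ivl L) (\<lambda>x. w x - v x) < ennreal (e^2) \<longleftrightarrow> (L2norm L (\<lambda>x. w x - v x))^2 < e^2"
    using ennreal_less_iff[OF zero_le_power2, of "L2norm L (\<lambda>x. w x - v x)" "e^2"] by simp
  also have "\<dots> \<longleftrightarrow> L2norm L (\<lambda>x. w x - v x) < e"
  proof -
    have "0 \<le> L2norm L (\<lambda>x. w x - v x)"
      unfolding L2norm_def set_lebesgue_integral_def by (intro real_sqrt_ge_zero integral_nonneg_AE) auto
    then show ?thesis using assms(5)
      by (metis less_imp_le not_le pos2 power_mono power_strict_mono)
  qed
  finally show ?thesis by simp
qed

text \<open>All properties of the cones below are derived from bumps through this density.\<close>

lemma cone_approx:
  assumes W: "W \<in> cone L" and L: "0 < L" and e: "0 < e"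
  obtains f where "f \<in> bumps" "\<And>x. x \<notin> Ivl L \<Longrightarrow> f x = 0"
    "N2 UNIV (\<lambda>x. trunc L W x - f x) < ennreal e"
proof -
  have W': "W \<in> borel_measurable lebesgue" "N2 (Ivl L) W < \<infinity>" using W by (auto simp: cone_def L2_iff)
  obtain V where V: "V \<in> unimodal_smooth L" "L2norm L (\<lambda>x. W x - V x) < sqrt e"
    using W real_sqrt_gt_zero[OF e] unfolding cone_def by blast
  obtain f where f: "f \<in> bumps" "\<And>x. x \<notin> Ivl L \<Longrightarrow> f x = 0" "\<And>x. x \<in> Ivl L \<Longrightarrow> V x = f x"
    using unimodal_imp_bumps[OF V(1) L] by blast
  have "L2norm L (\<lambda>x. W x - V x) = L2norm L (\<lambda>x. W x - f x)"
    unfolding L2norm_def using f(3) by (intro arg_cong[where f=sqrt] set_lebesgue_integral_cong) auto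
  then have "N2 (Ivl L) (\<lambda>x. W x - f x) < ennreal ((sqrt e)^2)"
    using V(2) W' e bumps_lebesgue[OF f(1)] bumps_N2_finite[OF f(1)]
    by (subst N2_diff_less_iff[symmetric]) simp_all
  moreover have "N2 (Ivl L) (\<lambda>x. W x - f x) = N2 UNIV (\<lambda>x. trunc L W x - f x)"
    unfolding N2_def trunc_def by (intro nn_integral_cong) (auto simp: indicator_def f)
  ultimately show thesis using e by (intro that[OF f(1,2)]) simp_all
qed

lemma cone_infI:
  assumes w: "w \<in> borel_measurable lebesgue" "N2 UNIV w < \<infinity>"
    and ap: "\<And>e. 0 < e \<Longrightarrow> \<exists>f\<in>bumps. N2 UNIV (\<lambda>x. w x - f x) < ennreal e"
  shows "w \<in> cone \<infinity>"
proof -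
  have "\<exists>V\<in>unimodal_smooth \<infinity>. L2norm \<infinity> (\<lambda>x. w x - V x) < e" if e: "0 < e" for e
  proof -
    obtain f where f: "f \<in> bumps" "N2 UNIV (\<lambda>x. w x - f x) < ennreal (e^2)"
      using ap[OF zero_less_power[OF e, of 2]] by blast
    then have "L2norm \<infinity> (\<lambda>x. w x - f x) < e"
      using e w f(2) N2_diff_less_iff[of w f \<infinity> e] bumps_lebesgue[of f] bumps_N2_finite[of f UNIV]
      by (simp add: Ivl_simps)
    then show ?thesis using bumps_imp_unimodal[OF f(1)] by blast
  qed
  then show ?thesis using w by (auto simp: cone_def L2_iff Ivl_simps periodic_def)
qed

lemma bumps_cone_inf: "f \<in> bumps \<Longrightarrow> f \<in> cone \<infinity>"
  by (rule cone_infI) (use bumps_lebesgue[of f] bumps_N2_finite[of f UNIV] in \<open>auto intro!: bexI[of _ f] simp: N2_def[of _ "\<lambda>x. 0"]\<close>)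

lemma unimodal_imp_cone:
  assumes "W \<in> unimodal_smooth L" "W \<in> L2 L" shows "W \<in> cone L"
proof -
  have "L2norm L (\<lambda>x. W x - W x) = 0"
    unfolding L2norm_def set_lebesgue_integral_def by simp
  then have "\<forall>e>0. \<exists>V\<in>unimodal_smooth L. L2norm L (\<lambda>x. W x - V x) < e"
    using assms(1) by (intro allI impI bexI[of _ W]) simp_all
  then show ?thesis using assms(2) by (simp add: cone_def)
qed

lemma periodize_cone:
  assumes f: "f \<in> bumps" and "0 < l" "b < l" "\<And>x. b \<le> \<bar>x\<bar> \<Longrightarrow> f x = 0"
  shows "periodize l f \<in> cone (ereal l)" "N2 (Ivl (ereal l)) (periodize l f) = N2 UNIV f"
proof -
  have "N2 (Ivl (ereal l)) (periodize l f) = N2 (Ivl (ereal l)) f"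
    using assms by (intro N2_cong) (auto simp: Ivl_simps periodize_eq)
  also have "\<dots> = N2 UNIV f"
  proof -
    have "f x = 0" if "x \<notin> Ivl (ereal l)" for x
      using that assms(3) by (intro assms(4)) (auto simp: Ivl_simps)
    then show ?thesis unfolding N2_def by (intro nn_integral_cong) (auto simp: indicator_def)
  qed
  finally show eq: "N2 (Ivl (ereal l)) (periodize l f) = N2 UNIV f" .
  have "periodize l f \<in> borel_measurable lebesgue"
    using periodize_borel[OF f] by (intro measurable_completion) auto
  then have "periodize l f \<in> L2 (ereal l)"
    using bumps_N2_finite[OF f, of UNIV] periodize_periodic[OF assms(2)] by (simp add: L2_iff eq)
  then show "periodize l f \<in> cone (ereal l)"
    using periodize_unimodal[OF assms] by (rule unimodal_imp_cone[rotated])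
qed

section \<open>Periodic integrals and window averages\<close>

lemma intervals_lebesgue [measurable]:
  fixes a b :: real
  shows "{a..b} \<in> sets lebesgue" "{a..<b} \<in> sets lebesgue" "{a<..<b} \<in> sets lebesgue"
    "Ivl L \<in> sets lebesgue" "(UNIV :: real set) \<in> sets lebesgue"
  by simp_all

lemma measurable_lebesgue_affine:
  fixes c :: real
  assumes "f \<in> borel_measurable lebesgue" "c \<noteq> 0"
  shows "(\<lambda>x. f (t + c * x)) \<in> borel_measurable lebesgue"
proof -
  have "(\<lambda>x::real. t + c * x) \<in> lebesgue \<rightarrow>\<^sub>M lebesgue"
    using lebesgue_affine_measurable[where c="\<lambda>_. c" and t=t] assms(2) by simp
  then show ?thesis using assms(1) by (rule measurable_compose)
qed

lemma nn_integral_lebesgue_shift: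
  fixes t :: real
  assumes "f \<in> borel_measurable lebesgue"
  shows "(\<integral>\<^sup>+x. f (x + t) \<partial>lebesgue) = (\<integral>\<^sup>+x. f x \<partial>lebesgue)"
  using nn_integral_real_affine_lebesgue[OF assms, of 1 t] by (simp add: add.commute)

lemma AE_lebesgue_shift:
  fixes t :: real
  assumes "AE x in lebesgue. Q x"
  shows "AE x in lebesgue. Q (x + t)"
proof -
  have "AE x in lborel. Q x" using assms by (simp add: AE_completion_iff)
  then obtain N where N: "N \<in> null_sets lborel" "{x. \<not> Q x} \<subseteq> N"
    unfolding eventually_ae_filter by auto
  have "{x. x - (- t) \<in> N} \<in> null_sets lborel" by (rule null_sets_translation[OF N(1)])
  then have "AE x in lborel. x - (- t) \<notin> N" using AE_not_in by force
  then have "AE x in lborel. Q (x + t)" using N(2) by (auto elim!: eventually_mono)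
  then show ?thesis by (simp add: AE_completion_iff)
qed

lemma AE_lebesgue_neq: "AE x in lebesgue. x \<noteq> (a::real)"
  by (simp add: AE_completion_iff AE_lborel_singleton)

lemma periodic_of_int:
  fixes f :: "real \<Rightarrow> 'a"
  assumes "\<And>x. f (x + p) = f x" shows "f (x + of_int k * p) = f x"
proof -
  interpret periodic_fun_simple f p by standard (rule assms)
  show ?thesis by (rule plus_of_int)
qed

context
  fixes l :: real and g :: "real \<Rightarrow> ennreal"
  assumes l: "0 < l" and per: "\<And>x. g (x + 2 * l) = g x"
    and meas [measurable]: "g \<in> borel_measurable lebesgue"
begin

lemma period_shift_int:
  "(\<integral>\<^sup>+x\<in>{a + of_int k * (2 * l)..<b + of_int k * (2 * l)}. g x \<partial>lebesgue) = (\<integral>\<^sup>+x\<in>{a..<b}. g x \<partial>lebesgue)"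
proof -
  let ?s = "of_int k * (2 * l)"
  have "(\<integral>\<^sup>+x\<in>{a + ?s..<b + ?s}. g x \<partial>lebesgue)
      = (\<integral>\<^sup>+x. g (x + ?s) * indicator {a + ?s..<b + ?s} (x + ?s) \<partial>lebesgue)"
    by (rule nn_integral_lebesgue_shift[where t="?s"
        and f="\<lambda>x. g x * indicator {a + ?s..<b + ?s} x", symmetric]) measurable
  also have "\<dots> = (\<integral>\<^sup>+x\<in>{a..<b}. g x \<partial>lebesgue)"
    using periodic_of_int[of g "2 * l", OF per] by (intro nn_integral_cong) (auto simp: indicator_def)
  finally show ?thesis .
qed

lemma nn_integral_split_Ico:
  assumes "a \<le> b" "b \<le> c"
  shows "(\<integral>\<^sup>+x\<in>{a..<c}. g x \<partial>lebesgue) = (\<integral>\<^sup>+x\<in>{a..<b}. g x \<partial>lebesgue) + (\<integral>\<^sup>+x\<in>{b..<c}. g x \<partial>lebesgue)"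
proof -
  have "(\<integral>\<^sup>+x\<in>{a..<c}. g x \<partial>lebesgue)
      = (\<integral>\<^sup>+x. g x * indicator {a..<b} x + g x * indicator {b..<c} x \<partial>lebesgue)"
    using assms by (intro nn_integral_cong) (auto simp: indicator_def)
  also have "\<dots> = (\<integral>\<^sup>+x\<in>{a..<b}. g x \<partial>lebesgue) + (\<integral>\<^sup>+x\<in>{b..<c}. g x \<partial>lebesgue)"
    by (intro nn_integral_add) measurable
  finally show ?thesis .
qed

lemma period_integral_eq:
  "(\<integral>\<^sup>+x\<in>{b..<b + 2 * l}. g x \<partial>lebesgue) = (\<integral>\<^sup>+x\<in>{a..<a + 2 * l}. g x \<partial>lebesgue)"
proof -
  have small: "(\<integral>\<^sup>+x\<in>{a + t..<a + t + 2 * l}. g x \<partial>lebesgue) = (\<integral>\<^sup>+x\<in>{a..<a + 2 * l}. g x \<partial>lebesgue)"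
    if "0 \<le> t" "t \<le> 2 * l" for t
    using nn_integral_split_Ico[of a "a + t" "a + 2 * l"]
      nn_integral_split_Ico[of "a + t" "a + 2 * l" "a + t + 2 * l"] that
      period_shift_int[of a 1 "a + t"] by (simp add: add.commute add.left_commute)
  define k where "k = \<lfloor>(b - a) / (2 * l)\<rfloor>"
  define t where "t = b - a - of_int k * (2 * l)"
  have "of_int k \<le> (b - a) / (2 * l)" "(b - a) / (2 * l) < of_int k + 1"
    unfolding k_def by linarith+
  then have "0 \<le> t" "t \<le> 2 * l" using l by (simp_all add: t_def field_simps)
  moreover have "b = a + t + of_int k * (2 * l)" by (simp add: t_def)
  ultimately show ?thesis
    using small[of t] period_shift_int[of "a + t" k "a + t + 2 * l"] by (simp add: algebra_simps)
qed

lemma period_integral_Ivl: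
  "(\<integral>\<^sup>+x\<in>{a..<a + 2 * l}. g x \<partial>lebesgue) = (\<integral>\<^sup>+x\<in>Ivl (ereal l). g x \<partial>lebesgue)"
proof -
  have "(\<integral>\<^sup>+x\<in>{a..<a + 2 * l}. g x \<partial>lebesgue) = (\<integral>\<^sup>+x\<in>{-l..<-l + 2 * l}. g x \<partial>lebesgue)"
    by (rule period_integral_eq)
  also have "\<dots> = (\<integral>\<^sup>+x\<in>Ivl (ereal l). g x \<partial>lebesgue)"
    by (intro nn_integral_cong_AE eventually_mono[OF AE_lebesgue_neq[of "-l"]])
       (auto simp: indicator_def Ivl_simps)
  finally show ?thesis .
qed

lemma periods_integral:
  "(\<integral>\<^sup>+x\<in>{a..<a + real n * (2 * l)}. g x \<partial>lebesgue) = of_nat n * (\<integral>\<^sup>+x\<in>Ivl (ereal l). g x \<partial>lebesgue)"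
proof (induction n)
  case (Suc n)
  have "(\<integral>\<^sup>+x\<in>{a..<a + real (Suc n) * (2 * l)}. g x \<partial>lebesgue)
      = (\<integral>\<^sup>+x\<in>{a..<a + real n * (2 * l)}. g x \<partial>lebesgue)
      + (\<integral>\<^sup>+x\<in>{a + real n * (2 * l)..<(a + real n * (2 * l)) + 2 * l}. g x \<partial>lebesgue)"
    using l nn_integral_split_Ico[of a "a + real n * (2 * l)" "a + real (Suc n) * (2 * l)"]
    by (simp add: algebra_simps)
  then show ?case
    unfolding Suc period_integral_Ivl by (simp add: distrib_right add.commute)
qed simp

end

lemma Ivl_integral_shift:
  fixes g :: "real \<Rightarrow> ennreal"
  assumes L: "0 < L" and per: "\<And>l x. L = ereal l \<Longrightarrow> g (x + 2 * l) = g x"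
    and [measurable]: "g \<in> borel_measurable lebesgue"
  shows "(\<integral>\<^sup>+x\<in>Ivl L. g (x + t) \<partial>lebesgue) = (\<integral>\<^sup>+x\<in>Ivl L. g x \<partial>lebesgue)"
proof (cases L)
  case (real l)
  then have l: "0 < l" using L by simp
  have "(\<integral>\<^sup>+x\<in>Ivl L. g (x + t) \<partial>lebesgue)
      = (\<integral>\<^sup>+x. g (x + t) * indicator {-l + t<..<l + t} (x + t) \<partial>lebesgue)"
    by (intro nn_integral_cong) (auto simp: indicator_def Ivl_simps real)
  also have "\<dots> = (\<integral>\<^sup>+x\<in>{-l + t<..<l + t}. g x \<partial>lebesgue)"
    by (rule nn_integral_lebesgue_shift) measurable
  also have "\<dots> = (\<integral>\<^sup>+x\<in>{-l + t..<(-l + t) + 2 * l}. g x \<partial>lebesgue)"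
    by (intro nn_integral_cong_AE eventually_mono[OF AE_lebesgue_neq[of "-l + t"]])
       (auto simp: indicator_def)
  also have "\<dots> = (\<integral>\<^sup>+x\<in>Ivl L. g x \<partial>lebesgue)"
    unfolding real by (rule period_integral_Ivl[where g=g, OF l per[OF real]]) measurable
  finally show ?thesis .
next
  case PInf
  then show ?thesis using nn_integral_lebesgue_shift[of g t] by (simp add: Ivl_simps)
qed (use L in simp)

text \<open>Almost every point of the line is a translate, by one of countably many periods, of a point in the
  open fundamental interval.\<close>

lemma AE_periodic:
  fixes Q :: "real \<Rightarrow> bool"
  assumes l: "0 < l" and ae: "AE x in lebesgue. x \<in> Ivl (ereal l) \<longrightarrow> Q x"
    and per: "\<And>x. Q (x + 2 * l) = Q x"
  shows "AE x in lebesgue. Q x"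
proof -
  have "AE x in lebesgue. \<forall>k::int. x + of_int k * (2 * l) \<in> Ivl (ereal l) \<longrightarrow> Q (x + of_int k * (2 * l))"
    unfolding AE_all_countable by (intro allI AE_lebesgue_shift[OF ae])
  moreover have "AE x in lebesgue. \<forall>k::int. x + of_int k * (2 * l) \<noteq> - l"
    unfolding AE_all_countable by (intro allI AE_lebesgue_shift[OF AE_lebesgue_neq])
  ultimately show ?thesis
  proof eventually_elim
    case (elim x)
    define k where "k = - \<lfloor>(x + l) / (2 * l)\<rfloor>"
    have "- of_int k \<le> (x + l) / (2 * l)" "(x + l) / (2 * l) < - of_int k + 1"
      unfolding k_def by linarith+
    then have "- l \<le> x + of_int k * (2 * l)" "x + of_int k * (2 * l) < l"
      using l by (simp_all add: field_simps)
    then have "x + of_int k * (2 * l) \<in> Ivl (ereal l)"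
      using elim(2)[rule_format, of k] by (simp add: Ivl_simps)
    then have "Q (x + of_int k * (2 * l))" using elim(1) by blast
    then show ?case using periodic_of_int[of Q "2 * l", OF per] by simp
  qed
qed

text \<open>Window averages depend only on the a.e. class. A Borel representative makes them jointly
  measurable in width and centre, which Lebesgue measurability of \<open>W\<close> alone does not give directly.\<close>

lemma avg_eq_lborel:
  assumes "W \<in> borel_measurable lebesgue"
  obtains w where "w \<in> borel_measurable borel" "AE x in lebesgue. W x = w x"
    "\<And>\<xi> x. avg \<xi> W x = (\<integral>t. indicator {x - \<xi> / 2 .. x + \<xi> / 2} t * w t \<partial>lborel)"
proof -
  obtain w where w: "w \<in> borel_measurable lborel" "AE x in lborel. W x = w x"
    using completion_ex_borel_measurable_real[OF assms] by auto
  have wl: "w \<in> borel_measurable lebesgue" using w(1) by (rule measurable_completion)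
  have wb: "w \<in> borel_measurable borel" using w(1) by simp
  have ae: "AE x in lebesgue. W x = w x" using w(2) by (simp add: AE_completion_iff)
  have "avg \<xi> W x = (\<integral>t. indicator {x - \<xi> / 2 .. x + \<xi> / 2} t * w t \<partial>lborel)" for \<xi> x
  proof -
    have "avg \<xi> W x = (\<integral>t. indicator {x - \<xi> / 2 .. x + \<xi> / 2} t *\<^sub>R w t \<partial>lebesgue)"
      unfolding avg_def set_lebesgue_integral_def
    proof (rule integral_cong_AE)
      show "(\<lambda>t. indicator {x - \<xi> / 2 .. x + \<xi> / 2} t *\<^sub>R W t) \<in> borel_measurable lebesgue"
        using assms by measurable
      show "(\<lambda>t. indicator {x - \<xi> / 2 .. x + \<xi> / 2} t *\<^sub>R w t) \<in> borel_measurable lebesgue"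
        using wl by measurable
    qed (rule eventually_mono[OF ae], simp)
    also have "\<dots> = (\<integral>t. indicator {x - \<xi> / 2 .. x + \<xi> / 2} t *\<^sub>R w t \<partial>lborel)"
    proof (rule integral_completion)
      have "(\<lambda>t. indicator {x - \<xi> / 2 .. x + \<xi> / 2} t *\<^sub>R w t) \<in> borel_measurable borel"
        using wb by measurable
      then show "(\<lambda>t. indicator {x - \<xi> / 2 .. x + \<xi> / 2} t *\<^sub>R w t) \<in> borel_measurable lborel"
        by simp
    qed
    finally show ?thesis by simp
  qed
  then show thesis using that ae wb by blast
qed

lemma avg_borel:
  assumes "W \<in> borel_measurable lebesgue"
  shows "(\<lambda>(\<xi>, x). avg \<xi> W x) \<in> borel_measurable (borel \<Otimes>\<^sub>M borel)"
proof -
  obtain w where [measurable]: "w \<in> borel_measurable borel"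
    and eq: "\<And>\<xi> x. avg \<xi> W x = (\<integral>t. indicator {x - \<xi> / 2 .. x + \<xi> / 2} t * w t \<partial>lborel)"
    using avg_eq_lborel[OF assms] by metis
  have "(\<lambda>p. \<integral>t. (if snd p - fst p / 2 \<le> t \<and> t \<le> snd p + fst p / 2 then 1 else 0) * w t \<partial>lborel)
     \<in> borel_measurable (borel \<Otimes>\<^sub>M borel)"
    by measurable
  moreover have "(\<lambda>p. \<integral>t. (if snd p - fst p / 2 \<le> t \<and> t \<le> snd p + fst p / 2 then 1 else 0) * w t \<partial>lborel)
     = (\<lambda>(\<xi>, x). avg \<xi> W x)"
    unfolding eq by (intro ext) (auto simp: indicator_def split_beta intro!: Bochner_Integration.integral_cong)
  ultimately show ?thesis by simp
qed

lemma avg_measurable [measurable (raw)]: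
  assumes "W \<in> borel_measurable lebesgue" "f \<in> borel_measurable M" "g \<in> borel_measurable M"
  shows "(\<lambda>x. avg (f x) W (g x)) \<in> borel_measurable M"
  using measurable_compose[OF measurable_Pair[OF assms(2,3)] avg_borel[OF assms(1)]] by simp

text \<open>Cauchy-Schwarz on the window.\<close>

lemma avg_sq_le:
  assumes "0 \<le> \<xi>" and [measurable]: "W \<in> borel_measurable lebesgue"
  shows "ennreal ((avg \<xi> W x)^2) \<le> ennreal \<xi> * N2 {x - \<xi> / 2 .. x + \<xi> / 2} W"
proof -
  let ?S = "{x - \<xi> / 2 .. x + \<xi> / 2}"
  define I where "I = (\<integral>\<^sup>+t. ennreal \<bar>indicator ?S t * W t\<bar> * indicator ?S t \<partial>lebesgue)"
  have I: "I = (\<integral>\<^sup>+t. norm (indicator ?S t *\<^sub>R W t) \<partial>lebesgue)"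
    unfolding I_def by (intro nn_integral_cong) (auto simp: indicator_def)
  have "ennreal \<bar>avg \<xi> W x\<bar> \<le> I"
  proof (cases "integrable lebesgue (\<lambda>t. indicator ?S t *\<^sub>R W t)")
    case True
    then show ?thesis unfolding I avg_def set_lebesgue_integral_def
      using integral_norm_bound_ennreal[OF True] by simp
  next
    case False
    then show ?thesis by (simp add: avg_def set_lebesgue_integral_def not_integrable_integral_eq)
  qed
  then have "(ennreal \<bar>avg \<xi> W x\<bar>)^2 \<le> I^2" by (rule power_mono) simp
  also have "\<dots> \<le> (\<integral>\<^sup>+t. (ennreal \<bar>indicator ?S t * W t\<bar>)^2 \<partial>lebesgue) * (\<integral>\<^sup>+t. (indicator ?S t)^2 \<partial>lebesgue)"
    unfolding I_def by (rule Cauchy_Schwarz_nn_integral) measurable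
  also have "(\<integral>\<^sup>+t. (ennreal \<bar>indicator ?S t * W t\<bar>)^2 \<partial>lebesgue) = N2 ?S W"
    unfolding N2_def by (intro nn_integral_cong) (auto simp: indicator_def ennreal_power)
  also have "(\<integral>\<^sup>+t. (indicator ?S t)^2 \<partial>lebesgue) = (\<integral>\<^sup>+t. indicator ?S t \<partial>lebesgue)"
    by (intro nn_integral_cong) (auto simp: indicator_def)
  also have "\<dots> = ennreal \<xi>" using assms(1) by (subst nn_integral_indicator) auto
  finally show ?thesis by (simp add: ennreal_power mult.commute)
qed

lemma N2_window:
  assumes [measurable]: "W \<in> borel_measurable lebesgue"
  shows "N2 {x - \<xi> / 2 .. x + \<xi> / 2} W = (\<integral>\<^sup>+t\<in>{-\<xi> / 2 .. \<xi> / 2}. ennreal ((W (x + t))^2) \<partial>lebesgue)"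
proof -
  have "N2 {x - \<xi> / 2 .. x + \<xi> / 2} W =
      (\<integral>\<^sup>+t. ennreal ((W (t + x))^2) * indicator {x - \<xi> / 2 .. x + \<xi> / 2} (t + x) \<partial>lebesgue)"
    unfolding N2_def
    by (rule nn_integral_lebesgue_shift[where t=x
        and f="\<lambda>t. ennreal ((W t)^2) * indicator {x - \<xi> / 2 .. x + \<xi> / 2} t", symmetric]) measurable
  also have "\<dots> = (\<integral>\<^sup>+t\<in>{-\<xi> / 2 .. \<xi> / 2}. ennreal ((W (x + t))^2) \<partial>lebesgue)"
    by (intro nn_integral_cong) (auto simp: indicator_def add.commute)
  finally show ?thesis .
qed

lemma square_periodic:
  assumes "periodic L W" "L = ereal l" shows "ennreal ((W (x + 2 * l))^2) = ennreal ((W x)^2)"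
  using assms by (simp add: periodic_def)

text \<open>A window no longer than the period fits into a translate of the fundamental interval.\<close>

lemma avg_sq_le_small:
  assumes "0 \<le> \<xi>" "0 < L" "ereal \<xi> \<le> 2 * L" "periodic L W" and [measurable]: "W \<in> borel_measurable lebesgue"
  shows "ennreal ((avg \<xi> W x)^2) \<le> ennreal \<xi> * N2 (Ivl L) W"
proof -
  have "N2 {x - \<xi> / 2 .. x + \<xi> / 2} W = (\<integral>\<^sup>+t\<in>{-\<xi> / 2 .. \<xi> / 2}. ennreal ((W (t + x))^2) \<partial>lebesgue)"
    by (simp add: N2_window add.commute)
  also have "\<dots> \<le> (\<integral>\<^sup>+t\<in>Ivl L. ennreal ((W (t + x))^2) \<partial>lebesgue)"
  proof (intro nn_integral_mono_AE eventually_mono[OF AE_conjI[OF AE_lebesgue_neq[of "-\<xi>/2"] AE_lebesgue_neq[of "\<xi>/2"]]])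
    fix t assume t: "t \<noteq> - \<xi> / 2 \<and> t \<noteq> \<xi> / 2"
    have "t \<in> Ivl L" if "t \<in> {-\<xi> / 2 .. \<xi> / 2}"
      using that t assms(2,3) by (cases L) (auto simp: Ivl_def)
    then show "ennreal ((W (t + x))^2) * indicator {-\<xi> / 2 .. \<xi> / 2} t \<le> ennreal ((W (t + x))^2) * indicator (Ivl L) t"
      by (auto simp: indicator_def)
  qed
  also have "\<dots> = N2 (Ivl L) W"
    unfolding N2_def using assms(2,4) square_periodic
    by (intro Ivl_integral_shift[where g="\<lambda>x. ennreal ((W x)^2)"]) auto
  finally have "N2 {x - \<xi> / 2 .. x + \<xi> / 2} W \<le> N2 (Ivl L) W" .
  then show ?thesis using avg_sq_le[OF assms(1,5), of x] by (meson mult_left_mono order_trans zero_le)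
qed

text \<open>A window of length \<open>\<xi> \<ge> 2 * l\<close> is covered by at most \<open>\<xi> / l\<close> periods.\<close>

lemma avg_sq_le_large:
  assumes "0 < l" "2 * l \<le> \<xi>" "periodic (ereal l) W" and [measurable]: "W \<in> borel_measurable lebesgue"
  shows "ennreal ((avg \<xi> W x)^2) \<le> ennreal (\<xi>^2 / l) * N2 (Ivl (ereal l)) W"
proof -
  define n where "n = nat \<lceil>\<xi> / (2 * l)\<rceil>"
  have "0 < \<xi> / (2 * l)" "1 \<le> \<xi> / (2 * l)" using assms by (auto simp: field_simps)
  then have n: "\<xi> / (2 * l) \<le> n" "real n < \<xi> / (2 * l) + 1" unfolding n_def by linarith+
  have n1: "\<xi> \<le> real n * (2 * l)" using n(1) assms(1) by (simp add: field_simps)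
  have n2: "real n \<le> \<xi> / l" using n(2) \<open>1 \<le> \<xi> / (2 * l)\<close> assms(1) by (simp add: field_simps)
  have "N2 {x - \<xi> / 2 .. x + \<xi> / 2} W \<le> (\<integral>\<^sup>+t\<in>{x - \<xi> / 2..<(x - \<xi> / 2) + real n * (2 * l)}. ennreal ((W t)^2) \<partial>lebesgue)"
    unfolding N2_def using n1
    by (intro nn_integral_mono_AE eventually_mono[OF AE_lebesgue_neq[of "x + \<xi>/2"]])
       (auto simp: indicator_def)
  also have "\<dots> = of_nat n * N2 (Ivl (ereal l)) W"
    unfolding N2_def using assms square_periodic[OF assms(3) refl]
    by (intro periods_integral) auto
  also have "\<dots> \<le> ennreal (\<xi> / l) * N2 (Ivl (ereal l)) W"
    using n2 by (intro mult_right_mono) (auto simp: ennreal_of_nat_eq_real_of_nat intro: ennreal_leI)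
  finally have "ennreal \<xi> * N2 {x - \<xi> / 2 .. x + \<xi> / 2} W \<le> ennreal \<xi> * (ennreal (\<xi> / l) * N2 (Ivl (ereal l)) W)"
    by (rule mult_left_mono) simp
  also have "\<dots> = ennreal (\<xi>^2 / l) * N2 (Ivl (ereal l)) W"
    using assms(1,2) by (simp add: mult.assoc[symmetric] ennreal_mult[symmetric] power2_eq_square)
  finally show ?thesis using avg_sq_le[of \<xi> W x] assms(1,2) by simp
qed

text \<open>Young's inequality \<open>\<parallel>avg \<xi> W\<parallel> \<le> \<xi> * \<parallel>W\<parallel>\<close>: by Cauchy-Schwarz the square of the average is at most
  \<open>\<xi>\<close> times the integral of \<open>(W (x + t))^2\<close> over \<open>\<bar>t\<bar> \<le> \<xi> / 2\<close>; exchange the integrals and use that each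
  translate has the same mass over a period.\<close>

lemma young_avg:
  assumes "0 \<le> \<xi>" "0 < L" "periodic L W" and [measurable]: "W \<in> borel_measurable lebesgue"
  shows "(\<integral>\<^sup>+x\<in>Ivl L. ennreal ((avg \<xi> W x)^2) \<partial>lebesgue) \<le> ennreal (\<xi>^2) * N2 (Ivl L) W"
proof -
  obtain w where [measurable]: "w \<in> borel_measurable borel" and ae: "AE x in lebesgue. W x = w x"
    using avg_eq_lborel[OF assms(4)] by metis
  have shift: "AE x in lebesgue. W (x + t) = w (x + t)" for t by (rule AE_lebesgue_shift[OF ae])
  let ?J = "{-\<xi> / 2 .. \<xi> / 2}"
  have "(\<integral>\<^sup>+x\<in>Ivl L. ennreal ((avg \<xi> W x)^2) \<partial>lebesgue)
      \<le> (\<integral>\<^sup>+x. ennreal \<xi> * (\<integral>\<^sup>+t. ennreal ((w (x + t))^2) * indicator ?J t * indicator (Ivl L) x \<partial>lborel) \<partial>lebesgue)"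
  proof (intro nn_integral_mono)
    fix x
    have "(\<integral>\<^sup>+t\<in>?J. ennreal ((W (x + t))^2) \<partial>lebesgue) = (\<integral>\<^sup>+t\<in>?J. ennreal ((w (x + t))^2) \<partial>lebesgue)"
      using shift[of x] by (intro nn_integral_cong_AE) (auto elim!: eventually_mono simp: add.commute)
    then have "N2 {x - \<xi> / 2 .. x + \<xi> / 2} W = (\<integral>\<^sup>+t\<in>?J. ennreal ((w (x + t))^2) \<partial>lborel)"
      by (simp add: N2_window nn_integral_completion)
    then show "ennreal ((avg \<xi> W x)^2) * indicator (Ivl L) x
        \<le> ennreal \<xi> * (\<integral>\<^sup>+t. ennreal ((w (x + t))^2) * indicator ?J t * indicator (Ivl L) x \<partial>lborel)"
      using avg_sq_le[OF assms(1,4), of x] by (cases "x \<in> Ivl L") auto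
  qed
  also have "\<dots> = (\<integral>\<^sup>+x. ennreal \<xi> * (\<integral>\<^sup>+t. ennreal ((w (x + t))^2) * indicator ?J t * indicator (Ivl L) x \<partial>lborel) \<partial>lborel)"
    by (rule nn_integral_completion)
  also have "\<dots> = ennreal \<xi> * (\<integral>\<^sup>+x. (\<integral>\<^sup>+t. ennreal ((w (x + t))^2) * indicator ?J t * indicator (Ivl L) x \<partial>lborel) \<partial>lborel)"
    by (intro nn_integral_cmult) measurable
  also have "(\<integral>\<^sup>+x. (\<integral>\<^sup>+t. ennreal ((w (x + t))^2) * indicator ?J t * indicator (Ivl L) x \<partial>lborel) \<partial>lborel)
      = (\<integral>\<^sup>+t. (\<integral>\<^sup>+x. ennreal ((w (x + t))^2) * indicator ?J t * indicator (Ivl L) x \<partial>lborel) \<partial>lborel)"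
    by (rule lborel_pair.Fubini') measurable
  also have "\<dots> = (\<integral>\<^sup>+t. N2 (Ivl L) W * indicator ?J t \<partial>lborel)"
  proof (intro nn_integral_cong)
    fix t
    have "(\<integral>\<^sup>+x. ennreal ((w (x + t))^2) * indicator (Ivl L) x \<partial>lborel) = (\<integral>\<^sup>+x\<in>Ivl L. ennreal ((w (x + t))^2) \<partial>lebesgue)"
      by (simp add: nn_integral_completion)
    also have "\<dots> = (\<integral>\<^sup>+x\<in>Ivl L. ennreal ((W (x + t))^2) \<partial>lebesgue)"
      using shift[of t] by (intro nn_integral_cong_AE) (auto elim!: eventually_mono)
    also have "\<dots> = N2 (Ivl L) W"
      unfolding N2_def using assms(2,3) square_periodic
      by (intro Ivl_integral_shift[where g="\<lambda>x. ennreal ((W x)^2)"]) auto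
    finally show "(\<integral>\<^sup>+x. ennreal ((w (x + t))^2) * indicator ?J t * indicator (Ivl L) x \<partial>lborel) = N2 (Ivl L) W * indicator ?J t"
      by (cases "t \<in> ?J") auto
  qed
  also have "\<dots> = N2 (Ivl L) W * ennreal \<xi>"
    using assms(1) by (subst nn_integral_cmult_indicator) auto
  also have "ennreal \<xi> * (N2 (Ivl L) W * ennreal \<xi>) = ennreal (\<xi>^2) * N2 (Ivl L) W"
    using assms(1) by (simp add: power2_eq_square ennreal_mult mult_ac)
  finally show ?thesis .
qed

lemma N2_finite_imp_integrable:
  assumes [measurable]: "W \<in> borel_measurable lebesgue" and fin: "N2 {a..b} W < \<infinity>"
  shows "set_integrable lebesgue {a..b} W"
proof -
  have "set_integrable lebesgue {a..b} (\<lambda>x. 1 + (W x)^2)"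
    using fin set_integrable_square_iff[of W "{a..b}"]
    by (intro set_integral_add) (auto simp: set_integrable_def emeasure_lborel_Icc_eq intro!: integrable_real_indicator)
  then show ?thesis
    unfolding set_integrable_def
  proof (rule Bochner_Integration.integrable_bound)
    have "\<bar>y\<bar> \<le> \<bar>1 + y^2\<bar>" for y :: real
      using sum_squares_bound[of "\<bar>y\<bar>" 1] zero_le_power2[of "y"] by (simp add: abs_of_nonneg)
    then show "AE x in lebesgue. norm (indicator {a..b} x *\<^sub>R W x) \<le> norm (indicator {a..b} x *\<^sub>R (1 + (W x)^2))"
      by (auto simp: indicator_def)
  qed measurable
qed

lemma avg_nonneg:
  assumes "AE x in lebesgue. 0 \<le> W x" shows "0 \<le> avg \<xi> W x"
  unfolding avg_def set_lebesgue_integral_def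
  by (intro integral_nonneg_AE eventually_mono[OF assms]) auto

lemma avg_cmult: "avg \<xi> (\<lambda>x. a * W x) x = a * avg \<xi> W x"
  unfolding avg_def by simp

lemma avg_mono:
  assumes "AE x in lebesgue. 0 \<le> u x" "AE x in lebesgue. u x \<le> v x"
    and "set_integrable lebesgue {x - \<xi> / 2 .. x + \<xi> / 2} v" and [measurable]: "u \<in> borel_measurable lebesgue"
  shows "avg \<xi> u x \<le> avg \<xi> v x"
  unfolding avg_def set_lebesgue_integral_def
  using assms(1,2,3) unfolding set_integrable_def
  by (intro integral_mono_AE') (auto elim!: eventually_elim2 simp: indicator_def)

lemma avg_cong:
  assumes "\<And>t. x - \<xi> / 2 \<le> t \<Longrightarrow> t \<le> x + \<xi> / 2 \<Longrightarrow> u t = v t"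
  shows "avg \<xi> u x = avg \<xi> v x"
  unfolding avg_def set_lebesgue_integral_def using assms
  by (intro Bochner_Integration.integral_cong) (auto simp: indicator_def)

section \<open>Compactness of the cones\<close>

lemma ennreal_weighted_square:
  fixes a b d :: real assumes "0 < d"
  shows "ennreal (a^2) \<le> ennreal (1 + d) * ennreal (b^2) + ennreal (1 + 1 / d) * ennreal ((a - b)^2)"
proof -
  \<comment> \<open>the arithmetic-geometric mean inequality for the cross term \<open>2 * b * (a - b)\<close>\<close>
  have "0 \<le> (sqrt d * b - (a - b) / sqrt d)^2" by simp
  also have "\<dots> = d * b^2 + (a - b)^2 / d - 2 * b * (a - b)"
    using assms by (simp add: power2_diff power_mult_distrib power_divide)
  finally have "2 * b * (a - b) \<le> d * b^2 + (1 / d) * (a - b)^2" by simp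
  moreover have "a^2 = b^2 + 2 * b * (a - b) + (a - b)^2" by (simp add: power2_eq_square algebra_simps)
  ultimately have "a^2 \<le> (1 + d) * b^2 + (1 + 1 / d) * (a - b)^2"
    by (simp only: distrib_right mult_1)
  then have "ennreal (a^2) \<le> ennreal ((1 + d) * b^2 + (1 + 1 / d) * (a - b)^2)" by (rule ennreal_leI)
  also have "\<dots> = ennreal (1 + d) * ennreal (b^2) + ennreal (1 + 1 / d) * ennreal ((a - b)^2)"
    using assms by (simp add: ennreal_plus ennreal_mult)
  finally show ?thesis .
qed

text \<open>A triangle inequality in which all terms stay squared, hence usable with extended reals.
  Optimizing over \<open>d\<close> recovers the usual one in \<open>N2_minkowski\<close>.\<close>

lemma N2_weighted:
  assumes [measurable]: "u \<in> borel_measurable lebesgue" "v \<in> borel_measurable lebesgue" "S \<in> sets lebesgue"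
    and d: "0 < d"
  shows "N2 S u \<le> ennreal (1 + d) * N2 S v + ennreal (1 + 1 / d) * N2 S (\<lambda>x. u x - v x)"
proof -
  have "N2 S u \<le> (\<integral>\<^sup>+x. ennreal (1 + d) * (ennreal ((v x)^2) * indicator S x)
      + ennreal (1 + 1 / d) * (ennreal ((u x - v x)^2) * indicator S x) \<partial>lebesgue)"
    unfolding N2_def using ennreal_weighted_square[OF d]
    by (intro nn_integral_mono) (auto simp: indicator_def)
  also have "\<dots> = ennreal (1 + d) * N2 S v + ennreal (1 + 1 / d) * N2 S (\<lambda>x. u x - v x)"
    unfolding N2_def by (simp add: nn_integral_add nn_integral_cmult)
  finally show ?thesis .
qed

lemma sqrt_le_of_weighted:
  fixes a b c :: real
  assumes "0 \<le> a" "0 \<le> c" and w: "\<And>d. 0 < d \<Longrightarrow> b \<le> (1 + d) * a + (1 + 1 / d) * c"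
  shows "sqrt b \<le> sqrt a + sqrt c"
proof -
  consider "a = 0" | "c = 0" | "0 < a" "0 < c" using assms by linarith
  then show ?thesis
  proof cases
    case 1
    have "b \<le> c + e" if "0 < e" for e
    proof -
      have "b \<le> (1 + 1 / ((c + 1) / e)) * c" using w[of "(c + 1) / e"] assms that 1 by simp
      also have "\<dots> = c + e * (c / (c + 1))" using assms that by (simp add: field_simps)
      also have "\<dots> \<le> c + e * 1" using assms that by (intro add_left_mono mult_left_mono) auto
      finally show ?thesis by simp
    qed
    then have "b \<le> c" by (rule field_le_epsilon)
    then show ?thesis using 1 by simp
  next
    case 2
    have "b \<le> a + e" if "0 < e" for e
    proof -
      have "b \<le> (1 + e / (a + 1)) * a" using w[of "e / (a + 1)"] assms that 2 by simp
      also have "\<dots> = a + e * (a / (a + 1))" using assms that by (simp add: field_simps)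
      also have "\<dots> \<le> a + e * 1" using assms that by (intro add_left_mono mult_left_mono) auto
      finally show ?thesis by simp
    qed
    then have "b \<le> a" by (rule field_le_epsilon)
    then show ?thesis using 2 by simp
  next
    case 3
    define p q where "p = sqrt a" and "q = sqrt c"
    have pq: "0 < p" "0 < q" "a = p^2" "c = q^2" using 3 by (auto simp: p_def q_def)
    \<comment> \<open>the optimal weight is \<open>d = q / p\<close>\<close>
    have "b \<le> (1 + q / p) * p^2 + (1 + 1 / (q / p)) * q^2" using w[of "q / p"] pq by simp
    also have "\<dots> = (p + q)^2" using pq by (simp add: field_simps power2_eq_square)
    finally have "sqrt b \<le> p + q" using pq by (intro real_le_lsqrt) auto
    then show ?thesis by (simp add: p_def q_def)
  qed
qed

lemma N2_diff_commute: "N2 S (\<lambda>x. u x - v x) = N2 S (\<lambda>x. v x - u x)"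
  unfolding N2_def by (simp add: power2_commute)

lemma N2_diff_finite:
  assumes "u \<in> borel_measurable lebesgue" "v \<in> borel_measurable lebesgue" "S \<in> sets lebesgue"
    and "N2 S u < \<infinity>" "N2 S v < \<infinity>"
  shows "N2 S (\<lambda>x. u x - v x) < \<infinity>"
proof -
  have "N2 S (\<lambda>x. u x + (-1) * v x) \<le> 2 * N2 S u + 2 * N2 S (\<lambda>x. (-1) * v x)"
    using assms by (intro N2_add_le) auto
  also have "\<dots> < \<infinity>" using assms by (subst N2_cmult) (auto simp: ennreal_mult_less_top)
  finally show ?thesis by simp
qed

lemma N2_minkowski:
  assumes m: "u \<in> borel_measurable lebesgue" "v \<in> borel_measurable lebesgue" "S \<in> sets lebesgue"
    and fin: "N2 S u < \<infinity>" "N2 S v < \<infinity>"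
  shows "\<bar>sqrt (enn2real (N2 S u)) - sqrt (enn2real (N2 S v))\<bar> \<le> sqrt (enn2real (N2 S (\<lambda>x. u x - v x)))"
proof -
  have *: "sqrt (enn2real (N2 S u)) \<le> sqrt (enn2real (N2 S v)) + sqrt (enn2real (N2 S (\<lambda>x. u x - v x)))"
    if m: "u \<in> borel_measurable lebesgue" "v \<in> borel_measurable lebesgue"
      and fin: "N2 S u < \<infinity>" "N2 S v < \<infinity>" for u v
  proof (rule sqrt_le_of_weighted)
    fix d :: real assume d: "0 < d"
    have e: "ennreal (enn2real x) = x" if "x < \<infinity>" for x
      using that by (intro ennreal_enn2real) simp
    have "ennreal (enn2real (N2 S u)) \<le> ennreal (1 + d) * ennreal (enn2real (N2 S v))
        + ennreal (1 + 1 / d) * ennreal (enn2real (N2 S (\<lambda>x. u x - v x)))"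
      unfolding e[OF fin(1)] e[OF fin(2)] e[OF N2_diff_finite[OF m assms(3) fin]]
      by (rule N2_weighted[OF m assms(3) d])
    also have "\<dots> = ennreal ((1 + d) * enn2real (N2 S v) + (1 + 1 / d) * enn2real (N2 S (\<lambda>x. u x - v x)))"
      using d by (simp add: ennreal_plus ennreal_mult)
    finally show "enn2real (N2 S u) \<le> (1 + d) * enn2real (N2 S v) + (1 + 1 / d) * enn2real (N2 S (\<lambda>x. u x - v x))"
      by (rule iffD1[OF ennreal_le_iff, rotated]) (use d in \<open>intro add_nonneg_nonneg mult_nonneg_nonneg; simp\<close>)
  qed auto
  from *[OF m(1,2) fin] *[OF m(2,1) fin(2,1)] show ?thesis
    by (simp add: N2_diff_commute[of S v u] abs_le_iff)
qed

lemma N2_tendsto: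
  assumes m: "\<And>n. f n \<in> borel_measurable lebesgue" "w \<in> borel_measurable lebesgue" "S \<in> sets lebesgue"
    and fin: "\<And>n. N2 S (f n) < \<infinity>" "N2 S w < \<infinity>"
    and lim: "(\<lambda>n. N2 S (\<lambda>x. w x - f n x)) \<longlonglongrightarrow> 0"
  shows "(\<lambda>n. N2 S (f n)) \<longlonglongrightarrow> N2 S w"
proof -
  define a where "a n = enn2real (N2 S (f n))" for n
  define b where "b = enn2real (N2 S w)"
  define d where "d n = enn2real (N2 S (\<lambda>x. w x - f n x))" for n
  have "d \<longlonglongrightarrow> 0"
    unfolding d_def using lim by (intro tendsto_enn2real) simp_all
  then have d0: "(\<lambda>n. sqrt (d n)) \<longlonglongrightarrow> 0"
    using tendsto_real_sqrt by fastforce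
  have mink: "\<bar>sqrt b - sqrt (a n)\<bar> \<le> sqrt (d n)" for n
    unfolding a_def b_def d_def by (rule N2_minkowski[OF m(2) m(1) m(3) fin(2) fin(1)])
  have "(\<lambda>n. sqrt (a n) - sqrt b) \<longlonglongrightarrow> 0"
  proof (rule Lim_null_comparison[OF always_eventually[OF allI] d0])
    show "norm (sqrt (a n) - sqrt b) \<le> sqrt (d n)" for n
      using mink[of n] unfolding real_norm_def abs_minus_commute[of "sqrt b"] .
  qed
  then have "(\<lambda>n. sqrt (a n)) \<longlonglongrightarrow> sqrt b"
    by (rule LIM_zero_cancel)
  moreover have "0 \<le> a n" "0 \<le> b" for n by (simp_all add: a_def b_def)
  ultimately have "(\<lambda>n. a n) \<longlonglongrightarrow> b"
    using tendsto_power[of "\<lambda>n. sqrt (a n)" "sqrt b" sequentially 2] by simp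
  then have "(\<lambda>n. ennreal (a n)) \<longlonglongrightarrow> ennreal b"
    by (rule tendsto_ennrealI)
  moreover have "ennreal (a n) = N2 S (f n)" for n
    unfolding a_def using fin(1)[of n] by (intro ennreal_enn2real) simp
  moreover have "ennreal b = N2 S w"
    unfolding b_def using fin(2) by (intro ennreal_enn2real) simp
  ultimately show ?thesis by simp
qed

lemma N2_dominated:
  assumes [measurable]: "\<And>n. v n \<in> borel_measurable lebesgue" "b \<in> borel_measurable lebesgue"
    and bd: "\<And>n. AE x in lebesgue. \<bar>v n x\<bar> \<le> b x" and fin: "N2 UNIV b < \<infinity>"
    and lim: "AE x in lebesgue. (\<lambda>n. v n x) \<longlonglongrightarrow> 0"
  shows "(\<lambda>n. N2 UNIV (v n)) \<longlonglongrightarrow> 0"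
proof -
  have "(\<lambda>n. \<integral>\<^sup>+x. ennreal ((v n x)^2) \<partial>lebesgue) \<longlonglongrightarrow> (\<integral>\<^sup>+x. 0 \<partial>(lebesgue :: real measure))"
  proof (rule nn_integral_dominated_convergence)
    show "AE x in lebesgue. ennreal ((v n x)^2) \<le> ennreal ((b x)^2)" for n
      using bd[of n]
    proof eventually_elim
      case (elim x)
      then have "\<bar>v n x\<bar>^2 \<le> (b x)^2" by (rule power_mono) simp
      then show ?case by (intro ennreal_leI) simp
    qed
    show "(\<integral>\<^sup>+x. ennreal ((b x)^2) \<partial>lebesgue) < \<infinity>" using fin by (simp add: N2_def)
    show "AE x in lebesgue. (\<lambda>n. ennreal ((v n x)^2)) \<longlonglongrightarrow> 0"
      using lim
    proof eventually_elim
      case (elim x)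
      then have "(\<lambda>n. ennreal ((v n x)^2)) \<longlonglongrightarrow> ennreal (0^2)" by (intro tendsto_intros)
      then show ?case by simp
    qed
  qed measurable
  then show ?thesis by (simp add: N2_def)
qed

lemma filterlim_at_top_eventually_gt:
  "filterlim l at_top sequentially \<Longrightarrow> \<forall>\<^sub>F n in sequentially. (c::real) < l n"
  by (simp add: filterlim_at_top_dense)

lemma N2_fatou:
  assumes "\<And>n. v n \<in> borel_measurable lebesgue" "S \<in> sets lebesgue"
    and conv: "AE x in lebesgue. (\<lambda>n. v n x) \<longlonglongrightarrow> w x"
  shows "N2 S w \<le> liminf (\<lambda>n. N2 S (v n))"
proof -
  note [measurable] = assms(1,2)
  have "N2 S w = (\<integral>\<^sup>+x. liminf (\<lambda>n. ennreal ((v n x)^2) * indicator S x) \<partial>lebesgue)"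
    unfolding N2_def
  proof (rule nn_integral_cong_AE)
    show "AE x in lebesgue. ennreal ((w x)^2) * indicator S x
        = liminf (\<lambda>n. ennreal ((v n x)^2) * indicator S x)"
      using conv
    proof eventually_elim
      case (elim x)
      have "(\<lambda>n. ennreal ((v n x)^2) * indicator S x) \<longlonglongrightarrow> ennreal ((w x)^2) * indicator S x"
        using tendsto_ennrealI[OF tendsto_power[OF elim]] by (cases "x \<in> S") simp_all
      from lim_imp_Liminf[OF sequentially_bot this] show ?case by simp
    qed
  qed
  also have "\<dots> \<le> liminf (\<lambda>n. N2 S (v n))"
    unfolding N2_def by (intro nn_integral_liminf) measurable
  finally show ?thesis .
qed

lemma N2_split:
  assumes "w \<in> borel_measurable lebesgue" "S \<in> sets lebesgue" "T \<in> sets lebesgue" "T \<subseteq> S"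
  shows "N2 S w = N2 T w + N2 (S - T) w"
proof -
  note [measurable] = assms(1-3)
  have "N2 S w = (\<integral>\<^sup>+x. ennreal ((w x)^2) * indicator T x + ennreal ((w x)^2) * indicator (S - T) x \<partial>lebesgue)"
    unfolding N2_def using assms(4) by (intro nn_integral_cong) (auto simp: indicator_def)
  also have "\<dots> = N2 T w + N2 (S - T) w"
    unfolding N2_def by (intro nn_integral_add) measurable
  finally show ?thesis .
qed

lemma N2_exhaust:
  assumes "w \<in> borel_measurable lebesgue" "N2 UNIV w < \<infinity>"
  shows "(\<lambda>j. N2 {-(real j + a)<..<real j + a} w) \<longlonglongrightarrow> N2 UNIV w"
  unfolding N2_def
proof (rule nn_integral_dominated_convergence)
  note [measurable] = assms(1)
  show "(\<integral>\<^sup>+x. ennreal ((w x)^2) \<partial>lebesgue) < \<infinity>" using assms(2) by (simp add: N2_def)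
  show "AE x in lebesgue. (\<lambda>j. ennreal ((w x)^2) * indicator {-(real j + a)<..<real j + a} x)
      \<longlonglongrightarrow> ennreal ((w x)^2) * indicator UNIV x"
  proof (rule AE_I2)
    fix x
    have "\<forall>\<^sub>F j in sequentially. \<bar>x\<bar> - a < real j"
      by (rule filterlim_at_top_eventually_gt[OF filterlim_real_sequentially])
    then have "\<forall>\<^sub>F j in sequentially. ennreal ((w x)^2) * indicator {-(real j + a)<..<real j + a} x = ennreal ((w x)^2) * indicator UNIV x"
      by eventually_elim (auto simp: indicator_def)
    then show "(\<lambda>j. ennreal ((w x)^2) * indicator {-(real j + a)<..<real j + a} x)
      \<longlonglongrightarrow> ennreal ((w x)^2) * indicator UNIV x" by (rule tendsto_eventually)
  qed
  show "AE x in lebesgue. ennreal ((w x)^2) * indicator {-(real j + a)<..<real j + a} x \<le> ennreal ((w x)^2)" for j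
    by (auto simp: indicator_def)
  show "(\<lambda>x. ennreal ((w x)^2) * indicator {-(real j + a)<..<real j + a} x) \<in> borel_measurable lebesgue" for j
    by measurable
qed (use assms(1) in measurable)

text \<open>Strong convergence gives a.e. convergence along a subsequence.\<close>

lemma N2_AE_subseq:
  assumes m: "\<And>n. v n \<in> borel_measurable lebesgue" and fin: "\<And>n. N2 UNIV (v n) < \<infinity>"
    and lim: "(\<lambda>n. N2 UNIV (v n)) \<longlonglongrightarrow> 0"
  obtains r :: "nat \<Rightarrow> nat" where "strict_mono r" "AE x in lebesgue. (\<lambda>n. v (r n) x) \<longlonglongrightarrow> 0"
proof -
  note m[measurable]
  have int: "integrable lebesgue (\<lambda>x. (v n x)^2)" for n
    using set_integrable_square_iff[OF m, of UNIV n] fin by (simp add: set_integrable_def)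
  have "(\<integral>x. norm ((v n x)^2) \<partial>lebesgue) = enn2real (N2 UNIV (v n))" for n
    unfolding N2_def using int[of n] by (subst integral_eq_nn_integral) auto
  moreover have "(\<lambda>n. enn2real (N2 UNIV (v n))) \<longlonglongrightarrow> 0"
    using lim by (intro tendsto_enn2real) simp_all
  ultimately have "(\<lambda>n. \<integral>x. norm ((v n x)^2) \<partial>lebesgue) \<longlonglongrightarrow> 0" by simp
  from tendsto_L1_AE_subseq[of lebesgue "\<lambda>n x. (v n x)^2", OF int this]
  obtain r :: "nat \<Rightarrow> nat" where r: "strict_mono r" "AE x in lebesgue. (\<lambda>n. (v (r n) x)^2) \<longlonglongrightarrow> 0"
    by auto
  from r(2) have "AE x in lebesgue. (\<lambda>n. v (r n) x) \<longlonglongrightarrow> 0"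
  proof eventually_elim
    case (elim x)
    then have "(\<lambda>n. sqrt ((v (r n) x)^2)) \<longlonglongrightarrow> sqrt 0" by (rule tendsto_real_sqrt)
    then show ?case by (simp add: tendsto_rabs_zero_iff)
  qed
  with r(1) show thesis by (rule that)
qed

text \<open>On \<open>[-\<bar>x\<bar>, \<bar>x\<bar>]\<close> the function is at least \<open>f x\<close>.\<close>

lemma bumps_decay:
  assumes f: "f \<in> bumps" shows "ennreal (2 * \<bar>x\<bar> * (f x)^2) \<le> N2 UNIV f"
proof -
  have "ennreal (2 * \<bar>x\<bar> * (f x)^2) = (\<integral>\<^sup>+y. ennreal ((f x)^2) * indicator {-\<bar>x\<bar>..\<bar>x\<bar>} y \<partial>lebesgue)"
    by (subst nn_integral_cmult_indicator) (auto simp: ennreal_mult mult.commute)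
  also have "\<dots> \<le> N2 UNIV f"
    unfolding N2_def
  proof (intro nn_integral_mono)
    fix y
    have "(f x)^2 \<le> (f y)^2" if "\<bar>y\<bar> \<le> \<bar>x\<bar>"
      using bumps_antimono[OF f that] bumpsD(3)[OF f, of x] by (rule power_mono)
    then show "ennreal ((f x)^2) * indicator {-\<bar>x\<bar>..\<bar>x\<bar>} y \<le> ennreal ((f y)^2) * indicator UNIV y"
      by (cases "\<bar>y\<bar> \<le> \<bar>x\<bar>") (auto simp: indicator_def abs_le_iff intro: ennreal_leI)
  qed
  finally show ?thesis .
qed

lemma cone_basic:
  assumes "W \<in> cone L"
  shows "W \<in> borel_measurable lebesgue" "periodic L W" "N2 (Ivl L) W < \<infinity>"
    "ennreal ((L2norm L W)^2) = N2 (Ivl L) W"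
  using assms L2norm_N2[of W L] by (auto simp: cone_def L2_iff)

lemma cone_approx_seq:
  assumes W: "W \<in> cone L" and L: "0 < L"
  obtains f where "\<And>n. f n \<in> bumps" "AE x in lebesgue. (\<lambda>n. f n x) \<longlonglongrightarrow> trunc L W x"
    "(\<lambda>n. N2 UNIV (f n)) \<longlonglongrightarrow> N2 (Ivl L) W"
    "(\<lambda>n. N2 UNIV (\<lambda>x. trunc L W x - f n x)) \<longlonglongrightarrow> 0"
proof -
  have "\<exists>f. f \<in> bumps \<and> N2 UNIV (\<lambda>x. trunc L W x - f x) < ennreal (1 / real (Suc n))" for n
    by (rule cone_approx[OF W L, of "1 / real (Suc n)"]) auto
  then obtain f where f: "\<And>n. f n \<in> bumps"
    and d: "\<And>n. N2 UNIV (\<lambda>x. trunc L W x - f n x) < ennreal (1 / real (Suc n))"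
    by metis
  have tm: "trunc L W \<in> borel_measurable lebesgue"
    using cone_basic(1)[OF W] by (rule trunc_measurable)
  note m = bumps_lebesgue[OF f]
  have lim: "(\<lambda>n. N2 UNIV (\<lambda>x. trunc L W x - f n x)) \<longlonglongrightarrow> 0"
  proof (rule tendsto_sandwich[of "\<lambda>_. 0"])
    show "(\<lambda>n. ennreal (1 / real (Suc n))) \<longlonglongrightarrow> 0"
      using tendsto_ennrealI[OF LIMSEQ_Suc[OF lim_1_over_n]] by simp
  qed (use d in \<open>auto intro!: always_eventually less_imp_le\<close>)
  have "N2 UNIV (\<lambda>x. trunc L W x - f n x) < \<infinity>" for n
    using d[of n] by (rule order.strict_trans) simp
  then obtain r :: "nat \<Rightarrow> nat" where r: "strict_mono r"
    "AE x in lebesgue. (\<lambda>n. trunc L W x - f (r n) x) \<longlonglongrightarrow> 0"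
    by (rule N2_AE_subseq[rotated]) (use tm m lim in auto)
  have "(\<lambda>n. N2 UNIV (f n)) \<longlonglongrightarrow> N2 UNIV (trunc L W)"
    using tm m lim cone_basic(3)[OF W] bumps_N2_finite[OF f] by (intro N2_tendsto) (auto simp: N2_trunc)
  then have n2: "(\<lambda>n. N2 UNIV (f (r n))) \<longlonglongrightarrow> N2 (Ivl L) W"
    using LIMSEQ_subseq_LIMSEQ[OF _ r(1)] by (force simp: N2_trunc o_def)
  have ae: "AE x in lebesgue. (\<lambda>n. f (r n) x) \<longlonglongrightarrow> trunc L W x"
    using r(2)
  proof eventually_elim
    case (elim x)
    from tendsto_diff[OF tendsto_const[of "trunc L W x"] elim] show ?case by simp
  qed
  show thesis
    by (rule that[OF f ae n2]) (use LIMSEQ_subseq_LIMSEQ[OF lim r(1)] in \<open>simp add: o_def\<close>)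
qed

text \<open>Nonnegativity and decay pass from bumps to their a.e. limits. The decay bound is the only source of
  compactness.\<close>

lemma cone_AE:
  assumes W: "W \<in> cone L" and L: "0 < L"
  shows "AE x in lebesgue. 0 \<le> W x"
    and "AE x in lebesgue. ennreal (2 * \<bar>x\<bar> * (trunc L W x)^2) \<le> N2 (Ivl L) W"
proof -
  obtain f where f: "\<And>n. f n \<in> bumps" and ae: "AE x in lebesgue. (\<lambda>n. f n x) \<longlonglongrightarrow> trunc L W x"
    and n2: "(\<lambda>n. N2 UNIV (f n)) \<longlonglongrightarrow> N2 (Ivl L) W"
    using cone_approx_seq[OF W L] by blast
  have nn: "AE x in lebesgue. 0 \<le> trunc L W x"
    using ae
  proof eventually_elim
    case (elim x)
    show ?case by (rule LIMSEQ_le_const[OF elim]) (simp add: bumpsD(3)[OF f])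
  qed
  show "AE x in lebesgue. 0 \<le> W x"
  proof (cases L)
    case (real l)
    then have "AE x in lebesgue. x \<in> Ivl (ereal l) \<longrightarrow> 0 \<le> W x"
      using nn by eventually_elim (simp add: trunc_def real)
    then show ?thesis
    proof (rule AE_periodic[rotated])
      show "(0 \<le> W (x + 2 * l)) = (0 \<le> W x)" for x
        using cone_basic(2)[OF W] real by (simp add: periodic_def)
    qed (use L real in simp)
  next
    case PInf
    then have "trunc L W = W" by (intro ext) (simp add: trunc_def Ivl_simps)
    with nn show ?thesis by simp
  qed (use L in simp)
  show "AE x in lebesgue. ennreal (2 * \<bar>x\<bar> * (trunc L W x)^2) \<le> N2 (Ivl L) W"
    using ae
  proof eventually_elim
    case (elim x)
    have "(\<lambda>n. ennreal (2 * \<bar>x\<bar> * (f n x)^2)) \<longlonglongrightarrow> ennreal (2 * \<bar>x\<bar> * (trunc L W x)^2)"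
      by (intro tendsto_intros elim)
    then show ?case by (rule LIMSEQ_le[OF _ n2]) (simp add: bumps_decay[OF f])
  qed
qed

text \<open>Helly's theorem needs uniformly bounded monotone functions on the line, so it is applied to
  \<open>- f / (1 + f)\<close>, frozen to the left of \<open>0\<close>. By \<open>bumps_decay\<close> the limit of \<open>f / (1 + f)\<close> stays below \<open>1\<close>
  away from the origin, hence the transformation can be inverted there.\<close>

lemma bumps_helly:
  assumes f: "\<And>n. f n \<in> bumps" and B: "\<And>n. N2 UNIV (f n) \<le> ennreal B" and "0 \<le> B"
  obtains s :: "nat \<Rightarrow> nat" and w where "strict_mono s" "w \<in> borel_measurable borel"
    "\<And>x. 0 \<le> w x" "AE x in lebesgue. (\<lambda>n. f (s n) x) \<longlonglongrightarrow> w x"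
proof -
  define T :: "real \<Rightarrow> real" where "T y = y / (1 + y)" for y
  have T_mono: "T a \<le> T b" if "0 \<le> a" "a \<le> b" for a b
    using that by (simp add: T_def divide_simps) (simp add: algebra_simps)
  have T_bd: "0 \<le> T a" "T a \<le> 1" "T a < 1" if "0 \<le> a" for a
    using that by (auto simp: T_def divide_simps)
  have T_inv: "T a / (1 - T a) = a" if "0 \<le> a" for a
    using that by (simp add: T_def divide_simps)
  define g where "g n x = - T (f n (max x 0))" for n x
  have gc: "continuous (at_right x) (g n)" for n x
  proof -
    have "continuous_on UNIV (g n)"
      unfolding g_def T_def
      by (intro continuous_intros continuous_on_compose2[OF bumps_continuous[OF f, of UNIV]])
         (auto simp: bumpsD(3)[OF f] add_nonneg_eq_0_iff)
    then show ?thesis by (simp add: continuous_on_eq_continuous_at continuous_at_imp_continuous_within)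
  qed
  have gm: "mono (g n)" for n
    unfolding g_def by (intro monoI) (auto intro!: T_mono bumpsD(3)[OF f] bumpsD(4)[OF f])
  have gb: "\<bar>g n x\<bar> \<le> 1" for n x
    using T_bd[OF bumpsD(3)[OF f]] by (simp add: g_def)
  from Helly_selection[of g 1, OF gc gm gb] obtain s F where s: "strict_mono (s :: nat \<Rightarrow> nat)" and F: "mono F"
    and conv: "\<And>x. continuous (at x) F \<Longrightarrow> (\<lambda>n. g (s n) x) \<longlonglongrightarrow> F x" by blast
  define w where "w x = max 0 (- F \<bar>x\<bar> / (1 + F \<bar>x\<bar>))" for x
  have [measurable]: "F \<in> borel_measurable borel" using F by (rule borel_measurable_mono)
  have wm: "w \<in> borel_measurable borel" unfolding w_def by measurable
  \<comment> \<open>\<open>F\<close> is only evaluated at \<open>\<bar>x\<bar>\<close>, so points of either sign have to be removed\<close>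
  define N where "N = insert 0 ({a. \<not> isCont F a} \<union> uminus ` {a. \<not> isCont F a})"
  have "countable N" unfolding N_def using mono_ctble_discont[OF F] by auto
  then have "N \<in> null_sets lborel" by (rule countable_imp_null_set_lborel)
  then have "AE x in lebesgue. x \<notin> N" by (simp add: AE_completion_iff AE_not_in)
  then have "AE x in lebesgue. (\<lambda>n. f (s n) x) \<longlonglongrightarrow> w x"
  proof eventually_elim
    case (elim x)
    then have x: "x \<noteq> 0" "isCont F \<bar>x\<bar>"
      unfolding N_def by (auto simp: abs_if image_iff)
    have lim: "(\<lambda>n. T (f (s n) x)) \<longlonglongrightarrow> - F \<bar>x\<bar>"
      using tendsto_minus[OF conv[OF x(2)]] by (simp add: g_def bumps_abs[OF f])
    define M where "M = sqrt (B / (2 * \<bar>x\<bar>))"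
    have "f n x \<le> M" for n
    proof -
      have "ennreal (2 * \<bar>x\<bar> * (f n x)^2) \<le> ennreal B"
        using bumps_decay[OF f] B by (rule order_trans)
      then have "2 * \<bar>x\<bar> * (f n x)^2 \<le> B" using assms(3) by (simp add: ennreal_le_iff)
      then have "(f n x)^2 \<le> B / (2 * \<bar>x\<bar>)" using x by (simp add: field_simps)
      then show ?thesis unfolding M_def by (rule real_le_rsqrt)
    qed
    then have "T (f (s n) x) \<le> T M" for n by (intro T_mono bumpsD(3)[OF f])
    then have "- F \<bar>x\<bar> \<le> T M" by (intro LIMSEQ_le_const2[OF lim]) auto
    moreover have "T M < 1" using assms(3) by (intro T_bd) (simp add: M_def)
    ultimately have lt: "- F \<bar>x\<bar> < 1" by simp
    have ge: "0 \<le> - F \<bar>x\<bar>" by (intro LIMSEQ_le_const[OF lim]) (auto intro: T_bd bumpsD(3)[OF f])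
    have "(\<lambda>n. T (f (s n) x) / (1 - T (f (s n) x))) \<longlonglongrightarrow> - F \<bar>x\<bar> / (1 - - F \<bar>x\<bar>)"
      using lt by (intro tendsto_intros lim) auto
    moreover have "w x = - F \<bar>x\<bar> / (1 - - F \<bar>x\<bar>)" 
    proof -
      have "0 \<le> - F \<bar>x\<bar> / (1 + F \<bar>x\<bar>)" using lt ge by (intro divide_nonneg_nonneg) auto
      then show ?thesis by (simp add: w_def max_def)
    qed
    ultimately show ?case by (simp add: T_inv bumpsD(3)[OF f])
  qed
  then show thesis using s wm by (intro that[of s w]) (simp_all add: w_def)
qed

text \<open>A.e. convergence need not be strong, since mass may concentrate at \<open>0\<close> or spread to infinity.
  Truncating the values of \<open>f n\<close> at height \<open>k\<close> and multiplying by the wide cutoff \<open>\<eta> (x / k)\<close> excludes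
  both and produces bumps again; these approximate \<open>w\<close> by dominated convergence, first in \<open>n\<close> and
  then in \<open>k\<close>.\<close>

lemma bumps_limit_cone:
  assumes f: "\<And>n. f n \<in> bumps" and chi: "\<eta> \<in> bumps" "\<eta> 0 = 1"
    and w: "w \<in> borel_measurable lebesgue" "\<And>x. 0 \<le> w x" "N2 UNIV w < \<infinity>"
    and ae: "AE x in lebesgue. (\<lambda>n. f n x) \<longlonglongrightarrow> w x"
  shows "w \<in> cone \<infinity>"
proof (rule cone_infI[OF w(1,3)])
  fix e :: real assume e: "0 < e"
  define T :: "nat \<Rightarrow> real \<Rightarrow> real" where "T k y = y / (1 + y / real (Suc k))" for k y
  define X where "X k x = \<eta> ((1 / real (Suc k)) * x)" for k x
  have X: "X k \<in> bumps" for k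
    unfolding X_def by (rule bumps_dilate[OF chi(1)]) simp
  have Tf: "(\<lambda>x. T k (f n x)) \<in> bumps" for k n
    unfolding T_def by (rule bumps_truncate[OF f]) simp
  have T_bd: "0 \<le> T k y" "T k y \<le> y" "T k y \<le> real (Suc k)" if "0 \<le> y" for k y
    using that by (auto simp: T_def divide_simps add_nonneg_pos algebra_simps)
  have X_bd: "0 \<le> X k x" "X k x \<le> 1" for k x
    using bumpsD(3)[OF X] bumps_antimono[OF chi(1), of 0] chi(2) by (auto simp: X_def)
  note [measurable] = w(1) bumps_lebesgue[OF f] bumps_lebesgue[OF X] bumps_lebesgue[OF Tf]
  have [measurable]: "(\<lambda>x. T k (w x)) \<in> borel_measurable lebesgue" for k
    unfolding T_def by measurable
  have l1: "(\<lambda>k. N2 UNIV (\<lambda>x. w x - T k (w x) * X k x)) \<longlonglongrightarrow> 0"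
  proof (rule N2_dominated[OF _ w(1) _ w(3)])
    show "AE x in lebesgue. \<bar>w x - T k (w x) * X k x\<bar> \<le> w x" for k
    proof (rule AE_I2)
      fix x
      have "T k (w x) * X k x \<le> w x * 1" using T_bd(1,2)[OF w(2)] X_bd w(2) by (intro mult_mono) auto
      moreover have "0 \<le> T k (w x) * X k x" using T_bd(1)[OF w(2)] X_bd by (intro mult_nonneg_nonneg)
      ultimately show "\<bar>w x - T k (w x) * X k x\<bar> \<le> w x" by simp
    qed
    show "AE x in lebesgue. (\<lambda>k. w x - T k (w x) * X k x) \<longlonglongrightarrow> 0"
    proof (rule AE_I2)
      fix x
      have r: "(\<lambda>k. 1 / real (Suc k)) \<longlonglongrightarrow> 0" by (rule LIMSEQ_Suc[OF lim_1_over_n])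
      have "isCont \<eta> 0"
        using bumps_continuous[OF chi(1), of UNIV] by (simp add: continuous_on_eq_continuous_at)
      moreover have "(\<lambda>k. (1 / real (Suc k)) * x) \<longlonglongrightarrow> 0 * x" by (intro tendsto_mult r tendsto_const)
      ultimately have 1: "(\<lambda>k. X k x) \<longlonglongrightarrow> 1"
        unfolding X_def using isCont_tendsto_compose[of 0 \<eta>] chi(2) by force
      have "(\<lambda>k. w x / (1 + w x * (1 / real (Suc k)))) \<longlonglongrightarrow> w x / (1 + w x * 0)"
        by (intro tendsto_intros r) auto
      then have "(\<lambda>k. T k (w x)) \<longlonglongrightarrow> w x" by (simp add: T_def)
      from tendsto_diff[OF tendsto_const[of "w x"] tendsto_mult[OF this 1]]
      show "(\<lambda>k. w x - T k (w x) * X k x) \<longlonglongrightarrow> 0" by simp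
    qed
  qed measurable
  have "\<forall>\<^sub>F k in sequentially. N2 UNIV (\<lambda>x. w x - T k (w x) * X k x) < ennreal (e / 4)"
    using e by (intro order_tendstoD(2)[OF l1]) simp
  then obtain k where k: "N2 UNIV (\<lambda>x. w x - T k (w x) * X k x) < ennreal (e / 4)"
    using eventually_happens by force
  have l2: "(\<lambda>n. N2 UNIV (\<lambda>x. T k (w x) * X k x - T k (f n x) * X k x)) \<longlonglongrightarrow> 0"
  proof (rule N2_dominated[where b="\<lambda>x. real (Suc k) * X k x"])
    show "N2 UNIV (\<lambda>x. real (Suc k) * X k x) < \<infinity>" by (intro bumps_N2_finite bumps_cmult X) simp
    show "AE x in lebesgue. \<bar>T k (w x) * X k x - T k (f n x) * X k x\<bar> \<le> real (Suc k) * X k x" for n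
    proof (rule AE_I2)
      fix x
      have "\<bar>T k (w x) - T k (f n x)\<bar> \<le> real (Suc k)"
        using T_bd[OF w(2)[of x], of k] T_bd[OF bumpsD(3)[OF f[of n], of x], of k] by linarith
      then have "\<bar>T k (w x) - T k (f n x)\<bar> * X k x \<le> real (Suc k) * X k x"
        using X_bd by (intro mult_right_mono)
      then show "\<bar>T k (w x) * X k x - T k (f n x) * X k x\<bar> \<le> real (Suc k) * X k x"
        using X_bd(1)[of k x] by (simp add: left_diff_distrib[symmetric] abs_mult)
    qed
    show "AE x in lebesgue. (\<lambda>n. T k (w x) * X k x - T k (f n x) * X k x) \<longlonglongrightarrow> 0"
      using ae
    proof eventually_elim
      case (elim x)
      have "1 + w x / real (Suc k) \<noteq> 0"
        using w(2)[of x] by (metis add_pos_nonneg divide_nonneg_nonneg less_irrefl of_nat_0_le_iff zero_less_one)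
      then have "(\<lambda>n. T k (w x) * X k x - T k (f n x) * X k x) \<longlonglongrightarrow> T k (w x) * X k x - T k (w x) * X k x"
        unfolding T_def by (intro tendsto_intros elim) auto
      then show ?case by simp
    qed
  qed measurable
  have "\<forall>\<^sub>F n in sequentially. N2 UNIV (\<lambda>x. T k (w x) * X k x - T k (f n x) * X k x) < ennreal (e / 4)"
    using e by (intro order_tendstoD(2)[OF l2]) simp
  then obtain n where n: "N2 UNIV (\<lambda>x. T k (w x) * X k x - T k (f n x) * X k x) < ennreal (e / 4)"
    using eventually_happens by force
  have "N2 UNIV (\<lambda>x. (w x - T k (w x) * X k x) + (T k (w x) * X k x - T k (f n x) * X k x))
    \<le> 2 * N2 UNIV (\<lambda>x. w x - T k (w x) * X k x) + 2 * N2 UNIV (\<lambda>x. T k (w x) * X k x - T k (f n x) * X k x)"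
    by (intro N2_add_le) measurable
  also have "\<dots> < 2 * ennreal (e / 4) + 2 * ennreal (e / 4)"
    using k n by (intro add_strict_mono ennreal_mult_strict_left_mono) auto
  also have "\<dots> = ennreal e"
    using e by (simp add: ennreal_mult[symmetric] ennreal_plus[symmetric] flip: ennreal_numeral del: ennreal_plus)
  finally show "\<exists>f\<in>bumps. N2 UNIV (\<lambda>x. w x - f x) < ennreal e"
    by (intro bexI[of _ "\<lambda>x. T k (f n x) * X k x"] bumps_mult Tf X) simp
qed

text \<open>The pointwise limit may have smaller norm. It lies in the cone although the convergence is not
  strong.\<close>

lemma cone_compactness:
  assumes W: "\<And>n. W n \<in> cone (L n)" and L: "\<And>n. 0 < L n" and chi: "\<eta> \<in> bumps" "\<eta> 0 = 1"
    and B: "\<And>n. N2 (Ivl (L n)) (W n) \<le> ennreal B" and B0: "0 \<le> B"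
  shows "\<exists>(s :: nat \<Rightarrow> nat) w. strict_mono s \<and> w \<in> cone \<infinity> \<and> (\<forall>x. 0 \<le> w x) \<and>
    N2 UNIV w \<le> ennreal B \<and> (AE x in lebesgue. (\<lambda>n. trunc (L (s n)) (W (s n)) x) \<longlonglongrightarrow> w x)"
proof -
  have "\<exists>f. f \<in> bumps \<and> N2 UNIV (\<lambda>x. trunc (L n) (W n) x - f x) < ennreal (1 / real (Suc n))" for n
    by (rule cone_approx[OF W L, of "1 / real (Suc n)"]) auto
  then obtain f where f: "\<And>n. f n \<in> bumps"
    and d: "\<And>n. N2 UNIV (\<lambda>x. trunc (L n) (W n) x - f n x) < ennreal (1 / real (Suc n))"
    by metis
  have tm: "trunc (L n) (W n) \<in> borel_measurable lebesgue" for n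
    using cone_basic(1)[OF W] by (rule trunc_measurable)
  note m = bumps_lebesgue[OF f]
  note [measurable] = tm m
  have f_bound: "N2 UNIV (f n) \<le> ennreal (2 * B + 2)" for n
  proof -
    have "N2 UNIV (f n) = N2 UNIV (\<lambda>x. trunc (L n) (W n) x + (f n x - trunc (L n) (W n) x))" by simp
    also have "\<dots> \<le> 2 * N2 UNIV (trunc (L n) (W n)) + 2 * N2 UNIV (\<lambda>x. f n x - trunc (L n) (W n) x)"
      by (intro N2_add_le) measurable
    also have "\<dots> \<le> 2 * ennreal B + 2 * ennreal 1"
    proof (intro add_mono mult_left_mono)
      show "N2 UNIV (trunc (L n) (W n)) \<le> ennreal B" using B by (simp add: N2_trunc)
      have "N2 UNIV (\<lambda>x. f n x - trunc (L n) (W n) x) \<le> ennreal (1 / real (Suc n))"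
        using d[of n] by (simp add: N2_diff_commute[of _ "f n"])
      also have "\<dots> \<le> ennreal 1" by (intro ennreal_leI) simp
      finally show "N2 UNIV (\<lambda>x. f n x - trunc (L n) (W n) x) \<le> ennreal 1" .
    qed auto
    also have "\<dots> = ennreal (2 * B + 2)"
      using B0 by (simp add: ennreal_mult)
    finally show ?thesis .
  qed
  have "0 \<le> 2 * B + 2" using B0 by simp
  then obtain s :: "nat \<Rightarrow> nat" and w where s: "strict_mono s" and w: "w \<in> borel_measurable borel"
    "\<And>x. 0 \<le> w x" and fw: "AE x in lebesgue. (\<lambda>n. f (s n) x) \<longlonglongrightarrow> w x"
    using bumps_helly[where f=f, OF f f_bound] by blast
  have wl: "w \<in> borel_measurable lebesgue" using w(1) by (intro measurable_completion) auto
  have lim0: "(\<lambda>n. N2 UNIV (\<lambda>x. trunc (L n) (W n) x - f n x)) \<longlonglongrightarrow> 0"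
  proof (rule tendsto_sandwich[of "\<lambda>_. 0"])
    show "(\<lambda>n. ennreal (1 / real (Suc n))) \<longlonglongrightarrow> 0"
      using tendsto_ennrealI[OF LIMSEQ_Suc[OF lim_1_over_n]] by simp
  qed (use d in \<open>auto intro!: always_eventually less_imp_le\<close>)
  have lim: "(\<lambda>n. N2 UNIV (\<lambda>x. trunc (L (s n)) (W (s n)) x - f (s n) x)) \<longlonglongrightarrow> 0"
    using LIMSEQ_subseq_LIMSEQ[OF lim0 s] by (simp add: o_def)
  have "N2 UNIV (\<lambda>x. trunc (L (s n)) (W (s n)) x - f (s n) x) < \<infinity>" for n
    using d[of "s n"] by (rule order.strict_trans) simp
  then obtain r :: "nat \<Rightarrow> nat" where r: "strict_mono r"
    "AE x in lebesgue. (\<lambda>n. trunc (L (s (r n))) (W (s (r n))) x - f (s (r n)) x) \<longlonglongrightarrow> 0"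
    by (rule N2_AE_subseq[rotated]) (use lim in auto)
  have conv: "AE x in lebesgue. (\<lambda>n. trunc (L (s (r n))) (W (s (r n))) x) \<longlonglongrightarrow> w x"
    using r(2) fw
  proof eventually_elim
    case (elim x)
    from LIMSEQ_subseq_LIMSEQ[OF elim(2) r(1)] have "(\<lambda>n. f (s (r n)) x) \<longlonglongrightarrow> w x" by (simp add: o_def)
    from tendsto_add[OF elim(1) this] show ?case by simp
  qed
  have "N2 UNIV w \<le> liminf (\<lambda>n. N2 UNIV (trunc (L (s (r n))) (W (s (r n)))))"
    by (intro N2_fatou tm conv) simp
  also have "\<dots> \<le> ennreal B"
  proof (rule Liminf_le)
    show "\<forall>\<^sub>F n in sequentially. N2 UNIV (trunc (L (s (r n))) (W (s (r n)))) \<le> ennreal B"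
      using B by (intro always_eventually) (simp add: N2_trunc)
  qed simp
  finally have N: "N2 UNIV w \<le> ennreal B" .
  have "w \<in> cone \<infinity>"
    by (rule bumps_limit_cone[OF f chi wl w(2) _ fw]) (rule le_less_trans[OF N], simp)
  then show ?thesis
    using s r(1) conv w(2) N by (intro exI[of _ "s \<circ> r"] exI[of _ w]) (simp add: strict_mono_def)
qed

section \<open>The energy of one window width for large periods\<close>

text \<open>The decay bound of \<open>cone_AE\<close> is a multiple of \<open>\<bar>t\<bar> powr (-1/2)\<close>, integrable at the origin, so it
  dominates window averages even where mass concentrates.\<close>

lemma singular_integrable:
  "integrable lebesgue (\<lambda>t::real. indicator {-a..a} t * sqrt (c / \<bar>t\<bar>))"
proof (cases "0 \<le> a")
  case True
  define f where "f t = indicator {0..a} t * (t powr (-1/2))" for t :: real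
  have "(\<lambda>x. x powr (-1/2)) absolutely_integrable_on {0..a}"
    using has_integral_powr_from_0[of "-1/2" a] True
    by (intro nonnegative_absolutely_integrable_1) (auto simp: has_integral_integrable)
  then have f: "integrable lebesgue f"
    unfolding set_integrable_def f_def by simp
  have fm: "integrable lebesgue (\<lambda>t. f (0 + (-1) * t))"
    using lebesgue_integrable_real_affine_iff[of "-1" f 0] f by simp
  have int: "integrable lebesgue (\<lambda>t. sqrt c * (f t + f (0 + (-1) * t)))"
    using f fm by (intro integrable_mult_right Bochner_Integration.integrable_add)
  have ae: "AE t in lebesgue. sqrt c * (f t + f (0 + (-1) * t)) = indicator {-a..a} t * sqrt (c / \<bar>t\<bar>)"
    using AE_lebesgue_neq[of 0]
  proof eventually_elim
    case (elim t)
    have "t powr (-1/2) = 1 / sqrt t" if "0 < t" for t :: real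
      using that by (simp add: powr_minus_divide powr_half_sqrt)
    moreover have "sqrt (c / \<bar>t\<bar>) = sqrt c * (1 / sqrt \<bar>t\<bar>)" by (simp add: real_sqrt_divide)
    ultimately show ?case using elim
      by (cases "0 < t") (auto simp: f_def indicator_def)
  qed
  have "(\<lambda>t::real. indicator {-a..a} t * sqrt (c / \<bar>t\<bar>)) \<in> borel_measurable lebesgue"
    by (intro measurable_completion) simp
  then show ?thesis
    by (rule integrable_cong_AE_imp[OF int _ ae])
qed (simp add: indicator_def)

lemma ennreal_less_add_pos:
  assumes "a < \<infinity>" "0 < e" shows "a < a + ennreal e"
  using assms by (cases a) (auto simp: ennreal_plus[symmetric] ennreal_less_iff simp del: ennreal_plus)

text \<open>Concentrating mass is not seen by averages: the decay bound dominates on each window.\<close>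

lemma avg_tendsto:
  assumes W: "\<And>n. W n \<in> cone (ereal (l n))" and l: "\<And>n. 0 < l n" "filterlim l at_top sequentially"
    and B: "\<And>n. N2 (Ivl (ereal (l n))) (W n) \<le> ennreal B" "0 \<le> B"
    and w: "w \<in> borel_measurable lebesgue"
    and conv: "AE x in lebesgue. (\<lambda>n. trunc (ereal (l n)) (W n) x) \<longlonglongrightarrow> w x"
  shows "(\<lambda>n. avg \<xi> (W n) x) \<longlonglongrightarrow> avg \<xi> w x"
proof -
  define J where "J = {x - \<xi> / 2 .. x + \<xi> / 2}"
  define a where "a = \<bar>x\<bar> + \<bar>\<xi>\<bar>"
  have Ja: "J \<subseteq> {-a..a}" unfolding J_def a_def by auto
  have "(\<lambda>n. \<integral>t. indicator J t * trunc (ereal (l n)) (W n) t \<partial>lebesgue) \<longlonglongrightarrow> (\<integral>t. indicator J t * w t \<partial>lebesgue)"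
  proof (rule integral_dominated_convergence)
    show "(\<lambda>t. indicator J t * w t) \<in> borel_measurable lebesgue" using w unfolding J_def by measurable
    show "(\<lambda>t. indicator J t * trunc (ereal (l n)) (W n) t) \<in> borel_measurable lebesgue" for n
      using trunc_measurable[OF cone_basic(1)[OF W[of n]]] unfolding J_def by measurable
    show "integrable lebesgue (\<lambda>t. indicator {-a..a} t * sqrt (B / 2 / \<bar>t\<bar>))" by (rule singular_integrable)
    show "AE t in lebesgue. (\<lambda>n. indicator J t * trunc (ereal (l n)) (W n) t) \<longlonglongrightarrow> indicator J t * w t"
      using conv by eventually_elim (intro tendsto_mult tendsto_const)
    show "AE t in lebesgue. norm (indicator J t * trunc (ereal (l n)) (W n) t)
        \<le> indicator {-a..a} t * sqrt (B / 2 / \<bar>t\<bar>)" for n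
    proof -
      have L: "0 < ereal (l n)" using l(1) by simp
      show ?thesis
        using cone_AE(2)[OF W L] AE_lebesgue_neq[of 0]
      proof eventually_elim
        case (elim t)
        define y where "y = trunc (ereal (l n)) (W n) t"
        have "ennreal (2 * \<bar>t\<bar> * y^2) \<le> ennreal B" using elim(1) B(1)[of n] unfolding y_def by (rule order_trans)
        then have "2 * \<bar>t\<bar> * \<bar>y\<bar>^2 \<le> B" using B(2) by (simp add: ennreal_le_iff)
        then have "\<bar>y\<bar>^2 \<le> B / 2 / \<bar>t\<bar>" using elim(2) by (simp add: field_simps)
        then have "\<bar>y\<bar> \<le> sqrt (B / 2 / \<bar>t\<bar>)" by (rule real_le_rsqrt)
        then show ?case using Ja B(2) unfolding y_def[symmetric] by (auto simp: indicator_def)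
      qed
    qed
  qed
  then have lim: "(\<lambda>n. avg \<xi> (trunc (ereal (l n)) (W n)) x) \<longlonglongrightarrow> avg \<xi> w x"
    by (simp add: avg_def set_lebesgue_integral_def J_def)
  show ?thesis
  proof (rule Lim_transform_eventually[OF lim])
    show "\<forall>\<^sub>F n in sequentially. avg \<xi> (trunc (ereal (l n)) (W n)) x = avg \<xi> (W n) x"
      using filterlim_at_top_eventually_gt[OF l(2), of a]
    proof eventually_elim
      case (elim n)
      show ?case
        by (rule avg_cong) (use elim in \<open>auto simp: trunc_def Ivl_simps a_def\<close>)
    qed
  qed
qed

lemma avg_const: "0 \<le> \<xi> \<Longrightarrow> avg \<xi> (\<lambda>_. m) x = \<xi> * m"
  unfolding avg_def by (subst set_integral_const) auto

lemma avg_le_small: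
  assumes "0 \<le> \<xi>" "0 < L" "ereal \<xi> \<le> 2 * L" "periodic L W" "W \<in> borel_measurable lebesgue"
    and "N2 (Ivl L) W \<le> ennreal B" "0 \<le> B"
  shows "avg \<xi> W x \<le> sqrt \<xi> * sqrt B"
proof -
  have "ennreal ((avg \<xi> W x)^2) \<le> ennreal \<xi> * ennreal B"
    using avg_sq_le_small[OF assms(1-5)] by (rule order_trans) (intro mult_left_mono assms(6), simp)
  then have "(avg \<xi> W x)^2 \<le> \<xi> * B"
    using assms by (simp add: ennreal_mult[symmetric] ennreal_le_iff)
  then show ?thesis by (simp add: real_sqrt_mult[symmetric] real_le_rsqrt)
qed

lemma avg_lebesgue_measurable:
  "W \<in> borel_measurable lebesgue \<Longrightarrow> (\<lambda>x. avg \<xi> W x) \<in> borel_measurable lebesgue"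
  by (intro measurable_completion) (simp, measurable)

text \<open>The factor \<open>h\<close> stands for \<open>\<Phi> r / r^2\<close>.\<close>

definition dens :: "real \<Rightarrow> (real \<Rightarrow> real) \<Rightarrow> (real \<Rightarrow> real) \<Rightarrow> real \<Rightarrow> ennreal" where
  "dens \<xi> h W x = ennreal ((avg \<xi> W x)^2 * h (avg \<xi> W x))"

context
  fixes h :: "real \<Rightarrow> real"
  assumes h_mono: "mono h" and h_cont: "continuous_on UNIV h" and h_nonneg: "\<And>r. 0 \<le> h r"
begin

lemma h_borel: "h \<in> borel_measurable borel"
  using h_cont by (rule borel_measurable_continuous_onI)

lemma density_mono: "0 \<le> r \<Longrightarrow> r \<le> s \<Longrightarrow> r^2 * h r \<le> s^2 * h s"
  using h_mono h_nonneg by (intro mult_mono power_mono monoD[OF h_mono]) auto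

lemma dens_borel:
  assumes "W \<in> borel_measurable lebesgue"
  shows "dens \<xi> h W \<in> borel_measurable lebesgue"
proof -
  note [measurable] = h_borel avg_lebesgue_measurable[OF assms]
  show ?thesis unfolding dens_def[abs_def] by measurable
qed

text \<open>The energy far from the origin is almost quadratic. An average centred outside
  \<open>[-R - \<xi>/2, R + \<xi>/2]\<close> does not see the values of \<open>W\<close> in \<open>(-R, R)\<close>, so \<open>W\<close> may be replaced by the
  periodic function \<open>U\<close> in which they are cut out. By the decay bound \<open>U \<le> sqrt (B / (2 * R))\<close>, which
  bounds the factor \<open>h\<close>, and Young's inequality for \<open>U\<close> bounds the remaining square by the mass
  outside \<open>(-R, R)\<close>.\<close>

lemma outer_bound:
  assumes W: "W \<in> cone (ereal l)" and B: "N2 (Ivl (ereal l)) W \<le> ennreal B" "0 \<le> B"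
    and xi: "0 < \<xi>" and R: "0 < R" "R + \<xi> / 2 \<le> l"
  shows "(\<integral>\<^sup>+x\<in>Ivl (ereal l) - {-(R + \<xi>/2)..R + \<xi>/2}. dens \<xi> h W x \<partial>lebesgue)
     \<le> ennreal (h (\<xi> * sqrt (B / (2 * R))) * \<xi>^2) * N2 (Ivl (ereal l) - {-R<..<R}) W"
proof -
  have l: "0 < l" using R xi by simp
  then have L: "0 < ereal l" by simp
  note Wb = cone_basic[OF W]
  \<comment> \<open>the cut has to be repeated periodically because windows near \<open>l\<close> reach into the next period\<close>
  define S where "S = {x. \<exists>k::int. \<bar>x + of_int k * (2 * l)\<bar> < R}"
  define U where "U x = indicator (- S) x * W x" for x
  have "S \<in> sets borel" unfolding S_def by measurable
  then have "- S \<in> sets lebesgue" by (simp add: sets.compl_sets Compl_eq_Diff_UNIV)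
  then have Um: "U \<in> borel_measurable lebesgue"
    unfolding U_def using Wb(1) by (intro borel_measurable_times borel_measurable_indicator)
  have S_per: "x + 2 * l \<in> S \<longleftrightarrow> x \<in> S" for x
  proof
    assume "x + 2 * l \<in> S"
    then obtain k :: int where "\<bar>x + 2 * l + of_int k * (2 * l)\<bar> < R" by (auto simp: S_def)
    then have "\<bar>x + of_int (k + 1) * (2 * l)\<bar> < R" by (simp add: algebra_simps)
    then show "x \<in> S" unfolding S_def by blast
  next
    assume "x \<in> S"
    then obtain k :: int where "\<bar>x + of_int k * (2 * l)\<bar> < R" by (auto simp: S_def)
    then have "\<bar>x + 2 * l + of_int (k - 1) * (2 * l)\<bar> < R" by (simp add: algebra_simps)
    then show "x + 2 * l \<in> S" unfolding S_def by blast
  qed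
  have U_per: "periodic (ereal l) U"
    using Wb(2) S_per by (simp add: periodic_def U_def indicator_def)
  define m where "m = sqrt (B / (2 * R))"
  have U_bd: "AE x in lebesgue. 0 \<le> U x \<and> U x \<le> m"
  proof (rule AE_periodic[OF l])
    show "AE x in lebesgue. x \<in> Ivl (ereal l) \<longrightarrow> 0 \<le> U x \<and> U x \<le> m"
      using cone_AE[OF W L]
    proof eventually_elim
      case (elim x)
      show ?case
      proof (rule impI, cases "x \<in> S")
        case True
        then show "0 \<le> U x \<and> U x \<le> m" using B R by (simp add: U_def m_def)
      next
        case False
        assume x: "x \<in> Ivl (ereal l)"
        have "R \<le> \<bar>x\<bar>" using False unfolding S_def by (auto dest!: spec[of _ 0])
        have "ennreal (2 * \<bar>x\<bar> * (W x)^2) \<le> ennreal B"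
          using elim(2) B(1) x by (simp add: trunc_def)
        then have "2 * \<bar>x\<bar> * (W x)^2 \<le> B" using B(2) by (simp add: ennreal_le_iff)
        moreover have "2 * R * (W x)^2 \<le> 2 * \<bar>x\<bar> * (W x)^2"
          using \<open>R \<le> \<bar>x\<bar>\<close> by (intro mult_right_mono) auto
        ultimately have "(W x)^2 \<le> B / (2 * R)" using R by (simp add: field_simps)
        then have "W x \<le> m" unfolding m_def by (rule real_le_rsqrt)
        then show "0 \<le> U x \<and> U x \<le> m" using False elim(1) by (simp add: U_def)
      qed
    qed
    show "(0 \<le> U (x + 2 * l) \<and> U (x + 2 * l) \<le> m) = (0 \<le> U x \<and> U x \<le> m)" for x
      using U_per by (simp add: periodic_def)
  qed
  have eq: "avg \<xi> W x = avg \<xi> U x" if x: "x \<in> Ivl (ereal l)" "x \<notin> {-(R + \<xi>/2)..R + \<xi>/2}" for x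
  proof (rule avg_cong)
    fix t assume t: "x - \<xi> / 2 \<le> t" "t \<le> x + \<xi> / 2"
    have "t \<notin> S"
    proof
      assume "t \<in> S"
      then obtain k :: int where k: "\<bar>t + of_int k * (2 * l)\<bar> < R" by (auto simp: S_def)
      have xR: "R + \<xi> / 2 < \<bar>x\<bar>" "\<bar>x\<bar> < l" using x by (auto simp: Ivl_simps)
      have kx: "\<bar>x + of_int k * (2 * l)\<bar> < R + \<xi> / 2" using k t by linarith
      consider "k = 0" | "1 \<le> k" | "k \<le> -1" by linarith
      then show False
      proof cases
        case 1 then show ?thesis using kx xR by simp
      next
        case 2
        then have "1 * (2 * l) \<le> of_int k * (2 * l)" using l by (intro mult_right_mono) auto
        then show ?thesis using kx xR R by linarith
      next
        case 3
        then have "of_int k * (2 * l) \<le> (-1) * (2 * l)" using l by (intro mult_right_mono) auto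
        then show ?thesis using kx xR R by linarith
      qed
    qed
    then show "W t = U t" by (simp add: U_def)
  qed
  have U_nn: "AE x in lebesgue. 0 \<le> U x" and U_m: "AE x in lebesgue. U x \<le> m"
    using U_bd by auto
  have avgU: "0 \<le> avg \<xi> U x" "avg \<xi> U x \<le> \<xi> * m" for x
  proof -
    show "0 \<le> avg \<xi> U x" by (rule avg_nonneg[OF U_nn])
    have "avg \<xi> U x \<le> avg \<xi> (\<lambda>_. m) x"
      by (rule avg_mono[OF U_nn U_m _ Um])
         (auto simp: set_integrable_def emeasure_lborel_Icc_eq intro!: integrable_mult_left integrable_real_indicator)
    then show "avg \<xi> U x \<le> \<xi> * m" using xi by (simp add: avg_const)
  qed
  define c where "c = h (\<xi> * m)"
  have c: "0 \<le> c" unfolding c_def by (rule h_nonneg)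
  have "(\<integral>\<^sup>+x\<in>Ivl (ereal l) - {-(R + \<xi>/2)..R + \<xi>/2}. dens \<xi> h W x \<partial>lebesgue)
     \<le> (\<integral>\<^sup>+x. ennreal c * (ennreal ((avg \<xi> U x)^2) * indicator (Ivl (ereal l)) x) \<partial>lebesgue)"
  proof (intro nn_integral_mono)
    fix x
    show "dens \<xi> h W x * indicator (Ivl (ereal l) - {-(R + \<xi>/2)..R + \<xi>/2}) x
      \<le> ennreal c * (ennreal ((avg \<xi> U x)^2) * indicator (Ivl (ereal l)) x)"
    proof (cases "x \<in> Ivl (ereal l) - {-(R + \<xi>/2)..R + \<xi>/2}")
      case True
      have "h (avg \<xi> U x) \<le> c" unfolding c_def using avgU by (intro monoD[OF h_mono])
      then have "(avg \<xi> U x)^2 * h (avg \<xi> U x) \<le> c * (avg \<xi> U x)^2"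
        by (subst mult.commute) (intro mult_right_mono, auto)
      then have "dens \<xi> h U x \<le> ennreal c * ennreal ((avg \<xi> U x)^2)"
        unfolding dens_def using c by (subst ennreal_mult[symmetric]) (auto intro: ennreal_leI)
      then show ?thesis using True eq[of x] by (simp add: dens_def)
    qed simp
  qed
  also have "\<dots> = ennreal c * (\<integral>\<^sup>+x\<in>Ivl (ereal l). ennreal ((avg \<xi> U x)^2) \<partial>lebesgue)"
  proof (rule nn_integral_cmult)
    have "(\<lambda>x. avg \<xi> U x) \<in> borel_measurable borel" using Um by measurable
    then have [measurable]: "(\<lambda>x. avg \<xi> U x) \<in> borel_measurable lebesgue" by (intro measurable_completion) simp
    show "(\<lambda>x. ennreal ((avg \<xi> U x)^2) * indicator (Ivl (ereal l)) x) \<in> borel_measurable lebesgue"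
      by measurable
  qed
  also have "\<dots> \<le> ennreal c * (ennreal (\<xi>^2) * N2 (Ivl (ereal l)) U)"
    using xi by (intro mult_left_mono young_avg L U_per Um) auto
  also have "\<dots> = ennreal (c * \<xi>^2) * N2 (Ivl (ereal l)) U"
    using c by (simp add: ennreal_mult mult.assoc)
  also have "\<dots> \<le> ennreal (c * \<xi>^2) * N2 (Ivl (ereal l) - {-R<..<R}) W"
  proof (intro mult_left_mono)
    show "N2 (Ivl (ereal l)) U \<le> N2 (Ivl (ereal l) - {-R<..<R}) W"
      unfolding N2_def
    proof (intro nn_integral_mono)
      fix x
      have "x \<in> S" if "x \<in> {-R<..<R}" using that unfolding S_def by (auto intro!: exI[of _ 0])
      then show "ennreal ((U x)^2) * indicator (Ivl (ereal l)) x
         \<le> ennreal ((W x)^2) * indicator (Ivl (ereal l) - {-R<..<R}) x"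
        by (cases "x \<in> S"; cases "x \<in> {-R<..<R}") (auto simp: U_def indicator_def)
    qed
  qed simp
  finally show ?thesis unfolding c_def m_def .
qed

text \<open>On a fixed bounded interval the averages converge pointwise and are uniformly bounded as soon as
  the window is shorter than the period.\<close>

lemma inner_tendsto:
  assumes W: "\<And>n. W n \<in> cone (ereal (l n))" and l: "\<And>n. 0 < l n" "filterlim l at_top sequentially"
    and B: "\<And>n. N2 (Ivl (ereal (l n))) (W n) \<le> ennreal B" "0 \<le> B" and xi: "0 < \<xi>"
    and w: "w \<in> borel_measurable lebesgue"
    and conv: "AE x in lebesgue. (\<lambda>n. trunc (ereal (l n)) (W n) x) \<longlonglongrightarrow> w x"
  shows "(\<lambda>n. \<integral>\<^sup>+x\<in>{-R..R}. dens \<xi> h (W n) x \<partial>lebesgue)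
     \<longlonglongrightarrow> (\<integral>\<^sup>+x\<in>{-R..R}. dens \<xi> h w x \<partial>lebesgue)"
proof -
  define M where "M = sqrt \<xi> * sqrt B"
  \<comment> \<open>domination must hold for every \<open>n\<close>, but the bound \<open>M\<close> needs a window within one period\<close>
  define u where "u n x = (if \<xi> \<le> 2 * l n then dens \<xi> h (W n) x else 0)
      * indicator {-R..R} x" for n x
  have ev: "\<forall>\<^sub>F n in sequentially. \<xi> \<le> 2 * l n"
    using filterlim_at_top_eventually_gt[OF l(2), of \<xi>] by eventually_elim (use xi in simp)
  note [measurable] = dens_borel[OF w] dens_borel[OF cone_basic(1)[OF W]]
  have "(\<lambda>n. \<integral>\<^sup>+x. u n x \<partial>lebesgue)
     \<longlonglongrightarrow> (\<integral>\<^sup>+x. dens \<xi> h w x * indicator {-R..R} x \<partial>lebesgue)"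
  proof (rule nn_integral_dominated_convergence)
    show "AE x in lebesgue. u n x \<le> ennreal (M^2 * h M) * indicator {-R..R} x" for n
    proof (rule AE_I2)
      fix x
      have "dens \<xi> h (W n) x \<le> ennreal (M^2 * h M)" if "\<xi> \<le> 2 * l n"
        unfolding dens_def
      proof (intro ennreal_leI density_mono)
        have L: "0 < ereal (l n)" using l(1) by simp
        show "0 \<le> avg \<xi> (W n) x" using cone_AE(1)[OF W L] by (rule avg_nonneg)
        show "avg \<xi> (W n) x \<le> M"
          unfolding M_def using that xi cone_basic[OF W] B
          by (intro avg_le_small[OF _ L]) (auto simp: numeral_eq_ereal)
      qed
      then show "u n x \<le> ennreal (M^2 * h M) * indicator {-R..R} x"
        unfolding u_def by (intro mult_right_mono) auto
    qed
    show "(\<integral>\<^sup>+x. ennreal (M^2 * h M) * indicator {-R..R} x \<partial>lebesgue) < \<infinity>"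
      by (subst nn_integral_cmult_indicator) (auto simp: ennreal_mult_less_top emeasure_lborel_Icc_eq)
    show "AE x in lebesgue. (\<lambda>n. u n x) \<longlonglongrightarrow> dens \<xi> h w x * indicator {-R..R} x"
    proof (rule AE_I2)
      fix x
      have a: "(\<lambda>n. avg \<xi> (W n) x) \<longlonglongrightarrow> avg \<xi> w x" by (rule avg_tendsto[OF W l B w conv])
      have hl: "(\<lambda>n. h (avg \<xi> (W n) x)) \<longlonglongrightarrow> h (avg \<xi> w x)"
        by (rule continuous_on_tendsto_compose[OF h_cont a]) auto
      have lim: "(\<lambda>n. dens \<xi> h (W n) x * indicator {-R..R} x)
         \<longlonglongrightarrow> dens \<xi> h w x * indicator {-R..R} x"
        unfolding dens_def using tendsto_ennrealI[OF tendsto_mult[OF tendsto_power[OF a] hl]] by (cases "x \<in> {-R..R}") simp_all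
      show "(\<lambda>n. u n x) \<longlonglongrightarrow> dens \<xi> h w x * indicator {-R..R} x"
        by (rule Lim_transform_eventually[OF lim]) (use ev in eventually_elim, simp add: u_def)
    qed
    show "u n \<in> borel_measurable lebesgue" for n unfolding u_def by measurable
  qed measurable
  then show ?thesis
    by (rule Lim_transform_eventually) (use ev in eventually_elim, simp add: u_def)
qed

text \<open>Split at a large radius. The inner part converges by \<open>inner_tendsto\<close>. The outer part is at most
  \<open>c j * \<xi>^2\<close> times the outer mass by \<open>outer_bound\<close>; as the radius grows, \<open>c j\<close> tends to \<open>h 0\<close>, and the
  outer mass is at most \<open>B\<close> minus the inner mass, which by Fatou is in the limit at least that of
  \<open>w\<close>.\<close>

lemma local_limsup:
  assumes W: "\<And>n. W n \<in> cone (ereal (l n))" and l: "\<And>n. 0 < l n" "filterlim l at_top sequentially"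
    and B: "\<And>n. N2 (Ivl (ereal (l n))) (W n) \<le> ennreal B" "0 \<le> B" and xi: "0 < \<xi>"
    and w: "w \<in> borel_measurable lebesgue" and N: "N2 UNIV w = ennreal N" "0 \<le> N"
    and conv: "AE x in lebesgue. (\<lambda>n. trunc (ereal (l n)) (W n) x) \<longlonglongrightarrow> w x"
  shows "limsup (\<lambda>n. \<integral>\<^sup>+x\<in>Ivl (ereal (l n)). dens \<xi> h (W n) x \<partial>lebesgue)
    \<le> (\<integral>\<^sup>+x. dens \<xi> h w x \<partial>lebesgue) + ennreal (h 0 * \<xi>^2 * (B - N))"
    (is "limsup ?a \<le> ?I + ennreal ?q")
proof (rule ennreal_le_epsilon)
  fix e :: real assume e: "0 < e"
  \<comment> \<open>the shift keeps the radius positive, so that the decay bound is finite for every \<open>j\<close>\<close>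
  define R where "R j = real j + \<xi> / 2" for j
  define Nj where "Nj j = enn2real (N2 {-R j<..<R j} w)" for j
  define c where "c j = h (\<xi> * sqrt (B / (2 * R j)))" for j
  have Rpos: "0 < R j" for j using xi by (simp add: R_def add_nonneg_pos)
  have Nfin: "N2 UNIV w < \<infinity>" using N by simp
  have "(\<lambda>j. N2 {-R j<..<R j} w) \<longlonglongrightarrow> ennreal N"
    using N2_exhaust[OF w Nfin, of "\<xi> / 2"] N by (simp add: R_def)
  then have NjN: "Nj \<longlonglongrightarrow> N" unfolding Nj_def by (intro tendsto_enn2real N(2))
  have Rlim: "filterlim R at_top sequentially"
    by (rule filterlim_at_top_mono[OF filterlim_real_sequentially])
       (use xi in \<open>simp add: R_def\<close>)
  have "(\<lambda>j. \<xi> * sqrt (B / (2 * R j))) \<longlonglongrightarrow> \<xi> * sqrt 0"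
    using Rlim by (intro tendsto_mult tendsto_const tendsto_real_sqrt real_tendsto_divide_at_top[OF tendsto_const]
       filterlim_tendsto_pos_mult_at_top[OF tendsto_const]) auto
  then have cl: "c \<longlonglongrightarrow> h 0"
    unfolding c_def using continuous_on_tendsto_compose[OF h_cont] by simp
  have "(\<lambda>j. c j * \<xi>^2 * (B - (Nj j - 1 / real (Suc j)))) \<longlonglongrightarrow> h 0 * \<xi>^2 * (B - (N - 0))"
    by (intro tendsto_intros cl NjN LIMSEQ_Suc[OF lim_1_over_n])
  then have "(\<lambda>j. c j * \<xi>^2 * (B - (Nj j - 1 / real (Suc j)))) \<longlonglongrightarrow> ?q" by simp
  then have "\<forall>\<^sub>F j in sequentially. c j * \<xi>^2 * (B - (Nj j - 1 / real (Suc j))) < ?q + e / 2"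
    using e by (intro order_tendstoD) auto
  then obtain j where j: "c j * \<xi>^2 * (B - (Nj j - 1 / real (Suc j))) < ?q + e / 2"
    using eventually_happens by force
  \<comment> \<open>Fatou yields the inner mass of \<open>w\<close> only up to a small error\<close>
  define p where "p = Nj j - 1 / real (Suc j)"
  define r where "r = R j + \<xi> / 2"
  have Ifin: "\<forall>\<^sub>F n in sequentially. (\<integral>\<^sup>+x\<in>{-r..r}. dens \<xi> h (W n) x \<partial>lebesgue) \<le> ?I + ennreal (e / 2)"
  proof (cases "?I = \<infinity>")
    case False
    have "(\<integral>\<^sup>+x\<in>{-r..r}. dens \<xi> h w x \<partial>lebesgue) \<le> ?I"
      by (intro nn_integral_mono) (auto simp: indicator_def)
    also have "?I < ?I + ennreal (e / 2)"
      using False e by (intro ennreal_less_add_pos) (simp_all add: less_top)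
    finally have "(\<integral>\<^sup>+x\<in>{-r..r}. dens \<xi> h w x \<partial>lebesgue) < ?I + ennreal (e / 2)" .
    from order_tendstoD(2)[OF inner_tendsto[OF W l B xi w conv, of r] this] show ?thesis
      by eventually_elim simp
  qed simp
  have Nlow: "\<forall>\<^sub>F n in sequentially. ennreal p \<le> N2 {-R j<..<R j} (W n)"
  proof (cases "p \<le> 0")
    case True then show ?thesis by (simp add: ennreal_neg)
  next
    case False
    have "N2 {-R j<..<R j} w \<le> N2 UNIV w" by (rule N2_mono_set) simp
    then have "N2 {-R j<..<R j} w = ennreal (Nj j)"
      unfolding Nj_def using Nfin by (intro ennreal_enn2real[symmetric]) (simp add: order.strict_trans1)
    then have "ennreal p < N2 {-R j<..<R j} w"
      using False unfolding p_def by (simp add: ennreal_less_iff)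
    also have "\<dots> \<le> liminf (\<lambda>n. N2 {-R j<..<R j} (trunc (ereal (l n)) (W n)))"
      by (intro N2_fatou trunc_measurable cone_basic(1)[OF W] conv) simp
    finally have "\<forall>\<^sub>F n in sequentially. ennreal p < N2 {-R j<..<R j} (trunc (ereal (l n)) (W n))"
      by (rule less_LiminfD)
    then show ?thesis
    proof eventually_elim
      case (elim n)
      have "N2 {-R j<..<R j} (trunc (ereal (l n)) (W n)) \<le> N2 {-R j<..<R j} (W n)"
        unfolding N2_def trunc_def by (intro nn_integral_mono) (auto simp: indicator_def)
      with elim show ?case by simp
    qed
  qed
  have "\<forall>\<^sub>F n in sequentially. ?a n \<le> ?I + ennreal ?q + ennreal e"
    using Ifin Nlow filterlim_at_top_eventually_gt[OF l(2), of r]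
  proof eventually_elim
    case (elim n)
    define L where "L = Ivl (ereal (l n))"
    note [measurable] = dens_borel[OF cone_basic(1)[OF W]]
    have [simp]: "L \<in> sets lebesgue" unfolding L_def by simp
    have sub: "{-R j<..<R j} \<subseteq> L" using elim(3) xi unfolding L_def r_def by (auto simp: Ivl_simps)
    have tail: "N2 (L - {-R j<..<R j}) (W n) \<le> ennreal (B - p)"
    proof -
      have eq: "N2 L (W n) = N2 {-R j<..<R j} (W n) + N2 (L - {-R j<..<R j}) (W n)"
        by (rule N2_split[OF cone_basic(1)[OF W] _ _ sub]) auto
      have "ennreal p + N2 (L - {-R j<..<R j}) (W n) \<le> N2 L (W n)"
        unfolding eq by (intro add_right_mono elim(2))
      also have "\<dots> \<le> ennreal B" unfolding L_def by (rule B(1))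
      finally have le: "ennreal p + N2 (L - {-R j<..<R j}) (W n) \<le> ennreal B" .
      then obtain z where z: "N2 (L - {-R j<..<R j}) (W n) = ennreal z" "0 \<le> z"
        by (cases "N2 (L - {-R j<..<R j}) (W n)") (auto simp: top_unique)
      show ?thesis
      proof (cases "p \<le> 0")
        case True
        then have "ennreal z \<le> ennreal B" using le z by (simp add: ennreal_neg)
        also have "\<dots> \<le> ennreal (B - p)" using True by (intro ennreal_leI) simp
        finally show ?thesis using z by simp
      next
        case False
        then have "ennreal (p + z) \<le> ennreal B" using le z by (simp add: ennreal_plus)
        then have "p + z \<le> B" using B(2) by (simp add: ennreal_le_iff)
        then show ?thesis unfolding z by (intro ennreal_leI) simp
      qed
    qed
    have "?a n \<le> (\<integral>\<^sup>+x. dens \<xi> h (W n) x * indicator {-r..r} x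
        + dens \<xi> h (W n) x * indicator (L - {-r..r}) x \<partial>lebesgue)"
      unfolding L_def by (intro nn_integral_mono) (auto simp: indicator_def)
    also have "\<dots> = (\<integral>\<^sup>+x\<in>{-r..r}. dens \<xi> h (W n) x \<partial>lebesgue)
        + (\<integral>\<^sup>+x\<in>L - {-r..r}. dens \<xi> h (W n) x \<partial>lebesgue)"
      unfolding L_def by (intro nn_integral_add) measurable
    also have "\<dots> \<le> (?I + ennreal (e / 2)) + ennreal (c j * \<xi>^2) * N2 (L - {-R j<..<R j}) (W n)"
      unfolding L_def c_def r_def using elim Rpos
      by (intro add_mono outer_bound[OF W B xi]) (simp_all add: r_def)
    also have "\<dots> \<le> (?I + ennreal (e / 2)) + ennreal (c j * \<xi>^2) * ennreal (B - p)"
      by (intro add_left_mono mult_left_mono tail) simp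
    also have "ennreal (c j * \<xi>^2) * ennreal (B - p) \<le> ennreal (?q + e / 2)"
    proof (cases "0 \<le> B - p")
      case True
      then show ?thesis using j h_nonneg unfolding p_def[symmetric]
        by (subst ennreal_mult[symmetric]) (auto simp: c_def intro!: ennreal_leI)
    qed (simp add: ennreal_neg)
    also have "ennreal (?q + e / 2) \<le> ennreal ?q + ennreal (e / 2)"
    proof (cases "0 \<le> ?q")
      case False
      then have "ennreal (?q + e / 2) \<le> ennreal (e / 2)" by (intro ennreal_leI) linarith
      then show ?thesis by (rule order_trans) simp
    qed (use e in \<open>simp add: ennreal_plus\<close>)
    also have "(?I + ennreal (e / 2)) + (ennreal ?q + ennreal (e / 2)) = ?I + ennreal ?q + (ennreal (e / 2) + ennreal (e / 2))"
      by (simp add: ac_simps)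
    also have "ennreal (e / 2) + ennreal (e / 2) = ennreal e"
      using e by (subst ennreal_plus[symmetric]) auto
    finally show ?case by simp
  qed
  then show "limsup ?a \<le> ?I + ennreal ?q + ennreal e"
    by (rule Limsup_bounded)
qed

end

section \<open>Families of window widths\<close>

text \<open>Every point of the window has modulus at most \<open>\<bar>x\<bar> + \<xi> / 2\<close>.\<close>

lemma bumps_window_lower:
  assumes f: "f \<in> bumps" and xi: "0 \<le> \<xi>"
  shows "\<xi> * f (\<bar>x\<bar> + \<xi> / 2) \<le> avg \<xi> f x"
proof -
  let ?J = "{x - \<xi> / 2 .. x + \<xi> / 2}"
  have "\<xi> * f (\<bar>x\<bar> + \<xi> / 2) = avg \<xi> (\<lambda>_. f (\<bar>x\<bar> + \<xi> / 2)) x"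
    using xi by (simp add: avg_const)
  also have "\<dots> \<le> avg \<xi> f x"
    unfolding avg_def
  proof (rule set_integral_mono)
    show "set_integrable lebesgue ?J (\<lambda>_. f (\<bar>x\<bar> + \<xi> / 2))"
      by (auto simp: set_integrable_def emeasure_lborel_Icc_eq intro!: integrable_mult_left integrable_real_indicator)
    show "set_integrable lebesgue ?J f"
      by (intro N2_finite_imp_integrable bumps_lebesgue bumps_N2_finite f)
    show "f (\<bar>x\<bar> + \<xi> / 2) \<le> f t" if "t \<in> ?J" for t
      using that xi by (intro bumps_antimono[OF f]) auto
  qed
  finally show ?thesis .
qed

lemma window_integrable:
  assumes "W \<in> borel_measurable lebesgue" "N2 UNIV W < \<infinity>"
  shows "set_integrable lebesgue {x - \<xi> / 2 .. x + \<xi> / 2} W"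
  using assms(1) by (rule N2_finite_imp_integrable)
    (rule le_less_trans[OF N2_mono_set assms(2)], simp)

lemma avg_diff:
  assumes "u \<in> borel_measurable lebesgue" "N2 UNIV u < \<infinity>"
    and "v \<in> borel_measurable lebesgue" "N2 UNIV v < \<infinity>"
  shows "avg \<xi> (\<lambda>x. u x - v x) x = avg \<xi> u x - avg \<xi> v x"
  unfolding avg_def by (intro set_integral_diff window_integrable assms)

lemma avg_tendsto_L2:
  assumes f: "\<And>n. f n \<in> borel_measurable lebesgue" "\<And>n. N2 UNIV (f n) < \<infinity>"
    and w: "w \<in> borel_measurable lebesgue" "N2 UNIV w < \<infinity>"
    and lim: "(\<lambda>n. N2 UNIV (\<lambda>x. w x - f n x)) \<longlonglongrightarrow> 0" and xi: "0 \<le> \<xi>"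
  shows "(\<lambda>n. avg \<xi> (f n) x) \<longlonglongrightarrow> avg \<xi> w x"
proof -
  have le: "ennreal ((avg \<xi> w x - avg \<xi> (f n) x)^2) \<le> ennreal \<xi> * N2 UNIV (\<lambda>x. w x - f n x)" for n
  proof -
    have "ennreal ((avg \<xi> (\<lambda>x. w x - f n x) x)^2)
        \<le> ennreal \<xi> * N2 {x - \<xi> / 2 .. x + \<xi> / 2} (\<lambda>x. w x - f n x)"
      using f(1)[of n] w(1) by (intro avg_sq_le xi) measurable
    also have "\<dots> \<le> ennreal \<xi> * N2 UNIV (\<lambda>x. w x - f n x)"
      by (intro mult_left_mono N2_mono_set) auto
    finally show ?thesis unfolding avg_diff[OF w f] .
  qed
  have "(\<lambda>n. ennreal \<xi> * N2 UNIV (\<lambda>x. w x - f n x)) \<longlonglongrightarrow> ennreal \<xi> * 0"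
    by (rule ennreal_tendsto_cmult[OF _ lim]) simp
  then have up: "(\<lambda>n. ennreal \<xi> * N2 UNIV (\<lambda>x. w x - f n x)) \<longlonglongrightarrow> 0" by simp
  have "(\<lambda>n. ennreal ((avg \<xi> w x - avg \<xi> (f n) x)^2)) \<longlonglongrightarrow> 0"
    by (rule tendsto_sandwich[OF always_eventually[OF allI] always_eventually[OF allI] tendsto_const up])
       (rule zero_le, rule le)
  then have "(\<lambda>n. enn2real (ennreal ((avg \<xi> w x - avg \<xi> (f n) x)^2))) \<longlonglongrightarrow> 0"
    by (intro tendsto_enn2real) simp_all
  then have "(\<lambda>n. (avg \<xi> w x - avg \<xi> (f n) x)^2) \<longlonglongrightarrow> 0" by simp
  from tendsto_real_sqrt[OF this] have "(\<lambda>n. avg \<xi> w x - avg \<xi> (f n) x) \<longlonglongrightarrow> 0"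
    by (simp add: tendsto_rabs_zero_iff)
  from tendsto_diff[OF tendsto_const[of "avg \<xi> w x"] this] show ?thesis by simp
qed

lemma cone_inf_scale:
  assumes w: "w \<in> cone \<infinity>" and a: "0 \<le> a"
  shows "(\<lambda>x. a * w x) \<in> cone \<infinity>"
proof (rule cone_infI)
  note wb = cone_basic[OF w, unfolded Ivl_simps]
  show "(\<lambda>x. a * w x) \<in> borel_measurable lebesgue" using wb(1) by measurable
  show "N2 UNIV (\<lambda>x. a * w x) < \<infinity>"
    using wb by (subst N2_cmult) (auto simp: ennreal_mult_less_top)
  fix e :: real assume e: "0 < e"
  \<comment> \<open>adding \<open>1\<close> covers \<open>a = 0\<close>\<close>
  define d where "d = e / (a^2 + 1)"
  have d: "0 < d" using e by (simp add: d_def add_nonneg_pos)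
  obtain f where f: "f \<in> bumps" "N2 UNIV (\<lambda>x. trunc \<infinity> w x - f x) < ennreal d"
    using cone_approx[OF w _ d] by auto
  have t: "trunc \<infinity> w = w" by (rule ext) (simp add: trunc_def Ivl_simps)
  have "N2 UNIV (\<lambda>x. a * w x - a * f x) = N2 UNIV (\<lambda>x. a * (w x - f x))"
    by (simp add: right_diff_distrib)
  also have "\<dots> = ennreal (a^2) * N2 UNIV (\<lambda>x. w x - f x)"
    using wb(1) bumps_lebesgue[OF f(1)] by (intro N2_cmult) auto
  also have "\<dots> \<le> ennreal (a^2) * ennreal d"
    using f(2) unfolding t by (intro mult_left_mono) auto
  also have "\<dots> = ennreal (a^2 * d)" using d by (simp add: ennreal_mult)
  also have "\<dots> < ennreal e"
  proof (rule ennreal_lessI[OF e])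
    have "a^2 * d < (a^2 + 1) * d" using d by simp
    also have "\<dots> = e" unfolding d_def by (simp add: add_nonneg_eq_0_iff)
    finally show "a^2 * d < e" .
  qed
  finally show "\<exists>f\<in>bumps. N2 UNIV (\<lambda>x. a * w x - f x) < ennreal e"
    by (intro bexI[of _ "\<lambda>x. a * f x"] bumps_cmult f a)
qed

lemma bump_of_mass:
  assumes w: "w \<in> cone \<infinity>" "N2 UNIV w = ennreal B" and B: "0 < B"
  obtains f where "f \<in> bumps" "N2 UNIV f = ennreal B" 
proof -
  have pos: "0 < (\<infinity>::ereal)" by simp
  obtain g where g: "\<And>n. g n \<in> bumps" and lim: "(\<lambda>n. N2 UNIV (g n)) \<longlonglongrightarrow> N2 (Ivl \<infinity>) w"
    using cone_approx_seq[OF w(1) pos] by blast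
  have "\<forall>\<^sub>F n in sequentially. 0 < N2 UNIV (g n)"
    using B w(2) by (intro order_tendstoD(1)[OF lim]) (simp add: Ivl_simps)
  then obtain n where n: "0 < N2 UNIV (g n)" using eventually_happens by force
  define m where "m = enn2real (N2 UNIV (g n))"
  have m: "N2 UNIV (g n) = ennreal m" "0 < m"
    using n bumps_N2_finite[OF g, of UNIV n] by (auto simp: m_def enn2real_positive_iff)
  have "N2 UNIV (\<lambda>x. sqrt (B / m) * g n x) = ennreal ((sqrt (B / m))^2) * N2 UNIV (g n)"
    by (intro N2_cmult bumps_lebesgue g) simp
  also have "\<dots> = ennreal B" using m B by (simp add: ennreal_mult[symmetric])
  finally show thesis using B m by (intro that[OF bumps_cmult[OF g]]) auto
qed

text \<open>Discrete coupling is counting measure on finitely many indices, continuous coupling is Lebesgue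
  measure on the half-line with \<open>\<xi>\<close> the identity. The hypothesis \<open>tame\<close> is the integrability condition
  of continuous coupling in terms of \<open>h\<close>, with \<open>B\<close> in place of \<open>2 * K\<close>.\<close>

locale coupling_family =
  fixes \<nu> :: "'i measure" and \<xi> :: "'i \<Rightarrow> real" and h :: "'i \<Rightarrow> real \<Rightarrow> real"
  assumes xi_measurable [measurable]: "\<xi> \<in> borel_measurable \<nu>"
    and xi_pos: "i \<in> space \<nu> \<Longrightarrow> 0 < \<xi> i"
    and h_measurable: "(\<lambda>(i, r). h i r) \<in> borel_measurable (\<nu> \<Otimes>\<^sub>M borel)"
    and h_mono: "i \<in> space \<nu> \<Longrightarrow> mono (h i)"
    and h_cont: "i \<in> space \<nu> \<Longrightarrow> continuous_on UNIV (h i)"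
    and h_nonneg: "i \<in> space \<nu> \<Longrightarrow> 0 \<le> h i r"
    and tame: "0 < B \<Longrightarrow> (\<integral>\<^sup>+i. ennreal ((\<xi> i)^2 * h i (sqrt (\<xi> i) * sqrt B)) \<partial>\<nu>) < \<infinity>"
begin

definition energy :: "real set \<Rightarrow> (real \<Rightarrow> real) \<Rightarrow> 'i \<Rightarrow> ennreal" where
  "energy S W i = (\<integral>\<^sup>+x\<in>S. dens (\<xi> i) (h i) W x \<partial>lebesgue)"

definition P :: "ereal \<Rightarrow> (real \<Rightarrow> real) \<Rightarrow> ennreal" where
  "P L W = (\<integral>\<^sup>+i. energy (Ivl L) W i \<partial>\<nu>)"

definition Q :: "(real \<Rightarrow> real) \<Rightarrow> ennreal" where
  "Q W = (\<integral>\<^sup>+i. ennreal (h i 0) * (\<integral>\<^sup>+x. ennreal ((avg (\<xi> i) W x)^2) \<partial>lebesgue) \<partial>\<nu>)"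

text \<open>Up to a constant, this dominates the contribution of windows longer than the period, see
  \<open>energy_large\<close>.\<close>

definition tail_mass :: "real \<Rightarrow> real \<Rightarrow> ennreal" where
  "tail_mass c l = (\<integral>\<^sup>+i. ennreal ((\<xi> i)^2 * h i (\<xi> i * c)) * indicator {i. 2 * l < \<xi> i} i \<partial>\<nu>)"

text \<open>The largest quadratic energy per unit of mass; it is approached by flat functions, see \<open>q_le\<close>.\<close>

definition q :: ennreal where
  "q = (\<integral>\<^sup>+i. ennreal (h i 0 * (\<xi> i)^2) \<partial>\<nu>)"

lemma h_compose [measurable (raw)]:
  assumes "f \<in> M \<rightarrow>\<^sub>M \<nu>" "g \<in> borel_measurable M"
  shows "(\<lambda>x. h (f x) (g x)) \<in> borel_measurable M"
  using measurable_compose[OF measurable_Pair[OF assms] h_measurable] by simp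

lemma dens_pair_measurable:
  assumes "W \<in> borel_measurable lebesgue"
  shows "(\<lambda>(i, x). dens (\<xi> i) (h i) W x) \<in> borel_measurable (\<nu> \<Otimes>\<^sub>M lborel)"
  unfolding dens_def split_beta
  using assms by measurable

lemma dens_measurable:
  assumes "W \<in> borel_measurable lebesgue" "i \<in> space \<nu>"
  shows "dens (\<xi> i) (h i) W \<in> borel_measurable lebesgue"
proof -
  have "dens (\<xi> i) (h i) W \<in> borel_measurable lborel"
    using measurable_Pair2[OF dens_pair_measurable[OF assms(1)] assms(2)] by simp
  then show ?thesis by (rule measurable_completion)
qed

lemma energy_measurable [measurable]:
  assumes W: "W \<in> borel_measurable lebesgue" and S: "S \<in> sets borel"
  shows "energy S W \<in> borel_measurable \<nu>"
proof -
  note dens_pair_measurable[OF W, measurable]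
  have "(\<lambda>(i, x). dens (\<xi> i) (h i) W x * indicator S x) \<in> borel_measurable (\<nu> \<Otimes>\<^sub>M lborel)"
    using S unfolding split_beta by measurable
  then have "(\<lambda>i. \<integral>\<^sup>+x. dens (\<xi> i) (h i) W x * indicator S x \<partial>lborel) \<in> borel_measurable \<nu>"
    by (rule lborel.borel_measurable_nn_integral)
  then show ?thesis unfolding energy_def[abs_def] nn_integral_completion .
qed

lemma dens_eq_mono:
  assumes "i \<in> space \<nu>" "0 \<le> r" "r \<le> s"
  shows "ennreal (r^2 * h i r) \<le> ennreal (s^2 * h i s)"
  using density_mono[OF h_mono[OF assms(1)] h_cont[OF assms(1)] h_nonneg[OF assms(1)] assms(2,3)]
  by (rule ennreal_leI)

lemma dens_mono:
  assumes "i \<in> space \<nu>" "0 \<le> avg (\<xi> i) u x" "avg (\<xi> i) u x \<le> avg (\<xi> i) v x"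
  shows "dens (\<xi> i) (h i) u x \<le> dens (\<xi> i) (h i) v x"
  unfolding dens_def by (rule dens_eq_mono[OF assms])

text \<open>Windows no longer than the period: the average is at most \<open>sqrt (\<xi> i) * sqrt B\<close>, which bounds \<open>h\<close>,
  and Young's inequality bounds the remaining square.\<close>

lemma energy_small:
  assumes i: "i \<in> space \<nu>" and W: "W \<in> cone L" and L: "0 < L" "ereal (\<xi> i) \<le> 2 * L"
    and B: "N2 (Ivl L) W \<le> ennreal B" "0 \<le> B"
  shows "energy (Ivl L) W i \<le> ennreal (B * ((\<xi> i)^2 * h i (sqrt (\<xi> i) * sqrt B)))"
proof -
  note Wb = cone_basic[OF W]
  have xi: "0 < \<xi> i" using xi_pos[OF i] .
  define c where "c = h i (sqrt (\<xi> i) * sqrt B)"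
  have c: "0 \<le> c" unfolding c_def by (rule h_nonneg[OF i])
  note [measurable] = avg_lebesgue_measurable[OF Wb(1)]
  have "energy (Ivl L) W i \<le> (\<integral>\<^sup>+x. ennreal c * (ennreal ((avg (\<xi> i) W x)^2) * indicator (Ivl L) x) \<partial>lebesgue)"
    unfolding energy_def
  proof (intro nn_integral_mono)
    fix x
    have "avg (\<xi> i) W x \<le> sqrt (\<xi> i) * sqrt B"
      using xi L Wb B by (intro avg_le_small[of _ L]) auto
    then have "h i (avg (\<xi> i) W x) \<le> c" unfolding c_def by (rule monoD[OF h_mono[OF i]])
    then have "(avg (\<xi> i) W x)^2 * h i (avg (\<xi> i) W x) \<le> c * (avg (\<xi> i) W x)^2"
      by (subst mult.commute) (intro mult_right_mono, auto)
    then have "dens (\<xi> i) (h i) W x \<le> ennreal c * ennreal ((avg (\<xi> i) W x)^2)"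
      unfolding dens_def using c by (subst ennreal_mult[symmetric]) (auto intro: ennreal_leI)
    then show "dens (\<xi> i) (h i) W x * indicator (Ivl L) x \<le> ennreal c * (ennreal ((avg (\<xi> i) W x)^2) * indicator (Ivl L) x)"
      by (cases "x \<in> Ivl L") auto
  qed
  also have "\<dots> = ennreal c * (\<integral>\<^sup>+x\<in>Ivl L. ennreal ((avg (\<xi> i) W x)^2) \<partial>lebesgue)"
    by (intro nn_integral_cmult) measurable
  also have "\<dots> \<le> ennreal c * (ennreal ((\<xi> i)^2) * N2 (Ivl L) W)"
    using xi by (intro mult_left_mono young_avg L Wb) auto
  also have "\<dots> \<le> ennreal c * (ennreal ((\<xi> i)^2) * ennreal B)"
    by (intro mult_left_mono B) auto
  also have "\<dots> = ennreal (B * ((\<xi> i)^2 * c))"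
    using c B by (simp add: ennreal_mult[symmetric] mult_ac)
  finally show ?thesis unfolding c_def .
qed

text \<open>Windows longer than the period: the average is at most \<open>\<xi> i * sqrt (B / l)\<close> everywhere. Squaring it
  produces a factor \<open>1 / l\<close> that compensates the length \<open>2 * l\<close> of the domain of integration.\<close>

lemma energy_large:
  assumes i: "i \<in> space \<nu>" and W: "W \<in> cone (ereal l)" and l: "0 < l" "2 * l < \<xi> i"
    and B: "N2 (Ivl (ereal l)) W \<le> ennreal B" "0 \<le> B"
  shows "energy (Ivl (ereal l)) W i \<le> ennreal (2 * B * ((\<xi> i)^2 * h i (\<xi> i * sqrt (B / l))))"
proof -
  note Wb = cone_basic[OF W]
  have xi: "0 < \<xi> i" using xi_pos[OF i] .
  define s where "s = \<xi> i * sqrt (B / l)"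
  have s: "0 \<le> s" using xi B l by (simp add: s_def)
  have "avg (\<xi> i) W x \<le> s" for x
  proof -
    have "ennreal ((avg (\<xi> i) W x)^2) \<le> ennreal ((\<xi> i)^2 / l) * ennreal B"
      using avg_sq_le_large[OF l(1) less_imp_le[OF l(2)] Wb(2,1)]
      by (rule order_trans) (intro mult_left_mono B, simp)
    then have "(avg (\<xi> i) W x)^2 \<le> (\<xi> i)^2 / l * B"
      using B l by (simp add: ennreal_mult[symmetric] ennreal_le_iff)
    also have "\<dots> = s^2" using B l by (simp add: s_def power_mult_distrib)
    finally show ?thesis using s by (rule power2_le_imp_le)
  qed
  then have "dens (\<xi> i) (h i) W x \<le> ennreal (s^2 * h i s)" for x
    unfolding dens_def using l by (intro dens_eq_mono[OF i] avg_nonneg[OF cone_AE(1)[OF W]]) auto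
  then have "energy (Ivl (ereal l)) W i \<le> (\<integral>\<^sup>+x. ennreal (s^2 * h i s) * indicator (Ivl (ereal l)) x \<partial>lebesgue)"
    unfolding energy_def by (intro nn_integral_mono mult_right_mono) auto
  also have "\<dots> = ennreal (s^2 * h i s) * ennreal (2 * l)"
    using l by (subst nn_integral_cmult_indicator) (auto simp: Ivl_simps)
  also have "\<dots> = ennreal (s^2 * h i s * (2 * l))"
    using l h_nonneg[OF i] by (simp add: ennreal_mult)
  also have "s^2 * h i s * (2 * l) = 2 * B * ((\<xi> i)^2 * h i s)"
    using B l by (simp add: s_def power_mult_distrib)
  finally show ?thesis unfolding s_def .
qed

lemma P_inf_finite:
  assumes W: "W \<in> cone \<infinity>" and B: "N2 UNIV W \<le> ennreal B" "0 \<le> B"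
  shows "P \<infinity> W \<le> ennreal B * (\<integral>\<^sup>+i. ennreal ((\<xi> i)^2 * h i (sqrt (\<xi> i) * sqrt B)) \<partial>\<nu>)"
proof -
  have "P \<infinity> W \<le> (\<integral>\<^sup>+i. ennreal B * ennreal ((\<xi> i)^2 * h i (sqrt (\<xi> i) * sqrt B)) \<partial>\<nu>)"
    unfolding P_def
  proof (intro nn_integral_mono)
    fix i assume i: "i \<in> space \<nu>"
    show "energy (Ivl \<infinity>) W i \<le> ennreal B * ennreal ((\<xi> i)^2 * h i (sqrt (\<xi> i) * sqrt B))"
      using energy_small[OF i W _ _ _ B(2)] B h_nonneg[OF i]
      by (simp add: ennreal_mult Ivl_simps)
  qed
  also have "\<dots> = ennreal B * (\<integral>\<^sup>+i. ennreal ((\<xi> i)^2 * h i (sqrt (\<xi> i) * sqrt B)) \<partial>\<nu>)"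
    by (intro nn_integral_cmult) measurable
  finally show ?thesis .
qed

text \<open>Reverse Fatou over the parameter \<open>i\<close> applied to \<open>local_limsup\<close>. The dominating function \<open>b\<close> combines
  \<open>energy_small\<close> and \<open>energy_large\<close>; it is a bound only for large \<open>n\<close>, whence the truncated sequence \<open>u\<close>.\<close>

lemma limsup_P:
  assumes W: "\<And>n. W n \<in> cone (ereal (l n))" and l: "\<And>n. 0 < l n" "filterlim l at_top sequentially"
    and B: "\<And>n. N2 (Ivl (ereal (l n))) (W n) \<le> ennreal B" "0 < B"
    and w: "w \<in> borel_measurable lebesgue" and N: "N2 UNIV w = ennreal N" "0 \<le> N" "N \<le> B"
    and conv: "AE x in lebesgue. (\<lambda>n. trunc (ereal (l n)) (W n) x) \<longlonglongrightarrow> w x"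
    and c: "0 < c" and tail: "tail_mass c l0 < \<infinity>"
  shows "limsup (\<lambda>n. P (ereal (l n)) (W n)) \<le> P \<infinity> w + q * ennreal (B - N)"
proof -
  define b where "b i = ennreal B * ennreal ((\<xi> i)^2 * h i (sqrt (\<xi> i) * sqrt B))
     + ennreal (2 * B) * (ennreal ((\<xi> i)^2 * h i (\<xi> i * c)) * indicator {i. 2 * l0 < \<xi> i} i)" for i
  have ind: "(\<lambda>i. ennreal ((\<xi> i)^2 * h i (\<xi> i * c)) * indicator {i. 2 * l0 < \<xi> i} i) \<in> borel_measurable \<nu>"
    by measurable
  have bm [measurable]: "b \<in> borel_measurable \<nu>" unfolding b_def using ind by measurable
  have "integral\<^sup>N \<nu> b = (\<integral>\<^sup>+i. ennreal B * ennreal ((\<xi> i)^2 * h i (sqrt (\<xi> i) * sqrt B)) \<partial>\<nu>)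
     + (\<integral>\<^sup>+i. ennreal (2 * B) * (ennreal ((\<xi> i)^2 * h i (\<xi> i * c)) * indicator {i. 2 * l0 < \<xi> i} i) \<partial>\<nu>)"
    unfolding b_def using ind by (intro nn_integral_add) measurable
  also have "\<dots> = ennreal B * (\<integral>\<^sup>+i. ennreal ((\<xi> i)^2 * h i (sqrt (\<xi> i) * sqrt B)) \<partial>\<nu>)
     + ennreal (2 * B) * (\<integral>\<^sup>+i. ennreal ((\<xi> i)^2 * h i (\<xi> i * c)) * indicator {i. 2 * l0 < \<xi> i} i \<partial>\<nu>)"
    using ind by (intro arg_cong2[where f="(+)"] nn_integral_cmult) measurable
  also have "\<dots> < \<infinity>" using tame[OF B(2)] tail by (simp add: ennreal_mult_less_top tail_mass_def)
  finally have bfin: "integral\<^sup>N \<nu> b < \<infinity>" .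
  define u where "u n i = min (energy (Ivl (ereal (l n))) (W n) i) (b i)" for n i
  note Em = energy_measurable[OF cone_basic(1)[OF W] Ivl_sets]
  note [measurable] = Em
  have bound: "\<forall>\<^sub>F n in sequentially. \<forall>i\<in>space \<nu>. energy (Ivl (ereal (l n))) (W n) i \<le> b i"
    using filterlim_at_top_eventually_gt[OF l(2), of l0] filterlim_at_top_eventually_gt[OF l(2), of "B / c^2"]
  proof eventually_elim
    case (elim n)
    have "B / l n \<le> c^2" using elim(2) c l(1)[of n] by (simp add: field_simps)
    then have sq: "sqrt (B / l n) \<le> c" using c by (intro real_le_lsqrt) auto
    show ?case
    proof
      fix i assume i: "i \<in> space \<nu>"
      show "energy (Ivl (ereal (l n))) (W n) i \<le> b i"
      proof (cases "\<xi> i \<le> 2 * l n")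
        case True
        then have "ereal (\<xi> i) \<le> 2 * ereal (l n)" by (simp add: numeral_eq_ereal)
        then have "energy (Ivl (ereal (l n))) (W n) i \<le> ennreal (B * ((\<xi> i)^2 * h i (sqrt (\<xi> i) * sqrt B)))"
          using l(1)[of n] B by (intro energy_small[OF i W]) auto
        also have "\<dots> \<le> b i"
          unfolding b_def using B(2) h_nonneg[OF i] by (simp add: ennreal_mult)
        finally show ?thesis .
      next
        case False
        then have "energy (Ivl (ereal (l n))) (W n) i \<le> ennreal (2 * B * ((\<xi> i)^2 * h i (\<xi> i * sqrt (B / l n))))"
          using l(1)[of n] B by (intro energy_large[OF i W]) auto
        also have "\<dots> \<le> ennreal (2 * B * ((\<xi> i)^2 * h i (\<xi> i * c)))"
          using B sq xi_pos[OF i] by (intro ennreal_leI mult_left_mono monoD[OF h_mono[OF i]]) auto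
        also have "\<dots> = ennreal (2 * B) * (ennreal ((\<xi> i)^2 * h i (\<xi> i * c)) * indicator {i. 2 * l0 < \<xi> i} i)"
          using False elim(1) B(2) h_nonneg[OF i] by (simp add: ennreal_mult)
        also have "\<dots> \<le> b i" unfolding b_def by simp
        finally show ?thesis .
      qed
    qed
  qed
  have "limsup (\<lambda>n. P (ereal (l n)) (W n)) = limsup (\<lambda>n. integral\<^sup>N \<nu> (u n))"
  proof (rule Limsup_eq)
    show "\<forall>\<^sub>F n in sequentially. P (ereal (l n)) (W n) = integral\<^sup>N \<nu> (u n)"
      using bound by eventually_elim (auto simp: P_def u_def min_def intro!: nn_integral_cong)
  qed
  also have "\<dots> \<le> (\<integral>\<^sup>+i. limsup (\<lambda>n. u n i) \<partial>\<nu>)"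
    by (rule nn_integral_limsup[OF _ bm _ bfin]) (auto simp: u_def[abs_def])
  also have "\<dots> \<le> (\<integral>\<^sup>+i. energy (Ivl \<infinity>) w i + ennreal (h i 0 * (\<xi> i)^2) * ennreal (B - N) \<partial>\<nu>)"
  proof (intro nn_integral_mono)
    fix i assume i: "i \<in> space \<nu>"
    have "limsup (\<lambda>n. u n i) \<le> limsup (\<lambda>n. energy (Ivl (ereal (l n))) (W n) i)"
      by (intro Limsup_mono always_eventually) (simp add: u_def)
    also have "\<dots> \<le> energy (Ivl \<infinity>) w i + ennreal (h i 0 * (\<xi> i)^2 * (B - N))"
      using local_limsup[OF h_mono[OF i] h_cont[OF i] h_nonneg[OF i] W l B(1) _ xi_pos[OF i] w N(1,2) conv] B(2)
      by (simp add: energy_def Ivl_simps)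
    also have "ennreal (h i 0 * (\<xi> i)^2 * (B - N)) = ennreal (h i 0 * (\<xi> i)^2) * ennreal (B - N)"
      using N h_nonneg[OF i] by (intro ennreal_mult) auto
    finally show "limsup (\<lambda>n. u n i) \<le> energy (Ivl \<infinity>) w i + ennreal (h i 0 * (\<xi> i)^2) * ennreal (B - N)" .
  qed
  also have "\<dots> = P \<infinity> w + (\<integral>\<^sup>+i. ennreal (h i 0 * (\<xi> i)^2) * ennreal (B - N) \<partial>\<nu>)"
    unfolding P_def by (intro nn_integral_add energy_measurable w) auto
  also have "(\<integral>\<^sup>+i. ennreal (h i 0 * (\<xi> i)^2) * ennreal (B - N) \<partial>\<nu>) = q * ennreal (B - N)"
    unfolding q_def by (intro nn_integral_multc) measurable
  finally show ?thesis .
qed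

text \<open>Enlarging the average by the factor \<open>a \<ge> 1\<close> also enlarges \<open>h\<close>.\<close>

lemma P_scale:
  assumes w: "w \<in> cone \<infinity>" and a: "1 \<le> a"
  shows "ennreal (a^2) * P \<infinity> w \<le> P \<infinity> (\<lambda>x. a * w x)"
proof -
  have wm: "w \<in> borel_measurable lebesgue" using cone_basic(1)[OF w] .
  have nn: "0 \<le> avg (\<xi> i) w x" for i x by (rule avg_nonneg[OF cone_AE(1)[OF w]]) simp
  have "ennreal (a^2) * P \<infinity> w = (\<integral>\<^sup>+i. ennreal (a^2) * energy (Ivl \<infinity>) w i \<partial>\<nu>)"
    unfolding P_def by (intro nn_integral_cmult[symmetric] energy_measurable wm) simp
  also have "\<dots> \<le> P \<infinity> (\<lambda>x. a * w x)"
    unfolding P_def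
  proof (intro nn_integral_mono)
    fix i assume i: "i \<in> space \<nu>"
    have "ennreal (a^2) * energy (Ivl \<infinity>) w i = (\<integral>\<^sup>+x. ennreal (a^2) * dens (\<xi> i) (h i) w x \<partial>lebesgue)"
      unfolding energy_def using dens_measurable[OF wm i] by (subst nn_integral_cmult) (simp_all add: Ivl_simps)
    also have "\<dots> \<le> (\<integral>\<^sup>+x. dens (\<xi> i) (h i) (\<lambda>x. a * w x) x \<partial>lebesgue)"
    proof (intro nn_integral_mono)
      fix x
      define y where "y = avg (\<xi> i) w x"
      have "1 * y \<le> a * y" using a nn[of i x] unfolding y_def by (intro mult_right_mono)
      then have "h i y \<le> h i (a * y)" by (intro monoD[OF h_mono[OF i]]) simp
      then have "a^2 * (y^2 * h i y) \<le> (a * y)^2 * h i (a * y)"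
        by (simp add: power_mult_distrib mult.assoc[symmetric]) (intro mult_left_mono, auto)
      then show "ennreal (a^2) * dens (\<xi> i) (h i) w x \<le> dens (\<xi> i) (h i) (\<lambda>x. a * w x) x"
        unfolding dens_def avg_cmult y_def[symmetric] using h_nonneg[OF i]
        by (subst ennreal_mult[symmetric]) (auto intro: ennreal_leI)
    qed
    finally show "ennreal (a^2) * energy (Ivl \<infinity>) w i \<le> energy (Ivl \<infinity>) (\<lambda>x. a * w x) i"
      by (simp add: energy_def Ivl_simps)
  qed
  finally show ?thesis .
qed

text \<open>A function with positive quadratic energy therefore has positive energy, as required in \<open>cone_K\<close>.\<close>

lemma Q_le_P:
  assumes w: "w \<in> cone \<infinity>" shows "Q w \<le> P \<infinity> w"
  unfolding Q_def P_def
proof (intro nn_integral_mono)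
  fix i assume i: "i \<in> space \<nu>"
  note [measurable] = avg_lebesgue_measurable[OF cone_basic(1)[OF w]]
  have nn: "0 \<le> avg (\<xi> i) w x" for x by (rule avg_nonneg[OF cone_AE(1)[OF w]]) simp
  have "ennreal (h i 0) * (\<integral>\<^sup>+x. ennreal ((avg (\<xi> i) w x)^2) \<partial>lebesgue)
      = (\<integral>\<^sup>+x. ennreal (h i 0) * ennreal ((avg (\<xi> i) w x)^2) \<partial>lebesgue)"
    by (intro nn_integral_cmult[symmetric]) measurable
  also have "\<dots> \<le> energy (Ivl \<infinity>) w i"
    unfolding energy_def dens_def
  proof (intro nn_integral_mono)
    fix x
    have "h i 0 * (avg (\<xi> i) w x)^2 \<le> h i (avg (\<xi> i) w x) * (avg (\<xi> i) w x)^2"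
      using nn by (intro mult_right_mono monoD[OF h_mono[OF i]]) auto
    then show "ennreal (h i 0) * ennreal ((avg (\<xi> i) w x)^2)
       \<le> ennreal ((avg (\<xi> i) w x)^2 * h i (avg (\<xi> i) w x)) * indicator (Ivl \<infinity>) x"
      using h_nonneg[OF i] by (simp add: Ivl_simps ennreal_mult[symmetric] mult.commute ennreal_leI)
  qed
  finally show "ennreal (h i 0) * (\<integral>\<^sup>+x. ennreal ((avg (\<xi> i) w x)^2) \<partial>lebesgue) \<le> energy (Ivl \<infinity>) w i" .
qed

lemma avg_mass_measurable:
  assumes "W \<in> borel_measurable lebesgue"
  shows "(\<lambda>i. \<integral>\<^sup>+x. ennreal ((avg (\<xi> i) W x)^2) \<partial>lebesgue) \<in> borel_measurable \<nu>"
proof -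
  have "(\<lambda>(i, x). ennreal ((avg (\<xi> i) W x)^2)) \<in> borel_measurable (\<nu> \<Otimes>\<^sub>M lborel)"
    using assms unfolding split_beta by measurable
  then show ?thesis unfolding nn_integral_completion by (rule lborel.borel_measurable_nn_integral)
qed

lemma P_fatou:
  assumes v: "\<And>n. v n \<in> borel_measurable lebesgue" and S: "\<And>n. S n \<in> sets borel"
    and conv: "\<And>i x. i \<in> space \<nu> \<Longrightarrow> (\<lambda>n. avg (\<xi> i) (v n) x) \<longlonglongrightarrow> avg (\<xi> i) w x"
    and Sev: "\<And>x. \<forall>\<^sub>F n in sequentially. x \<in> S n"
  shows "P \<infinity> w \<le> liminf (\<lambda>n. \<integral>\<^sup>+i. energy (S n) (v n) i \<partial>\<nu>)"
proof -
  have "P \<infinity> w \<le> (\<integral>\<^sup>+i. liminf (\<lambda>n. energy (S n) (v n) i) \<partial>\<nu>)"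
    unfolding P_def
  proof (intro nn_integral_mono)
    fix i assume i: "i \<in> space \<nu>"
    note [measurable] = dens_measurable[OF v i]
    have [measurable]: "S n \<in> sets lebesgue" for n using S[of n] by simp
    have "energy (Ivl \<infinity>) w i = (\<integral>\<^sup>+x. liminf (\<lambda>n. dens (\<xi> i) (h i) (v n) x * indicator (S n) x) \<partial>lebesgue)"
      unfolding energy_def
    proof (intro nn_integral_cong)
      fix x
      have "(\<lambda>n. h i (avg (\<xi> i) (v n) x)) \<longlonglongrightarrow> h i (avg (\<xi> i) w x)"
        by (rule continuous_on_tendsto_compose[OF h_cont[OF i] conv[OF i]]) auto
      from tendsto_ennrealI[OF tendsto_mult[OF tendsto_power[OF conv[OF i], of _ 2] this]]
      have d: "(\<lambda>n. dens (\<xi> i) (h i) (v n) x) \<longlonglongrightarrow> dens (\<xi> i) (h i) w x" unfolding dens_def .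
      have "(\<lambda>n. dens (\<xi> i) (h i) (v n) x * indicator (S n) x) \<longlonglongrightarrow> dens (\<xi> i) (h i) w x"
        by (rule Lim_transform_eventually[OF d]) (use Sev[of x] in eventually_elim, simp)
      from lim_imp_Liminf[OF sequentially_bot this]
      show "dens (\<xi> i) (h i) w x * indicator (Ivl \<infinity>) x = liminf (\<lambda>n. dens (\<xi> i) (h i) (v n) x * indicator (S n) x)"
        by (simp add: Ivl_simps)
    qed
    also have "\<dots> \<le> liminf (\<lambda>n. energy (S n) (v n) i)"
      unfolding energy_def by (intro nn_integral_liminf) measurable
    finally show "energy (Ivl \<infinity>) w i \<le> liminf (\<lambda>n. energy (S n) (v n) i)" .
  qed
  also have "\<dots> \<le> liminf (\<lambda>n. \<integral>\<^sup>+i. energy (S n) (v n) i \<partial>\<nu>)"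
    by (intro nn_integral_liminf energy_measurable v S)
  finally show ?thesis .
qed

text \<open>By Fatou \<open>P \<infinity>\<close> is lower semicontinuous along strongly convergent bumps, also after their masses
  have been corrected to \<open>B\<close>.\<close>

lemma bump_approx_P:
  assumes w: "w \<in> cone \<infinity>" "N2 UNIV w = ennreal B" "0 < B" and a: "a < P \<infinity> w"
  obtains f where "f \<in> bumps" "N2 UNIV f = ennreal B" "a < P \<infinity> f"
proof -
  have wb: "w \<in> borel_measurable lebesgue" "N2 UNIV w < \<infinity>"
    using cone_basic[OF w(1)] by (simp_all add: Ivl_simps)
  have t: "trunc \<infinity> w = w" by (rule ext) (simp add: trunc_def Ivl_simps)
  have pos: "0 < (\<infinity>::ereal)" by simp
  obtain g where g: "\<And>n. g n \<in> bumps" and lim: "(\<lambda>n. N2 UNIV (g n)) \<longlonglongrightarrow> N2 (Ivl \<infinity>) w"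
    and dif: "(\<lambda>n. N2 UNIV (\<lambda>x. trunc \<infinity> w x - g n x)) \<longlonglongrightarrow> 0"
    using cone_approx_seq[OF w(1) pos] by blast
  define m where "m n = enn2real (N2 UNIV (g n))" for n
  have m: "N2 UNIV (g n) = ennreal (m n)" for n
    using bumps_N2_finite[OF g, of UNIV n] by (simp add: m_def)
  have mB: "m \<longlonglongrightarrow> B" unfolding m_def using lim w by (intro tendsto_enn2real) (simp_all add: Ivl_simps)
  define a' where "a' n = sqrt (B / m n)" for n
  have "(\<lambda>n. sqrt (B / m n)) \<longlonglongrightarrow> sqrt (B / B)"
    using w(3) by (intro tendsto_real_sqrt tendsto_divide tendsto_const mB) simp
  then have a1: "a' \<longlonglongrightarrow> 1" using w(3) by (simp add: a'_def[abs_def])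
  define v where "v n x = a' n * g n x" for n x
  have vm: "v n \<in> borel_measurable lebesgue" for n
    unfolding v_def using bumps_lebesgue[OF g[of n]] by measurable
  have "P \<infinity> w \<le> liminf (\<lambda>n. \<integral>\<^sup>+i. energy UNIV (v n) i \<partial>\<nu>)"
  proof (rule P_fatou[OF vm])
    fix i x assume i: "i \<in> space \<nu>"
    have "(\<lambda>n. avg (\<xi> i) (g n) x) \<longlonglongrightarrow> avg (\<xi> i) w x"
      using dif[unfolded t] xi_pos[OF i]
      by (intro avg_tendsto_L2 wb bumps_lebesgue g bumps_N2_finite) auto
    from tendsto_mult[OF a1 this] show "(\<lambda>n. avg (\<xi> i) (v n) x) \<longlonglongrightarrow> avg (\<xi> i) w x"
      unfolding v_def avg_cmult by simp
  qed auto
  then have "a < liminf (\<lambda>n. P \<infinity> (v n))" using a by (simp add: P_def Ivl_simps)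
  then have "\<forall>\<^sub>F n in sequentially. a < P \<infinity> (v n)" by (rule less_LiminfD)
  moreover have "\<forall>\<^sub>F n in sequentially. 0 < m n" by (rule order_tendstoD(1)[OF mB w(3)])
  ultimately have "\<forall>\<^sub>F n in sequentially. a < P \<infinity> (v n) \<and> 0 < m n" by eventually_elim simp
  then obtain n where n: "a < P \<infinity> (v n)" "0 < m n" using eventually_happens by force
  have "N2 UNIV (v n) = ennreal ((a' n)^2) * N2 UNIV (g n)"
    unfolding v_def by (intro N2_cmult bumps_lebesgue g) simp
  also have "\<dots> = ennreal B" unfolding m a'_def using n w(3) by (simp add: ennreal_mult[symmetric])
  finally have "N2 UNIV (v n) = ennreal B" .
  moreover have "v n \<in> bumps" unfolding v_def a'_def using n w(3) by (intro bumps_cmult g) simp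
  ultimately show thesis using n that by blast
qed

lemma periodize_ge:
  assumes "f \<in> bumps" "0 < l" "b < l" "\<And>x. b \<le> \<bar>x\<bar> \<Longrightarrow> f x = 0"
  shows "f x \<le> periodize l f x" "0 \<le> periodize l f x"
proof -
  show nn: "0 \<le> periodize l f x" unfolding periodize_def by (rule bumpsD(3)[OF assms(1)])
  show "f x \<le> periodize l f x"
  proof (cases "\<bar>x\<bar> < l")
    case True
    then have "periodize l f x = f x" using assms(2) by (intro periodize_eq) auto
    then show ?thesis by simp
  next
    case False
    then have "f x = 0" using assms(3) by (intro assms(4)) simp
    then show ?thesis using nn by simp
  qed
qed

lemma periodize_window_integrable:
  assumes "f \<in> bumps"
  shows "set_integrable lebesgue {x - c / 2 .. x + c / 2} (periodize l f)"
proof (rule N2_finite_imp_integrable)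
  show "periodize l f \<in> borel_measurable lebesgue"
    using periodize_borel[OF assms] by (intro measurable_completion) simp
  have "N2 {x - c / 2 .. x + c / 2} (periodize l f)
      \<le> (\<integral>\<^sup>+y. ennreal ((f 0)^2) * indicator {x - c / 2 .. x + c / 2} y \<partial>lebesgue)"
    unfolding N2_def
  proof (intro nn_integral_mono mult_right_mono ennreal_leI power_mono)
    show "periodize l f y \<le> f 0" "0 \<le> periodize l f y" for y
      unfolding periodize_def using bumps_antimono[OF assms, of 0] bumpsD(3)[OF assms] by auto
  qed simp
  also have "\<dots> < \<infinity>"
    by (subst nn_integral_cmult_indicator) (auto simp: ennreal_mult_less_top emeasure_lborel_Icc_eq)
  finally show "N2 {x - c / 2 .. x + c / 2} (periodize l f) < \<infinity>" .
qed

text \<open>The periodic extension dominates the bump, so its averages do as well; what is lost by integrating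
  over one period only tends to \<open>0\<close> with increasing period.\<close>

lemma periodize_P:
  assumes f: "f \<in> bumps" and a: "a < P \<infinity> f" and b: "0 < b" "\<And>x. b \<le> \<bar>x\<bar> \<Longrightarrow> f x = 0"
  shows "\<forall>\<^sub>F l in at_top. a < P (ereal l) (periodize l f)"
proof -
  have fm: "f \<in> borel_measurable lebesgue" by (rule bumps_lebesgue[OF f])
  have "P \<infinity> f \<le> liminf (\<lambda>n. \<integral>\<^sup>+i. energy (Ivl (ereal (real n))) f i \<partial>\<nu>)"
  proof (rule P_fatou)
    show "\<forall>\<^sub>F n in sequentially. x \<in> Ivl (ereal (real n))" for x
      using filterlim_at_top_eventually_gt[OF filterlim_real_sequentially, of "\<bar>x\<bar>"]
      by eventually_elim (auto simp: Ivl_simps)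
  qed (auto simp: fm)
  then have "a < liminf (\<lambda>n. \<integral>\<^sup>+i. energy (Ivl (ereal (real n))) f i \<partial>\<nu>)" using a by simp
  then have "\<forall>\<^sub>F n in sequentially. a < (\<integral>\<^sup>+i. energy (Ivl (ereal (real n))) f i \<partial>\<nu>)" by (rule less_LiminfD)
  then obtain n where n: "a < (\<integral>\<^sup>+i. energy (Ivl (ereal (real n))) f i \<partial>\<nu>)" using eventually_happens by force
  have "a < P (ereal l) (periodize l f)" if l: "b < l" "real n < l" for l
  proof -
    have l0: "0 < l" using b l by simp
    have "(\<integral>\<^sup>+i. energy (Ivl (ereal (real n))) f i \<partial>\<nu>) \<le> P (ereal l) (periodize l f)"
      unfolding P_def
    proof (intro nn_integral_mono)
      fix i assume i: "i \<in> space \<nu>"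
      show "energy (Ivl (ereal (real n))) f i \<le> energy (Ivl (ereal l)) (periodize l f) i"
        unfolding energy_def
      proof (intro nn_integral_mono mult_mono)
        fix x
        have "0 \<le> avg (\<xi> i) f x" by (rule avg_nonneg) (simp add: bumpsD(3)[OF f])
        moreover have "avg (\<xi> i) f x \<le> avg (\<xi> i) (periodize l f) x"
          by (rule avg_mono[OF _ _ periodize_window_integrable[OF f] fm])
             (auto simp: bumpsD(3)[OF f] periodize_ge(1)[OF f l0 l(1) b(2)])
        ultimately show "dens (\<xi> i) (h i) f x \<le> dens (\<xi> i) (h i) (periodize l f) x" by (rule dens_mono[OF i])
        show "indicator (Ivl (ereal (real n))) x \<le> (indicator (Ivl (ereal l)) x :: ennreal)"
          using l by (auto simp: indicator_def Ivl_simps)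
      qed auto
    qed
    with n show ?thesis by simp
  qed
  then show ?thesis
    using eventually_conj[OF eventually_gt_at_top[of b] eventually_gt_at_top[of "real n"]]
    by (auto elim!: eventually_mono)
qed

text \<open>Dilating \<open>f\<close> at constant mass flattens it. For the flattened functions \<open>g n\<close> the window average is
  at least \<open>\<xi> * g n (\<bar>x\<bar> + \<xi> / 2)\<close>. Undoing the dilation turns the shift \<open>\<xi> / 2\<close> into \<open>c n * \<xi> / 2\<close>, which
  tends to \<open>0\<close>, so the quadratic energy is in the limit at least \<open>h i 0 * (\<xi> i)^2\<close> times the mass.\<close>

lemma q_le:
  assumes f: "f \<in> bumps" "N2 UNIV f = ennreal B" and s: "\<And>g. g \<in> bumps \<Longrightarrow> N2 UNIV g = ennreal B \<Longrightarrow> Q g \<le> s"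
  shows "q * ennreal B \<le> s"
proof -
  define c where "c n = 1 / real (Suc n)" for n
  have c: "0 < c n" for n by (simp add: c_def)
  have c0: "c \<longlonglongrightarrow> 0" unfolding c_def by (rule LIMSEQ_Suc[OF lim_1_over_n])
  define g where "g n x = sqrt (c n) * f (c n * x)" for n x
  have g: "g n \<in> bumps" for n
    unfolding g_def using c[of n] by (intro bumps_cmult bumps_dilate f) auto
  have fl: "f \<in> borel_measurable borel" using bumps_borel[OF f(1)] .
  have affine: "(\<integral>\<^sup>+x. ennreal (c n) * F (c n * x) \<partial>lebesgue) = (\<integral>\<^sup>+x. F x \<partial>lebesgue)"
    if "F \<in> borel_measurable lebesgue" for F n
  proof -
    have "(\<integral>\<^sup>+x. ennreal (c n) * F (c n * x) \<partial>lebesgue) = ennreal (c n) * (\<integral>\<^sup>+x. F (c n * x) \<partial>lebesgue)"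
      using measurable_lebesgue_affine[of F, where c="c n" and t=0] c[of n] that
      by (intro nn_integral_cmult) auto
    also have "\<dots> = (\<integral>\<^sup>+x. F x \<partial>lebesgue)"
      using nn_integral_real_affine_lebesgue[OF that, of "c n" 0] c[of n] by simp
    finally show ?thesis .
  qed
  have gN: "N2 UNIV (g n) = ennreal B" for n
  proof -
    have "N2 UNIV (g n) = (\<integral>\<^sup>+x. ennreal (c n) * ennreal ((f (c n * x))^2) \<partial>lebesgue)"
      unfolding N2_def g_def using c[of n] by (intro nn_integral_cong) (simp add: power_mult_distrib ennreal_mult)
    also have "\<dots> = (\<integral>\<^sup>+x. ennreal ((f x)^2) \<partial>lebesgue)"
      using bumps_lebesgue[OF f(1)] by (intro affine) measurable
    also have "\<dots> = ennreal B" using f(2) by (simp add: N2_def)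
    finally show ?thesis .
  qed
  define A where "A n i = ennreal (h i 0) * (\<integral>\<^sup>+x. ennreal ((avg (\<xi> i) (g n) x)^2) \<partial>lebesgue)" for n i
  have Am: "A n \<in> borel_measurable \<nu>" for n
    unfolding A_def[abs_def] using avg_mass_measurable[OF bumps_lebesgue[OF g[of n]]] by measurable
  have low: "ennreal (h i 0 * (\<xi> i)^2) * ennreal B \<le> liminf (\<lambda>n. A n i)" if i: "i \<in> space \<nu>" for i
  proof -
    have xi: "0 < \<xi> i" using xi_pos[OF i] .
    define k where "k = h i 0 * (\<xi> i)^2"
    have k: "0 \<le> k" using h_nonneg[OF i] by (simp add: k_def)
    define F where "F n y = ennreal k * ennreal ((f (\<bar>y\<bar> + c n * \<xi> i / 2))^2)" for n y
    have Fm: "F n \<in> borel_measurable lebesgue" for n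
    proof -
      have "F n \<in> borel_measurable borel" unfolding F_def using fl by measurable
      then show ?thesis by (intro measurable_completion) simp
    qed
    have A_ge: "(\<integral>\<^sup>+y. F n y \<partial>lebesgue) \<le> A n i" for n
    proof -
      have "(\<integral>\<^sup>+y. F n y \<partial>lebesgue) = (\<integral>\<^sup>+x. ennreal (c n) * F n (c n * x) \<partial>lebesgue)"
        by (rule affine[OF Fm, symmetric])
      also have "\<dots> \<le> (\<integral>\<^sup>+x. ennreal (h i 0) * ennreal ((avg (\<xi> i) (g n) x)^2) \<partial>lebesgue)"
      proof (intro nn_integral_mono)
        fix x
        have eq: "c n * (\<bar>x\<bar> + \<xi> i / 2) = \<bar>c n * x\<bar> + c n * \<xi> i / 2"
          using c[of n] by (simp add: abs_mult algebra_simps)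
        have "(\<xi> i * g n (\<bar>x\<bar> + \<xi> i / 2))^2 \<le> (avg (\<xi> i) (g n) x)^2"
          using xi bumpsD(3)[OF g] by (intro power_mono bumps_window_lower g) auto
        then have "h i 0 * (\<xi> i * g n (\<bar>x\<bar> + \<xi> i / 2))^2 \<le> h i 0 * (avg (\<xi> i) (g n) x)^2"
          by (intro mult_left_mono h_nonneg[OF i])
        then have "ennreal (c n * (k * (f (\<bar>c n * x\<bar> + c n * \<xi> i / 2))^2)) \<le> ennreal (h i 0 * (avg (\<xi> i) (g n) x)^2)"
          using c[of n] unfolding g_def eq by (intro ennreal_leI) (simp add: k_def power_mult_distrib mult_ac)
        then show "ennreal (c n) * F n (c n * x) \<le> ennreal (h i 0) * ennreal ((avg (\<xi> i) (g n) x)^2)"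
          unfolding F_def using c[of n] k h_nonneg[OF i] by (simp add: ennreal_mult[symmetric])
      qed
      also have "\<dots> = A n i"
        unfolding A_def
      proof (rule nn_integral_cmult)
        show "(\<lambda>x. ennreal ((avg (\<xi> i) (g n) x)^2)) \<in> borel_measurable lebesgue"
          by (intro measurable_compose[OF _ measurable_ennreal] borel_measurable_power
              avg_lebesgue_measurable[OF bumps_lebesgue[OF g[of n]]])
      qed
      finally show ?thesis .
    qed
    have "ennreal k * ennreal B = (\<integral>\<^sup>+y. ennreal k * ennreal ((f y)^2) \<partial>lebesgue)"
      using bumps_lebesgue[OF f(1)] f(2) by (subst nn_integral_cmult) (auto simp: N2_def)
    also have "\<dots> = (\<integral>\<^sup>+y. liminf (\<lambda>n. F n y) \<partial>lebesgue)"
    proof (intro nn_integral_cong)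
      fix y
      have "(\<lambda>n. \<bar>y\<bar> + c n * \<xi> i / 2) \<longlonglongrightarrow> \<bar>y\<bar> + 0 * \<xi> i / 2"
        by (intro tendsto_intros c0) auto
      then have "(\<lambda>n. f (\<bar>y\<bar> + c n * \<xi> i / 2)) \<longlonglongrightarrow> f \<bar>y\<bar>"
        using continuous_on_tendsto_compose[OF bumps_continuous[OF f(1), of UNIV]] by simp
      then have "(\<lambda>n. f (\<bar>y\<bar> + c n * \<xi> i / 2)) \<longlonglongrightarrow> f y" by (simp add: bumps_abs[OF f(1)])
      from tendsto_ennrealI[OF tendsto_mult[OF tendsto_const[of k] tendsto_power[OF this, of 2]]]
      have "(\<lambda>n. F n y) \<longlonglongrightarrow> ennreal k * ennreal ((f y)^2)"
        unfolding F_def using k by (simp add: ennreal_mult)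
      from lim_imp_Liminf[OF sequentially_bot this]
      show "ennreal k * ennreal ((f y)^2) = liminf (\<lambda>n. F n y)" by simp
    qed
    also have "\<dots> \<le> liminf (\<lambda>n. \<integral>\<^sup>+y. F n y \<partial>lebesgue)"
      by (intro nn_integral_liminf Fm)
    also have "\<dots> \<le> liminf (\<lambda>n. A n i)"
      by (intro Liminf_mono always_eventually allI A_ge)
    finally show ?thesis unfolding k_def .
  qed
  have "q * ennreal B = (\<integral>\<^sup>+i. ennreal (h i 0 * (\<xi> i)^2) * ennreal B \<partial>\<nu>)"
    unfolding q_def by (intro nn_integral_multc[symmetric]) measurable
  also have "\<dots> \<le> (\<integral>\<^sup>+i. liminf (\<lambda>n. A n i) \<partial>\<nu>)" by (intro nn_integral_mono low)
  also have "\<dots> \<le> liminf (\<lambda>n. integral\<^sup>N \<nu> (A n))" by (intro nn_integral_liminf Am)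
  also have "\<dots> \<le> s"
  proof (rule Liminf_le)
    show "\<forall>\<^sub>F n in sequentially. integral\<^sup>N \<nu> (A n) \<le> s"
      using s[OF g gN] by (intro always_eventually) (simp add: Q_def A_def[abs_def])
  qed simp
  finally show ?thesis .
qed

text \<open>For windows longer than the period the average of the periodic extension of \<open>f\<close> is at least a fixed
  multiple of the window length, independently of the centre. Finite energy of this one function
  therefore bounds \<open>tail_mass\<close>.\<close>

lemma tail_of_finite:
  assumes f: "f \<in> bumps" "0 < N2 UNIV f" and b: "0 < b" "\<And>x. b \<le> \<bar>x\<bar> \<Longrightarrow> f x = 0" and l: "b < l"
    and fin: "P (ereal l) (periodize l f) < \<infinity>"
  shows "\<exists>c>0. tail_mass c l < \<infinity>"
proof -
  have l0: "0 < l" using b l by simp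
  define p where "p = periodize l f"
  have pm: "p \<in> borel_measurable lebesgue"
    unfolding p_def using periodize_borel[OF f(1)] by (intro measurable_completion) simp
  have pn: "0 \<le> p x" for x unfolding p_def periodize_def by (rule bumpsD(3)[OF f(1)])
  have per: "ennreal (p (x + 2 * l)) = ennreal (p x)" for x
    using periodize_periodic[OF l0, of f] by (simp add: periodic_def p_def)
  define M where "M = (\<integral>\<^sup>+x\<in>Ivl (ereal l). ennreal (p x) \<partial>lebesgue)"
  have "M \<noteq> 0"
  proof
    assume "M = 0"
    then have "AE x in lebesgue. ennreal (p x) * indicator (Ivl (ereal l)) x = 0"
      unfolding M_def using pm by (subst (asm) nn_integral_0_iff_AE) auto
    then have "AE x in lebesgue. ennreal ((f x)^2) * indicator UNIV x = 0"
    proof eventually_elim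
      case (elim x)
      show ?case
      proof (cases "\<bar>x\<bar> < l")
        case True
        then have "p x = f x" unfolding p_def by (intro periodize_eq l0) auto
        then show ?thesis using elim True bumpsD(3)[OF f(1), of x] by (auto simp: Ivl_simps indicator_def abs_less_iff)
      next
        case False
        then show ?thesis using b(2)[of x] l by simp
      qed
    qed
    then have "N2 UNIV f = 0"
      unfolding N2_def using bumps_lebesgue[OF f(1)] by (subst nn_integral_0_iff_AE) auto
    with f(2) show False by simp
  qed
  have "\<exists>k>0. ennreal k \<le> M"
  proof (cases M)
    case (real r)
    then show ?thesis using \<open>M \<noteq> 0\<close> by (intro exI[of _ r]) auto
  qed (auto intro: exI[of _ 1])
  then obtain k where k: "0 < k" "ennreal k \<le> M" by blast
  \<comment> \<open>a window of length \<open>s > 2 * l\<close> contains at least \<open>s / (4 * l)\<close> full periods\<close>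
  define c where "c = k / (4 * l)"
  have c: "0 < c" using k l0 by (simp add: c_def)
  have low: "c * s \<le> avg s p x" if s: "2 * l < s" for s x
  proof -
    define n where "n = nat \<lfloor>s / (2 * l)\<rfloor>"
    have "1 < s / (2 * l)" using s l0 by (simp add: field_simps)
    then have n: "real n \<le> s / (2 * l)" "s / (2 * l) < real n + 1" "1 \<le> n"
      unfolding n_def by linarith+
    have n1: "real n * (2 * l) \<le> s" using n(1) l0 by (simp add: field_simps)
    have "s / (2 * l) \<le> 2 * real n" using n(2,3) by linarith
    then have n2: "c * s \<le> real n * k" using l0 k unfolding c_def by (simp add: field_simps)
    have int: "set_integrable lebesgue {x - s / 2 .. x + s / 2} p"
      unfolding p_def by (rule periodize_window_integrable[OF f(1)])
    have "ennreal (c * s) \<le> ennreal (real n * k)" using n2 by (rule ennreal_leI)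
    also have "\<dots> \<le> of_nat n * M"
      using k by (simp add: ennreal_mult ennreal_of_nat_eq_real_of_nat[symmetric] mult_left_mono)
    also have "\<dots> = (\<integral>\<^sup>+t\<in>{x - s / 2..<x - s / 2 + real n * (2 * l)}. ennreal (p t) \<partial>lebesgue)"
      unfolding M_def using pm by (intro periods_integral[where g="\<lambda>x. ennreal (p x)", OF l0 per, symmetric]) measurable
    also have "\<dots> \<le> (\<integral>\<^sup>+t\<in>{x - s / 2 .. x + s / 2}. ennreal (p t) \<partial>lebesgue)"
      using n1 by (intro nn_set_integral_set_mono) auto
    also have "\<dots> = (\<integral>\<^sup>+t. ennreal (indicator {x - s / 2 .. x + s / 2} t *\<^sub>R p t) \<partial>lebesgue)"
      by (intro nn_integral_cong) (auto simp: indicator_def)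
    also have "\<dots> = ennreal (avg s p x)"
      unfolding avg_def set_lebesgue_integral_def using int pn
      by (intro nn_integral_eq_integral) (auto simp: set_integrable_def)
    finally show ?thesis using avg_nonneg[of p s x] pn by (simp add: ennreal_le_iff)
  qed
  have "(\<integral>\<^sup>+i. ennreal (2 * l * c^2) * (ennreal ((\<xi> i)^2 * h i (\<xi> i * c)) * indicator {i. 2 * l < \<xi> i} i) \<partial>\<nu>)
      \<le> P (ereal l) p"
    unfolding P_def
  proof (intro nn_integral_mono)
    fix i assume i: "i \<in> space \<nu>"
    show "ennreal (2 * l * c^2) * (ennreal ((\<xi> i)^2 * h i (\<xi> i * c)) * indicator {i. 2 * l < \<xi> i} i)
       \<le> energy (Ivl (ereal l)) p i"
    proof (cases "2 * l < \<xi> i")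
      case True
      have d: "ennreal ((\<xi> i * c)^2 * h i (\<xi> i * c)) \<le> dens (\<xi> i) (h i) p x" for x
        unfolding dens_def using low[OF True, of x] c xi_pos[OF i]
        by (intro dens_eq_mono[OF i]) (auto simp: mult.commute)
      have "ennreal (2 * l * c^2) * ennreal ((\<xi> i)^2 * h i (\<xi> i * c)) = ennreal ((\<xi> i * c)^2 * h i (\<xi> i * c)) * ennreal (2 * l)"
        using l0 h_nonneg[OF i] by (simp add: ennreal_mult[symmetric] power_mult_distrib mult_ac)
      also have "\<dots> = (\<integral>\<^sup>+x. ennreal ((\<xi> i * c)^2 * h i (\<xi> i * c)) * indicator (Ivl (ereal l)) x \<partial>lebesgue)"
        using l0 by (subst nn_integral_cmult_indicator) (auto simp: Ivl_simps)
      also have "\<dots> \<le> energy (Ivl (ereal l)) p i"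
        unfolding energy_def by (intro nn_integral_mono mult_right_mono d) simp
      finally show ?thesis using True by simp
    qed simp
  qed
  also have "\<dots> < \<infinity>" using fin by (simp add: p_def)
  also have "(\<integral>\<^sup>+i. ennreal (2 * l * c^2) * (ennreal ((\<xi> i)^2 * h i (\<xi> i * c)) * indicator {i. 2 * l < \<xi> i} i) \<partial>\<nu>)
     = ennreal (2 * l * c^2) * (\<integral>\<^sup>+i. ennreal ((\<xi> i)^2 * h i (\<xi> i * c)) * indicator {i. 2 * l < \<xi> i} i \<partial>\<nu>)"
    by (intro nn_integral_cmult) measurable
  finally show ?thesis
    using c l0 by (intro exI[of _ c]) (auto simp: ennreal_mult_less_top tail_mass_def)
qed

end

section \<open>The maximization problem for a family\<close>

text \<open>By Scheffe's lemma the squares converge in the mean, and \<open>(v - w)^2 \<le> \<bar>v^2 - w^2\<bar>\<close> for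
  nonnegative \<open>v\<close> and \<open>w\<close>.\<close>

lemma N2_scheffe:
  assumes v: "\<And>n. v n \<in> borel_measurable lebesgue" "\<And>n. AE x in lebesgue. 0 \<le> v n x"
    and w: "w \<in> borel_measurable lebesgue" "\<And>x. 0 \<le> w x"
    and N: "\<And>n. N2 UNIV (v n) = ennreal B" "N2 UNIV w = ennreal B"
    and conv: "AE x in lebesgue. (\<lambda>n. v n x) \<longlonglongrightarrow> w x"
  shows "(\<lambda>n. N2 UNIV (\<lambda>x. v n x - w x)) \<longlonglongrightarrow> 0"
proof -
  have int: "integrable lebesgue (\<lambda>x. (u x)^2)" if "u \<in> borel_measurable lebesgue" "N2 UNIV u = ennreal B" for u
    using set_integrable_square_iff[OF that(1), of UNIV] that(2) by (simp add: set_integrable_def)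
  have eq: "(\<integral>\<^sup>+x. norm ((u x)^2) \<partial>lebesgue) = N2 UNIV u" for u
    by (simp add: N2_def)
  have up: "(\<lambda>n. \<integral>\<^sup>+x. norm ((v n x)^2 - (w x)^2) \<partial>lebesgue) \<longlonglongrightarrow> 0"
  proof (rule Scheffe_lemma1)
    show "integrable lebesgue (\<lambda>x. (v n x)^2)" for n by (rule int[OF v(1) N(1)])
    show "integrable lebesgue (\<lambda>x. (w x)^2)" by (rule int[OF w(1) N(2)])
    show "AE x in lebesgue. (\<lambda>n. (v n x)^2) \<longlonglongrightarrow> (w x)^2"
      using conv by eventually_elim (rule tendsto_power)
    show "limsup (\<lambda>n. \<integral>\<^sup>+x. norm ((v n x)^2) \<partial>lebesgue) \<le> (\<integral>\<^sup>+x. norm ((w x)^2) \<partial>lebesgue)"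
      unfolding eq N by (rule Limsup_bounded) simp
  qed
  have le: "N2 UNIV (\<lambda>x. v n x - w x) \<le> (\<integral>\<^sup>+x. norm ((v n x)^2 - (w x)^2) \<partial>lebesgue)" for n
    unfolding N2_def
  proof (rule nn_integral_mono_AE)
    show "AE x in lebesgue. ennreal ((v n x - w x)^2) * indicator UNIV x \<le> ennreal (norm ((v n x)^2 - (w x)^2))"
      using v(2)[of n]
    proof eventually_elim
      case (elim x)
      have "\<bar>v n x - w x\<bar> \<le> v n x + w x" using elim w(2)[of x] by linarith
      then have "\<bar>v n x - w x\<bar> * \<bar>v n x - w x\<bar> \<le> \<bar>v n x - w x\<bar> * (v n x + w x)"
        by (intro mult_left_mono) auto
      also have "\<dots> = \<bar>(v n x - w x) * (v n x + w x)\<bar>"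
        using elim w(2)[of x] by (simp add: abs_mult)
      also have "(v n x - w x) * (v n x + w x) = (v n x)^2 - (w x)^2"
        by (simp add: power2_eq_square algebra_simps)
      finally have "(v n x - w x)^2 \<le> \<bar>(v n x)^2 - (w x)^2\<bar>" by (simp add: power2_eq_square)
      then show ?case by (simp add: ennreal_leI)
    qed
  qed
  show ?thesis
    by (rule tendsto_sandwich[OF always_eventually[OF allI] always_eventually[OF allI] tendsto_const up])
       (rule zero_le, rule le)
qed

context coupling_family
begin

text \<open>In contrast to \<open>P_sup\<close>, functions of zero energy are admitted; this does not change the supremum.\<close>

definition S :: "ereal \<Rightarrow> real \<Rightarrow> ennreal" where
  "S L B = (SUP W\<in>{W\<in>cone L. N2 (Ivl L) W = ennreal B}. P L W)"

lemma S_upper: "W \<in> cone L \<Longrightarrow> N2 (Ivl L) W = ennreal B \<Longrightarrow> P L W \<le> S L B"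
  unfolding S_def by (rule SUP_upper) simp

lemma S_inf_finite: "0 < B \<Longrightarrow> S \<infinity> B < \<infinity>"
proof -
  assume B: "0 < B"
  have "S \<infinity> B \<le> ennreal B * (\<integral>\<^sup>+i. ennreal ((\<xi> i)^2 * h i (sqrt (\<xi> i) * sqrt B)) \<partial>\<nu>)"
    unfolding S_def
  proof (rule SUP_least)
    fix W assume "W \<in> {W \<in> cone \<infinity>. N2 (Ivl \<infinity>) W = ennreal B}"
    then show "P \<infinity> W \<le> ennreal B * (\<integral>\<^sup>+i. ennreal ((\<xi> i)^2 * h i (sqrt (\<xi> i) * sqrt B)) \<partial>\<nu>)"
      using B by (intro P_inf_finite) (auto simp: Ivl_simps)
  qed
  also have "\<dots> < \<infinity>" using tame[OF B] by (simp add: ennreal_mult_less_top)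
  finally show ?thesis .
qed

text \<open>Scale \<open>w\<close> up to mass \<open>B\<close> and apply \<open>P_scale\<close>.\<close>

lemma P_le_fraction:
  assumes w: "w \<in> cone \<infinity>" "N2 UNIV w = ennreal N" and N: "0 \<le> N" "N \<le> B" and B: "0 < B"
  shows "P \<infinity> w \<le> ennreal (N / B) * S \<infinity> B"
proof (cases "N = 0")
  case True
  then have "P \<infinity> w \<le> 0" using P_inf_finite[OF w(1), of 0] w(2) by simp
  then show ?thesis by simp
next
  case False
  then have N0: "0 < N" using N by simp
  define a where "a = sqrt (B / N)"
  have a: "1 \<le> a" "a^2 = B / N" using N N0 B by (auto simp: a_def)
  have "N2 UNIV (\<lambda>x. a * w x) = ennreal (a^2) * ennreal N"
    using cone_basic(1)[OF w(1)] by (subst N2_cmult) (simp_all add: w(2))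
  also have "\<dots> = ennreal B" unfolding a(2) using N0 B by (simp add: ennreal_mult[symmetric])
  finally have m: "N2 (Ivl \<infinity>) (\<lambda>x. a * w x) = ennreal B" by (simp add: Ivl_simps)
  have sc: "(\<lambda>x. a * w x) \<in> cone \<infinity>" using a by (intro cone_inf_scale w) simp
  have "ennreal (B / N) * P \<infinity> w \<le> S \<infinity> B"
    by (rule order_trans[OF P_scale[OF w(1) a(1), unfolded a(2)] S_upper[OF sc m]])
  then have "ennreal (N / B) * (ennreal (B / N) * P \<infinity> w) \<le> ennreal (N / B) * S \<infinity> B"
    by (rule mult_left_mono) simp
  moreover have "ennreal (N / B) * (ennreal (B / N) * P \<infinity> w) = P \<infinity> w"
    using N0 B by (simp add: mult.assoc[symmetric] ennreal_mult[symmetric])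
  ultimately show ?thesis by simp
qed

context
  fixes B :: real and sQ :: ennreal and c l0 :: real
  assumes B: "0 < B"
    and sQ: "\<And>g. g \<in> bumps \<Longrightarrow> N2 UNIV g = ennreal B \<Longrightarrow> Q g \<le> sQ"
    and strict: "sQ < S \<infinity> B"
    and c: "0 < c"
    and tail: "tail_mass c l0 < \<infinity>"
begin

lemma test_bump:
  obtains f where "f \<in> bumps" "N2 UNIV f = ennreal B"
proof -
  have "0 < S \<infinity> B" using strict by (rule le_less_trans[rotated]) simp
  then obtain W where "W \<in> cone \<infinity>" "N2 UNIV W = ennreal B"
    unfolding S_def less_SUP_iff by (auto simp: Ivl_simps)
  then show thesis using bump_of_mass[OF _ _ B] that by blast
qed

text \<open>The strict gap provides a function of positive energy, hence a nonzero bump, which serves as the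
  cutoff in the compactness argument.\<close>

lemma test_cutoff:
  obtains \<eta> where "\<eta> \<in> bumps" "\<eta> 0 = 1"
proof -
  obtain f where f: "f \<in> bumps" "N2 UNIV f = ennreal B" by (rule test_bump)
  have "f 0 \<noteq> 0"
  proof
    assume "f 0 = 0"
    then have "f x = 0" for x
      using bumps_antimono[OF f(1), of 0 x] bumpsD(3)[OF f(1), of x] by simp
    then have "N2 UNIV f = 0" by (simp add: N2_def)
    then show False using f(2) B by simp
  qed
  then have "0 < f 0" using bumpsD(3)[OF f(1), of 0] by simp
  then show thesis by (intro that[OF bumps_cmult[OF f(1), of "1 / f 0"]]) simp_all
qed

text \<open>The energy gap excludes loss of mass. With \<open>th = N / B\<close> the limsup is at most
  \<open>th * S \<infinity> B + (1 - th) * sQ\<close>, which is strictly less than \<open>S \<infinity> B\<close> unless \<open>th = 1\<close>.\<close>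

lemma concentration:
  assumes W: "\<And>n. W n \<in> cone (ereal (l n))" and l: "\<And>n. 0 < l n" "filterlim l at_top sequentially"
    and mass: "\<And>n. N2 (Ivl (ereal (l n))) (W n) = ennreal B"
  shows "\<exists>(s :: nat \<Rightarrow> nat) w. strict_mono s \<and> w \<in> cone \<infinity> \<and> (\<forall>x. 0 \<le> w x) \<and>
    (AE x in lebesgue. (\<lambda>n. trunc (ereal (l (s n))) (W (s n)) x) \<longlonglongrightarrow> w x) \<and>
    limsup (\<lambda>n. P (ereal (l (s n))) (W (s n))) \<le> S \<infinity> B \<and>
    (S \<infinity> B \<le> limsup (\<lambda>n. P (ereal (l (s n))) (W (s n))) \<longrightarrow> N2 UNIV w = ennreal B \<and> P \<infinity> w = S \<infinity> B)"
proof -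
  obtain \<eta> where eta: "\<eta> \<in> bumps" "\<eta> 0 = 1" by (rule test_cutoff)
  have L: "0 < ereal (l n)" for n using l(1) by simp
  have mB: "N2 (Ivl (ereal (l n))) (W n) \<le> ennreal B" for n by (simp add: mass)
  obtain s :: "nat \<Rightarrow> nat" and w where s: "strict_mono s" and w: "w \<in> cone \<infinity>" "\<And>x. 0 \<le> w x"
    and Nw: "N2 UNIV w \<le> ennreal B"
    and conv: "AE x in lebesgue. (\<lambda>n. trunc (ereal (l (s n))) (W (s n)) x) \<longlonglongrightarrow> w x"
    using cone_compactness[where W=W and L="\<lambda>n. ereal (l n)", OF W L eta mB less_imp_le[OF B]] by blast
  obtain N where N: "N2 UNIV w = ennreal N" "0 \<le> N"
  proof (cases "N2 UNIV w")
    case top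
    then show ?thesis using Nw by (simp add: top_unique)
  qed blast
  have NB: "N \<le> B" using Nw B N by (simp add: ennreal_le_iff)
  have ls: "filterlim (\<lambda>n. l (s n)) at_top sequentially"
    using filterlim_compose[OF l(2) filterlim_subseq[OF s]] .
  have up: "limsup (\<lambda>n. P (ereal (l (s n))) (W (s n))) \<le> P \<infinity> w + q * ennreal (B - N)"
    by (rule limsup_P[OF W l(1) ls _ B cone_basic(1)[OF w(1)] N NB conv c tail]) (simp add: mass)
  obtain f where f: "f \<in> bumps" "N2 UNIV f = ennreal B" by (rule test_bump)
  have "q * ennreal B \<le> sQ" by (rule q_le[OF f sQ])
  obtain p where p: "S \<infinity> B = ennreal p" "0 \<le> p"
    using S_inf_finite[OF B] by (cases "S \<infinity> B") simp_all
  obtain t where t: "sQ = ennreal t" "0 \<le> t" using strict unfolding p(1) by (cases sQ) simp_all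
  have tp: "t < p" using strict t p by (simp add: ennreal_less_iff)
  have "q * ennreal B < \<infinity>" using \<open>q * ennreal B \<le> sQ\<close> t by (simp add: le_less_trans)
  then obtain r where r: "q = ennreal r" "0 \<le> r"
  proof (cases q)
    case top
    then show ?thesis using \<open>q * ennreal B < \<infinity>\<close> B by (simp add: ennreal_top_mult)
  qed blast
  have rB: "r * B \<le> t" using \<open>q * ennreal B \<le> sQ\<close> r t B by (simp add: ennreal_mult[symmetric] ennreal_le_iff)
  define th where "th = N / B"
  have th: "0 \<le> th" "th \<le> 1" "N = th * B" using N NB B by (simp_all add: th_def)
  have "P \<infinity> w + q * ennreal (B - N) \<le> ennreal th * ennreal p + ennreal r * ennreal (B - N)"
    using P_le_fraction[OF w(1) N NB B] unfolding th_def[symmetric] p r by (intro add_right_mono)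
  also have "\<dots> = ennreal (th * p + r * (B - N))"
    using th p r NB by (simp add: ennreal_mult ennreal_plus)
  also have "th * p + r * (B - N) = th * p + (1 - th) * (r * B)"
    using th(3) by (simp add: algebra_simps)
  also have "\<dots> \<le> th * p + (1 - th) * t"
    using th rB by (intro add_left_mono mult_left_mono) auto
  finally have bd: "P \<infinity> w + q * ennreal (B - N) \<le> ennreal (th * p + (1 - th) * t)"
    by (simp add: ennreal_leI)
  have gap: "th * p + (1 - th) * t = p - (1 - th) * (p - t)" by (simp add: algebra_simps)
  have "th * p + (1 - th) * t \<le> p" unfolding gap using th tp by simp
  then have upper: "limsup (\<lambda>n. P (ereal (l (s n))) (W (s n))) \<le> S \<infinity> B"
    unfolding p(1) by (rule order_trans[OF order_trans[OF up bd] ennreal_leI])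
  have full: "N2 UNIV w = ennreal B \<and> P \<infinity> w = S \<infinity> B"
    if ge: "S \<infinity> B \<le> limsup (\<lambda>n. P (ereal (l (s n))) (W (s n)))"
  proof -
    have "ennreal p \<le> ennreal (th * p + (1 - th) * t)"
      using order_trans[OF ge order_trans[OF up bd]] unfolding p(1) .
    moreover have "0 \<le> th * p + (1 - th) * t" using th t p by simp
    ultimately have "p \<le> th * p + (1 - th) * t" by (simp only: ennreal_le_iff)
    then have "(1 - th) * (p - t) \<le> 0" unfolding gap by simp
    then have "th = 1" using th tp by (simp add: mult_le_0_iff)
    then have NB': "N = B" using th by simp
    then have m: "N2 UNIV w = ennreal B" using N by simp
    have "S \<infinity> B \<le> P \<infinity> w" using order_trans[OF ge up] NB' by simp
    moreover have "P \<infinity> w \<le> S \<infinity> B" using m by (intro S_upper w) (simp add: Ivl_simps)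
    ultimately show ?thesis using m by simp
  qed
  show ?thesis using s w conv upper full by blast
qed

lemma S_tendsto: "((\<lambda>l. S (ereal l) B) \<longlongrightarrow> S \<infinity> B) at_top"
proof (rule order_tendstoI)
  fix a assume "a < S \<infinity> B"
  then obtain W where W: "W \<in> cone \<infinity>" "N2 UNIV W = ennreal B" "a < P \<infinity> W"
    unfolding S_def less_SUP_iff by (auto simp: Ivl_simps)
  obtain f where f: "f \<in> bumps" "N2 UNIV f = ennreal B" "a < P \<infinity> f"
    using bump_approx_P[OF W(1,2) B W(3)] by blast
  obtain b where b: "0 < b" "\<And>x. b \<le> \<bar>x\<bar> \<Longrightarrow> f x = 0" using bumps_support[OF f(1)] by blast
  have "\<forall>\<^sub>F l in at_top. a < P (ereal l) (periodize l f)"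
    by (rule periodize_P[OF f(1,3) b])
  then show "\<forall>\<^sub>F l in at_top. a < S (ereal l) B"
    using eventually_gt_at_top[of b]
  proof eventually_elim
    case (elim l)
    have l: "0 < l" using b elim by simp
    have "P (ereal l) (periodize l f) \<le> S (ereal l) B"
      using periodize_cone[OF f(1) l elim(2) b(2)] f(2) by (intro S_upper) simp_all
    with elim(1) show ?case by simp
  qed
next
  fix a assume a: "S \<infinity> B < a"
  show "\<forall>\<^sub>F l in at_top. S (ereal l) B < a"
  proof (rule ccontr)
    assume neg: "\<not> (\<forall>\<^sub>F l in at_top. S (ereal l) B < a)"
    have "\<exists>l\<ge>real (Suc n). a \<le> S (ereal l) B" for n
      using neg unfolding eventually_at_top_linorder by (meson not_le)
    then obtain l where l: "\<And>n. real (Suc n) \<le> l n" "\<And>n. a \<le> S (ereal (l n)) B" by metis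
    obtain d where d: "S \<infinity> B < d" "d < a" using dense[OF a] by blast
    have "\<exists>W. W \<in> cone (ereal (l n)) \<and> N2 (Ivl (ereal (l n))) W = ennreal B \<and> d < P (ereal (l n)) W" for n
    proof -
      have "d < S (ereal (l n)) B" using d(2) l(2)[of n] by (rule less_le_trans)
      then show ?thesis unfolding S_def less_SUP_iff by auto
    qed
    then obtain W where W: "\<And>n. W n \<in> cone (ereal (l n))" "\<And>n. N2 (Ivl (ereal (l n))) (W n) = ennreal B"
      and dW: "\<And>n. d < P (ereal (l n)) (W n)" by metis
    have l0: "0 < l n" for n using l(1)[of n] by simp
    have "real n \<le> l n" for n using l(1)[of n] by simp
    then have "filterlim l at_top sequentially"
      by (intro filterlim_at_top_mono[OF filterlim_real_sequentially] always_eventually allI)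
    from concentration[OF W(1) l0 this W(2)]
    obtain s :: "nat \<Rightarrow> nat" where "limsup (\<lambda>n. P (ereal (l (s n))) (W (s n))) \<le> S \<infinity> B" by blast
    moreover have "d \<le> limsup (\<lambda>n. P (ereal (l (s n))) (W (s n)))"
      by (intro le_Limsup always_eventually allI less_imp_le dW) simp
    ultimately show False using d(1) by simp
  qed
qed

text \<open>Maximizers have energies tending to \<open>S \<infinity> B\<close>, so \<open>concentration\<close> preserves their full mass in the
  limit.\<close>

lemma maximizers_converge:
  assumes W: "\<And>n. W n \<in> cone (ereal (l n))" and l: "\<And>n. 0 < l n" "filterlim l at_top sequentially"
    and mass: "\<And>n. N2 (Ivl (ereal (l n))) (W n) = ennreal B"
    and max: "\<And>n. P (ereal (l n)) (W n) = S (ereal (l n)) B"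
  obtains s :: "nat \<Rightarrow> nat" and w where "strict_mono s" "w \<in> cone \<infinity>" "N2 UNIV w = ennreal B" "P \<infinity> w = S \<infinity> B"
    "(\<lambda>n. N2 UNIV (\<lambda>x. trunc (ereal (l (s n))) (W (s n)) x - w x)) \<longlonglongrightarrow> 0"
proof -
  obtain s :: "nat \<Rightarrow> nat" and w where s: "strict_mono s" and w: "w \<in> cone \<infinity>" "\<And>x. 0 \<le> w x"
    and conv: "AE x in lebesgue. (\<lambda>n. trunc (ereal (l (s n))) (W (s n)) x) \<longlonglongrightarrow> w x"
    and full: "S \<infinity> B \<le> limsup (\<lambda>n. P (ereal (l (s n))) (W (s n))) \<longrightarrow> N2 UNIV w = ennreal B \<and> P \<infinity> w = S \<infinity> B"
    using concentration[OF W l mass] by blast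
  have ls: "filterlim (\<lambda>n. l (s n)) at_top sequentially"
    using filterlim_compose[OF l(2) filterlim_subseq[OF s]] .
  have "(\<lambda>n. P (ereal (l (s n))) (W (s n))) \<longlonglongrightarrow> S \<infinity> B"
    unfolding max using filterlim_compose[OF S_tendsto ls] .
  from lim_imp_Limsup[OF sequentially_bot this] full
  have w_max: "N2 UNIV w = ennreal B" "P \<infinity> w = S \<infinity> B" by simp_all
  have "(\<lambda>n. N2 UNIV (\<lambda>x. trunc (ereal (l (s n))) (W (s n)) x - w x)) \<longlonglongrightarrow> 0"
  proof (rule N2_scheffe)
    show "AE x in lebesgue. 0 \<le> trunc (ereal (l (s n))) (W (s n)) x" for n
    proof -
      have L: "0 < ereal (l (s n))" using l(1) by simp
      show ?thesis using cone_AE(1)[OF W L] by eventually_elim (simp add: trunc_def)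
    qed
    show "N2 UNIV (trunc (ereal (l (s n))) (W (s n))) = ennreal B" for n by (simp only: N2_trunc mass)
  qed (rule trunc_measurable[OF cone_basic(1)[OF W]] cone_basic(1)[OF w(1)] w(2) conv w_max)+
  then show thesis by (rule that[OF s w(1) w_max])
qed

end

text \<open>The test function must be a cone element of the prescribed mass, so that its energy is bounded by
  the supremum.\<close>

lemma tail_of_S_finite:
  assumes B: "0 < B" and pos: "0 < S \<infinity> B" and fin: "\<forall>\<^sub>F l in at_top. S (ereal l) B < \<infinity>"
  obtains c l where "0 < c"
    "tail_mass c l < \<infinity>"
proof -
  obtain W where "W \<in> cone \<infinity>" "N2 UNIV W = ennreal B"
    using pos unfolding S_def less_SUP_iff by (auto simp: Ivl_simps)
  then obtain f where f: "f \<in> bumps" "N2 UNIV f = ennreal B" using bump_of_mass[OF _ _ B] by blast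
  obtain b where b: "0 < b" "\<And>x. b \<le> \<bar>x\<bar> \<Longrightarrow> f x = 0" using bumps_support[OF f(1)] by blast
  have "\<forall>\<^sub>F l in at_top. S (ereal l) B < \<infinity> \<and> b < l"
    using fin eventually_gt_at_top[of b] by eventually_elim simp
  then obtain l where l: "S (ereal l) B < \<infinity>" "b < l" using eventually_happens by force
  have l0: "0 < l" using b l by simp
  have "P (ereal l) (periodize l f) \<le> S (ereal l) B"
    using periodize_cone[OF f(1) l0 l(2) b(2)] f(2) by (intro S_upper) simp_all
  then have "P (ereal l) (periodize l f) < \<infinity>" using l(1) by (rule le_less_trans)
  then show thesis using tail_of_finite[OF f(1) _ b l(2)] f(2) B that by auto
qed

text \<open>Once the functionals of a coupling are identified with those of a family, the two parts of the
  theorem are \<open>S_tendsto\<close> and \<open>maximizers_converge\<close>.\<close>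

lemma convergence_of_maximizers:
  fixes D :: coupling and K :: real
  assumes K: "0 < K"
    and P: "\<And>L W. 0 < L \<Longrightarrow> W \<in> cone L \<Longrightarrow> P_func D L W = P L W"
    and Q: "\<And>W. W \<in> cone \<infinity> \<Longrightarrow> Q_func D \<infinity> W = Q W"
    and gap: "Q_sup D K < P_sup D \<infinity> K"
    and tail: "(\<exists>c>0. \<exists>l. tail_mass c l < \<infinity>)
      \<or> (\<forall>\<^sub>F l in at_top. P_sup D (ereal l) K < \<infinity>)"
  shows "((\<lambda>L::real. P_sup D (ereal L) K) \<longlongrightarrow> P_sup D \<infinity> K) at_top \<and>
    (\<forall>W :: real \<Rightarrow> real \<Rightarrow> real.
      (\<forall>L\<ge>1. maximizer D (ereal L) K (W L)) \<longrightarrow>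
      (\<forall>l :: nat \<Rightarrow> real. (\<forall>n. l n \<ge> 1) \<and> filterlim l at_top sequentially \<longrightarrow>
        (\<exists>(s :: nat \<Rightarrow> nat) W_inf. strict_mono s \<and> maximizer D \<infinity> K W_inf \<and>
          (\<lambda>n. L2norm \<infinity> (\<lambda>x. trunc (ereal (l (s n))) (W (l (s n))) x - W_inf x))
            \<longlonglongrightarrow> 0)))"
proof -
  define B where "B = 2 * K"
  have B: "0 < B" using K by (simp add: B_def)
  have massK: "(L2norm L W)^2 / 2 = K \<longleftrightarrow> N2 (Ivl L) W = ennreal B" if W: "W \<in> cone L" for L W
    unfolding cone_basic(4)[OF W, symmetric] B_def using K by (subst ennreal_inj) auto
  have cone_K: "cone_K D L K = {W \<in> cone L. 0 < P L W \<and> N2 (Ivl L) W = ennreal B}" if "0 < L" for L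
    unfolding cone_K_def using massK P[OF that] by auto
  have P_sup: "P_sup D L K = S L B" if L: "0 < L" for L
  proof (rule antisym)
    show "P_sup D L K \<le> S L B"
      unfolding P_sup_def cone_K[OF L] by (intro SUP_least) (auto simp: P[OF L] intro: S_upper)
    show "S L B \<le> P_sup D L K"
      unfolding S_def
    proof (rule SUP_least)
      fix W assume W: "W \<in> {W \<in> cone L. N2 (Ivl L) W = ennreal B}"
      show "P L W \<le> P_sup D L K"
      proof (cases "P L W = 0")
        case False
        then have "W \<in> cone_K D L K" unfolding cone_K[OF L] using W by (simp add: zero_less_iff_neq_zero)
        then have "P_func D L W \<le> P_sup D L K" unfolding P_sup_def by (rule SUP_upper)
        then show ?thesis using W P[OF L] by simp
      qed simp
    qed
  qed
  have inf: "0 < (\<infinity>::ereal)" by simp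
  have sQ: "Q g \<le> Q_sup D K" if g: "g \<in> bumps" "N2 UNIV g = ennreal B" for g
  proof (cases "Q g = 0")
    case False
    have gc: "g \<in> cone \<infinity>" by (rule bumps_cone_inf[OF g(1)])
    have "0 < P \<infinity> g" using False Q_le_P[OF gc] by (simp add: zero_less_iff_neq_zero) (metis le_zero_eq)
    then have "g \<in> cone_K D \<infinity> K" unfolding cone_K[OF inf] using gc g by (simp add: Ivl_simps)
    then have "Q_func D \<infinity> g \<le> Q_sup D K" unfolding Q_sup_def by (rule SUP_upper)
    then show ?thesis using Q[OF gc] by simp
  qed simp
  have strict: "Q_sup D K < S \<infinity> B" using gap P_sup[OF inf] by simp
  have "\<exists>c>0. \<exists>l. tail_mass c l < \<infinity>"
    using tail
  proof
    assume "\<forall>\<^sub>F l in at_top. P_sup D (ereal l) K < \<infinity>"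
    then have fin: "\<forall>\<^sub>F l in at_top. S (ereal l) B < \<infinity>"
      using eventually_gt_at_top[of 0] by eventually_elim (simp add: P_sup)
    have pos: "0 < S \<infinity> B" using strict by (rule le_less_trans[rotated]) simp
    show ?thesis using tail_of_S_finite[OF B pos fin] by metis
  qed
  then obtain c l1 where c: "0 < c"
    and tl: "tail_mass c l1 < \<infinity>" by blast
  have lim: "((\<lambda>L::real. P_sup D (ereal L) K) \<longlongrightarrow> P_sup D \<infinity> K) at_top"
    unfolding P_sup[OF inf]
  proof (rule Lim_transform_eventually[OF S_tendsto[OF B sQ strict c tl]])
    show "\<forall>\<^sub>F L in at_top. S (ereal L) B = P_sup D (ereal L) K"
      using eventually_gt_at_top[of "0::real"] by eventually_elim (simp add: P_sup)
  qed
  have sub: "\<exists>(s :: nat \<Rightarrow> nat) W_inf. strict_mono s \<and> maximizer D \<infinity> K W_inf \<and>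
          (\<lambda>n. L2norm \<infinity> (\<lambda>x. trunc (ereal (l (s n))) (W (l (s n))) x - W_inf x)) \<longlonglongrightarrow> 0"
    if W: "\<forall>L\<ge>1. maximizer D (ereal L) K (W L)" and l: "\<And>n. l n \<ge> 1" "filterlim l at_top sequentially"
    for W :: "real \<Rightarrow> real \<Rightarrow> real" and l :: "nat \<Rightarrow> real"
  proof -
    have l0: "0 < l n" for n using l(1)[of n] by simp
    then have L: "0 < ereal (l n)" for n by simp
    have mx: "maximizer D (ereal (l n)) K (W (l n))" for n using W l(1) by blast
    have Wn: "W (l n) \<in> cone (ereal (l n))" "N2 (Ivl (ereal (l n))) (W (l n)) = ennreal B" for n
      using mx[of n] unfolding maximizer_def cone_K[OF L] by simp_all
    have Wmax: "P (ereal (l n)) (W (l n)) = S (ereal (l n)) B" for n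
      using mx[of n] P[OF L Wn(1)] unfolding maximizer_def P_sup[OF L] by simp
    obtain s :: "nat \<Rightarrow> nat" and w where s: "strict_mono s" and w: "w \<in> cone \<infinity>" "N2 UNIV w = ennreal B"
        "P \<infinity> w = S \<infinity> B"
      and w0: "(\<lambda>n. N2 UNIV (\<lambda>x. trunc (ereal (l (s n))) (W (l (s n))) x - w x)) \<longlonglongrightarrow> 0"
      using maximizers_converge[OF B sQ strict c tl Wn(1) l0 l(2) Wn(2) Wmax] by blast
    have "0 < S \<infinity> B" using strict by (rule le_less_trans[rotated]) simp
    then have "maximizer D \<infinity> K w"
      unfolding maximizer_def cone_K[OF inf] P_sup[OF inf] using w P[OF inf w(1)] by (simp add: Ivl_simps)
    moreover have "(\<lambda>n. L2norm \<infinity> (\<lambda>x. trunc (ereal (l (s n))) (W (l (s n))) x - w x)) \<longlonglongrightarrow> 0"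
    proof -
      define v where "v n x = trunc (ereal (l (s n))) (W (l (s n))) x - w x" for n x
      have tm: "trunc (ereal (l n)) (W (l n)) \<in> borel_measurable lebesgue" for n
        by (rule trunc_measurable[OF cone_basic(1)[OF Wn(1)]])
      have vm: "v n \<in> borel_measurable lebesgue" for n
        unfolding v_def using tm[of "s n"] cone_basic(1)[OF w(1)] by measurable
      have vf: "N2 UNIV (v n) < \<infinity>" for n
        unfolding v_def using tm[of "s n"] cone_basic(1)[OF w(1)] w(2)
        by (intro N2_diff_finite) (simp_all add: N2_trunc Wn)
      have "L2norm \<infinity> (v n) = sqrt (enn2real (N2 UNIV (v n)))" for n
      proof -
        have "ennreal ((L2norm \<infinity> (v n))^2) = N2 UNIV (v n)"
          using L2norm_N2[OF vm, of \<infinity> n] vf by (simp add: Ivl_simps)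
        moreover have "0 \<le> L2norm \<infinity> (v n)"
          unfolding L2norm_def set_lebesgue_integral_def by (intro real_sqrt_ge_zero integral_nonneg_AE) auto
        ultimately show ?thesis by (metis enn2real_ennreal real_sqrt_unique zero_le_power2)
      qed
      moreover have "(\<lambda>n. enn2real (N2 UNIV (v n))) \<longlonglongrightarrow> 0"
        using w0 unfolding v_def by (intro tendsto_enn2real) simp_all
      ultimately have "(\<lambda>n. L2norm \<infinity> (v n)) \<longlonglongrightarrow> 0"
        using tendsto_real_sqrt[of "\<lambda>n. enn2real (N2 UNIV (v n))" 0 sequentially] by simp
      then show ?thesis unfolding v_def .
    qed
    ultimately show ?thesis using s by blast
  qed
  from lim sub show ?thesis by blast
qed

end

section \<open>Discrete and continuous coupling\<close>

text \<open>The profile \<open>\<Phi>\<close> carries information on \<open>[0, \<infinity>)\<close> only. Averages of cone elements are nonnegative,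
  so the constant extension of the quotient to negative arguments does not affect any energy.\<close>

lemma quad_quotient_extended:
  assumes "weakly_super_quadratic \<Phi>"
  shows "mono (\<lambda>r. quad_quotient \<Phi> (max 0 r))" "continuous_on UNIV (\<lambda>r. quad_quotient \<Phi> (max 0 r))"
    "0 \<le> quad_quotient \<Phi> (max 0 r)"
proof -
  show "mono (\<lambda>r. quad_quotient \<Phi> (max 0 r))"
    by (intro monoI quad_quotient_mono[OF assms]) auto
  show "continuous_on UNIV (\<lambda>r. quad_quotient \<Phi> (max 0 r))"
    by (intro continuous_on_compose2[OF quad_quotient_continuous[OF assms]] continuous_intros) auto
  show "0 \<le> quad_quotient \<Phi> (max 0 r)"
    using quad_quotient_at_0_nonneg[OF assms] quad_quotient_mono[OF assms, of 0 "max 0 r"] by simp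
qed

text \<open>Sums over finitely many indices are finite, so both integrability conditions hold trivially.\<close>

lemma discrete_coupling_family:
  fixes M :: nat and \<xi> :: "nat \<Rightarrow> real" and \<Phi> :: "nat \<Rightarrow> real \<Rightarrow> real"
  defines "\<nu> \<equiv> count_space {1..M}" and "h \<equiv> \<lambda>m r. quad_quotient (\<Phi> m) (max 0 r)"
  assumes adm: "admissible (Discrete M \<xi> \<Phi>)"
  shows "coupling_family \<nu> \<xi> h"
    and "0 < L \<Longrightarrow> W \<in> cone L \<Longrightarrow> P_func (Discrete M \<xi> \<Phi>) L W = coupling_family.P \<nu> \<xi> h L W"
    and "W \<in> cone \<infinity> \<Longrightarrow> Q_func (Discrete M \<xi> \<Phi>) \<infinity> W = coupling_family.Q \<nu> \<xi> h W"
    and "coupling_family.tail_mass \<nu> \<xi> h 1 0 < \<infinity>"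
proof -
  have wsq: "weakly_super_quadratic (\<Phi> m)" and xi: "0 < \<xi> m" if "m \<in> {1..M}" for m
    using adm that by auto
  have int: "integral\<^sup>N \<nu> F = (\<Sum>m=1..M. F m)" for F :: "nat \<Rightarrow> ennreal"
    unfolding \<nu>_def by (rule nn_integral_count_space_finite) simp
  interpret coupling_family \<nu> \<xi> h
  proof
    show "\<xi> \<in> borel_measurable \<nu>" by (simp add: \<nu>_def)
    show "(\<lambda>(i, r). h i r) \<in> borel_measurable (\<nu> \<Otimes>\<^sub>M borel)"
      unfolding \<nu>_def
    proof (rule measurable_pair_measure_countable1)
      fix m assume m: "m \<in> {1..M}"
      show "(\<lambda>r. case (m, r) of (i, r) \<Rightarrow> h i r) \<in> borel_measurable borel"
        unfolding prod.case h_def by (intro borel_measurable_continuous_onI quad_quotient_extended wsq m)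
    qed simp
    show "(\<integral>\<^sup>+i. ennreal ((\<xi> i)^2 * h i (sqrt (\<xi> i) * sqrt B)) \<partial>\<nu>) < \<infinity>" for B
      unfolding int by simp
  qed (use xi in \<open>auto simp: \<nu>_def h_def intro!: quad_quotient_extended wsq\<close>)
  show "coupling_family \<nu> \<xi> h" by unfold_locales
  show "P_func (Discrete M \<xi> \<Phi>) L W = P L W" if L: "0 < L" and W: "W \<in> cone L"
  proof -
    have "ennreal (\<Phi> m (avg (\<xi> m) W x)) = dens (\<xi> m) (h m) W x" if m: "m \<in> {1..M}" for m x
    proof -
      have "0 \<le> avg (\<xi> m) W x" by (rule avg_nonneg[OF cone_AE(1)[OF W L]])
      then show ?thesis
        unfolding dens_def unfolding h_def using wsq_eq_quotient[OF wsq[OF m]] by simp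
    qed
    then show ?thesis
      unfolding P_def energy_def int by (auto intro!: sum.cong nn_integral_cong)
  qed
  show "Q_func (Discrete M \<xi> \<Phi>) \<infinity> W = Q W" if "W \<in> cone \<infinity>"
    unfolding Q_def int by (simp add: h_def quad_quotient_def Ivl_simps)
  show "tail_mass 1 0 < \<infinity>"
    unfolding tail_mass_def int by (simp add: ennreal_mult_less_top)
qed

text \<open>The weight \<open>\<beta> t\<close> multiplies the average, so \<open>\<alpha> t * \<Phi> (\<beta> t * r)\<close> is \<open>r^2\<close> times \<open>h t r\<close>. The
  integrability condition controls \<open>h\<close> because \<open>quad_quotient \<Phi> r \<le> \<Phi>' r / r\<close>.\<close>

lemma continuous_coupling_family:
  fixes \<alpha> \<beta> \<Phi> :: "real \<Rightarrow> real"
  defines "\<nu> \<equiv> restrict_space lebesgue {0<..}"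
    and "h \<equiv> \<lambda>t r. \<alpha> t * (\<beta> t)^2 * quad_quotient \<Phi> (max 0 (\<beta> t * r))"
  assumes adm: "admissible (Continuous \<alpha> \<beta> \<Phi>)"
  shows "coupling_family \<nu> (\<lambda>t. t) h"
    and "0 < L \<Longrightarrow> W \<in> cone L \<Longrightarrow> P_func (Continuous \<alpha> \<beta> \<Phi>) L W = coupling_family.P \<nu> (\<lambda>t. t) h L W"
    and "W \<in> cone \<infinity> \<Longrightarrow> Q_func (Continuous \<alpha> \<beta> \<Phi>) \<infinity> W = coupling_family.Q \<nu> (\<lambda>t. t) h W"
proof -
  have wsq: "weakly_super_quadratic \<Phi>" and nn: "0 < t \<Longrightarrow> 0 \<le> \<alpha> t" "0 < t \<Longrightarrow> 0 \<le> \<beta> t" for t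
    using adm by auto
  have am [measurable]: "\<alpha> \<in> borel_measurable \<nu>" and bm [measurable]: "\<beta> \<in> borel_measurable \<nu>"
    using adm by (auto simp: \<nu>_def)
  have fin: "(\<integral>\<^sup>+\<xi>\<in>{0<..}. ennreal ((\<xi> + \<xi>^2) * \<alpha> \<xi> * (\<beta> \<xi>)^2
           * (\<bar>hderiv \<Phi> (sqrt \<xi> * \<beta> \<xi> * sqrt (2 * K))\<bar> / (sqrt \<xi> * \<beta> \<xi> * sqrt (2 * K)))) \<partial>lebesgue) < \<infinity>"
    if "0 < K" for K
    using adm that by (simp add: Let_def)
  have sp: "space \<nu> = {0<..}" by (simp add: \<nu>_def space_restrict_space)
  have int: "integral\<^sup>N \<nu> F = (\<integral>\<^sup>+t\<in>{0<..}. F t \<partial>lebesgue)" for F :: "real \<Rightarrow> ennreal"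
    unfolding \<nu>_def by (rule nn_integral_restrict_space) simp
  note ext = quad_quotient_extended[OF wsq]
  interpret coupling_family \<nu> "\<lambda>t. t" h
  proof
    have "(\<lambda>x::real. x) \<in> borel_measurable lebesgue" by (intro measurable_completion) simp
    then show "(\<lambda>t. t) \<in> borel_measurable \<nu>" unfolding \<nu>_def by (rule measurable_restrict_space1)
    have [measurable]: "(\<lambda>r. quad_quotient \<Phi> (max 0 r)) \<in> borel_measurable borel"
      by (intro borel_measurable_continuous_onI ext)
    show "(\<lambda>(i, r). h i r) \<in> borel_measurable (\<nu> \<Otimes>\<^sub>M borel)"
      unfolding h_def split_beta by measurable
  next
    fix t assume "t \<in> space \<nu>"
    then have t: "0 < t" by (simp add: sp)
    then show "0 < t" .
    show "mono (h t)"
    proof (rule monoI)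
      fix r s :: real assume "r \<le> s"
      then have "\<beta> t * r \<le> \<beta> t * s" using nn(2)[OF t] by (rule mult_left_mono)
      then show "h t r \<le> h t s"
        unfolding h_def using nn[OF t] monoD[OF ext(1)] by (intro mult_left_mono) auto
    qed
    show "continuous_on UNIV (h t)"
      unfolding h_def
      by (intro continuous_intros continuous_on_compose2[OF quad_quotient_continuous[OF wsq]]) auto
    show "0 \<le> h t r" for r
      unfolding h_def using nn[OF t] ext(3) by simp
  next
    fix B :: real assume B: "0 < B"
    have "(\<integral>\<^sup>+t. ennreal (t^2 * h t (sqrt t * sqrt B)) \<partial>\<nu>)
      \<le> (\<integral>\<^sup>+\<xi>\<in>{0<..}. ennreal ((\<xi> + \<xi>^2) * \<alpha> \<xi> * (\<beta> \<xi>)^2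
           * (\<bar>hderiv \<Phi> (sqrt \<xi> * \<beta> \<xi> * sqrt (2 * (B / 2)))\<bar> / (sqrt \<xi> * \<beta> \<xi> * sqrt (2 * (B / 2))))) \<partial>lebesgue)"
      unfolding int
    proof (intro nn_integral_mono)
      fix t
      show "ennreal (t^2 * h t (sqrt t * sqrt B)) * indicator {0<..} t
        \<le> ennreal ((t + t^2) * \<alpha> t * (\<beta> t)^2
           * (\<bar>hderiv \<Phi> (sqrt t * \<beta> t * sqrt (2 * (B / 2)))\<bar> / (sqrt t * \<beta> t * sqrt (2 * (B / 2))))) * indicator {0<..} t"
      proof (cases "0 < t")
        case True
        define r where "r = sqrt t * \<beta> t * sqrt B"
        have r: "0 \<le> r" using True nn(2)[OF True] B by (simp add: r_def)
        have "t^2 * h t (sqrt t * sqrt B) \<le> (t + t^2) * \<alpha> t * (\<beta> t)^2 * (\<bar>hderiv \<Phi> r\<bar> / r)"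
        proof (cases "\<beta> t = 0")
          case False
          then have "0 < r" using True nn(2)[OF True] B by (simp add: r_def)
          have k: "0 \<le> quad_quotient \<Phi> r" using ext(3)[of r] r by simp
          have "quad_quotient \<Phi> r \<le> \<bar>hderiv \<Phi> r\<bar> / r"
            using quad_quotient_bounds(2)[OF wsq \<open>0 < r\<close>] wsq_facts(4)[OF wsq r] \<open>0 < r\<close>
            by (simp add: field_simps)
          then have "(t^2 * (\<alpha> t * (\<beta> t)^2)) * quad_quotient \<Phi> r \<le> ((t + t^2) * (\<alpha> t * (\<beta> t)^2)) * (\<bar>hderiv \<Phi> r\<bar> / r)"
            using True nn[OF True] k by (intro mult_mono mult_right_mono) auto
          moreover have "max 0 (\<beta> t * (sqrt t * sqrt B)) = r" using r by (simp add: r_def mult_ac)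
          ultimately show ?thesis by (simp add: h_def mult.assoc)
        qed (simp add: h_def)
        then show ?thesis using True by (simp add: r_def ennreal_leI)
      qed simp
    qed
    also have "\<dots> < \<infinity>" using B by (intro fin) simp
    finally show "(\<integral>\<^sup>+t. ennreal (t^2 * h t (sqrt t * sqrt B)) \<partial>\<nu>) < \<infinity>" .
  qed
  show "coupling_family \<nu> (\<lambda>t. t) h" by unfold_locales
  show "P_func (Continuous \<alpha> \<beta> \<Phi>) L W = P L W" if L: "0 < L" and W: "W \<in> cone L"
  proof -
    have "ennreal (\<alpha> t * \<Phi> (\<beta> t * avg t W x)) = dens t (h t) W x" if t: "0 < t" for t x
    proof -
      have "0 \<le> \<beta> t * avg t W x" using nn(2)[OF t] avg_nonneg[OF cone_AE(1)[OF W L]] by simp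
      then show ?thesis
        unfolding dens_def unfolding h_def using wsq_eq_quotient[OF wsq, of "\<beta> t * avg t W x"]
        by (simp add: power_mult_distrib mult_ac)
    qed
    then show ?thesis
      unfolding P_def energy_def int P_func.simps
      by (intro nn_integral_cong) (auto simp: indicator_def)
  qed
  show "Q_func (Continuous \<alpha> \<beta> \<Phi>) \<infinity> W = Q W" if W: "W \<in> cone \<infinity>"
  proof -
    define I where "I t = (\<integral>\<^sup>+x. ennreal ((avg t W x)^2) \<partial>lebesgue)" for t
    have Im [measurable]: "I \<in> borel_measurable \<nu>"
      unfolding I_def[abs_def] by (rule avg_mass_measurable[OF cone_basic(1)[OF W]])
    have k: "0 \<le> quad_quotient \<Phi> 0" by (rule quad_quotient_at_0_nonneg[OF wsq])
    have "Q W = (\<integral>\<^sup>+t. ennreal (quad_quotient \<Phi> 0) * (ennreal (\<alpha> t * (\<beta> t)^2) * I t) \<partial>\<nu>)"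
      unfolding Q_def
    proof (intro nn_integral_cong)
      fix t assume "t \<in> space \<nu>"
      then have "0 < t" by (simp add: sp)
      then show "ennreal (h t 0) * (\<integral>\<^sup>+x. ennreal ((avg t W x)^2) \<partial>lebesgue)
          = ennreal (quad_quotient \<Phi> 0) * (ennreal (\<alpha> t * (\<beta> t)^2) * I t)"
        using nn[of t] k by (simp add: h_def I_def ennreal_mult mult_ac)
    qed
    also have "\<dots> = ennreal (quad_quotient \<Phi> 0) * (\<integral>\<^sup>+t. ennreal (\<alpha> t * (\<beta> t)^2) * I t \<partial>\<nu>)"
      by (intro nn_integral_cmult) measurable
    finally show ?thesis
      by (simp add: int I_def quad_quotient_def Ivl_simps)
  qed
qed

theorem proposition10:
  fixes D :: coupling and K :: real
  assumes "admissible D"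
    and "K > 0"
    and "P_sup D \<infinity> K > Q_sup D K"
    and "is_Continuous D \<longrightarrow> (\<forall>\<^sub>F L in at_top. P_sup D (ereal L) K < \<infinity>)"
  shows "((\<lambda>L::real. P_sup D (ereal L) K) \<longlongrightarrow> P_sup D \<infinity> K) at_top \<and>
    (\<forall>W :: real \<Rightarrow> real \<Rightarrow> real.
      (\<forall>L\<ge>1. maximizer D (ereal L) K (W L)) \<longrightarrow>
      (\<forall>l :: nat \<Rightarrow> real. (\<forall>n. l n \<ge> 1) \<and> filterlim l at_top sequentially \<longrightarrow>
        (\<exists>(s :: nat \<Rightarrow> nat) W_inf. strict_mono s \<and> maximizer D \<infinity> K W_inf \<and>
          (\<lambda>n. L2norm \<infinity> (\<lambda>x. trunc (ereal (l (s n))) (W (l (s n))) x - W_inf x))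
            \<longlonglongrightarrow> 0)))"
proof (cases D)
  case (Discrete M \<xi> \<Phi>)
  note adm = assms(1)[unfolded Discrete]
  have "\<exists>c>0. \<exists>l. coupling_family.tail_mass (count_space {1..M}) \<xi>
      (\<lambda>m r. quad_quotient (\<Phi> m) (max 0 r)) c l < \<infinity>"
    using discrete_coupling_family(4)[OF adm] zero_less_one by blast
  then show ?thesis
    unfolding Discrete using assms(2,3)[unfolded Discrete]
    by (intro coupling_family.convergence_of_maximizers[OF discrete_coupling_family(1)[OF adm]]
        discrete_coupling_family(2,3)[OF adm] disjI1)
next
  case (Continuous \<alpha> \<beta> \<Phi>)
  note adm = assms(1)[unfolded Continuous]
  have "\<forall>\<^sub>F L in at_top. P_sup D (ereal L) K < \<infinity>" using assms(4) Continuous by simp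
  then show ?thesis
    unfolding Continuous using assms(2,3)[unfolded Continuous]
    by (intro coupling_family.convergence_of_maximizers[OF continuous_coupling_family(1)[OF adm]]
        continuous_coupling_family(2,3)[OF adm] disjI2)
qed

end
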